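(* Let $\theta\in[0,2\pi]$, let $Z=(X,Y)$ be the solution of $$dX_t=-\tfrac12X_t\,dt-Y_t\,dW_t,\qquad dY_t=-\tfrac12Y_t\,dt+X_t\,dW_t,\qquad Z_0=(\cos\theta,\sin\theta),$$ where $W$ is a standard one-dimensional Brownian motion, and let $Z^n=(X^n,Y^n)$ be the Euler scheme (with step $T/n$) associated with $Z$. For $\alpha\in[1/2,1]$ let $f_\alpha(z)=\big||z|^2-1\big|^{2\alpha}$, $z\in\mathbb{R}^2$. Then for $\alpha\in[1/2,1]$, $$n^{\alpha}\,\mathbb{E}\big(f_\alpha(Z^n_t)-f_\alpha(Z_t)\big)\longrightarrow(2t)^{\alpha}\,\mathbb{E}|G|^{2\alpha}\quad\text{as }n\to\infty,\qquad t\ge0,$$ where $G$ is a standard normal random variable.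
   Context: $T>0$ is the time horizon and $|z|$ is the Euclidean norm on $\mathbb{R}^2$. The Euler scheme with step $\delta=T/n$ is the continuous process with $Z^n_0=Z_0$ and $dX^n_t=-\tfrac12X^n_{\eta_n(t)}\,dt-Y^n_{\eta_n(t)}\,dW_t$, $dY^n_t=-\tfrac12Y^n_{\eta_n(t)}\,dt+X^n_{\eta_n(t)}\,dW_t$, where $\eta_n(t)=[t/\delta]\delta$ and $[\cdot]$ is the integer part.
   Formalization: The limit is proved with constant (2Tt)^α E|G|^{2α} in place of (2t)^α E|G|^{2α}: with step T/n the printed constant is correct only for T = 1 (or t = 0), e.g. for α = 1 the limit is 2Tt; T = 1 gives the printed formula. *)

theory Defs
  imports "HOL-Probability.Probability"
begin

section \<open>Filtered probability spaces and Brownian motion\<close>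

text \<open>
  The time index of a filtration is the type of reals, but everything below only looks at times
  in \<open>[0,\<infinity>)\<close>; a filtration indexed by \<open>[0,\<infinity>)\<close> extends to negative times by \<open>F t = F 0\<close>.
  The usual conditions are not imposed, so they may or may not hold.
\<close>

locale filtered_prob_space = prob_space M + filtration "space M" F
  for M :: "'a measure" and F :: "real \<Rightarrow> 'a measure" +
  assumes subalgebra_F: "\<And>t. subalgebra M (F t)"

definition adapted_process :: "(real \<Rightarrow> 'a measure) \<Rightarrow> (real \<Rightarrow> 'a \<Rightarrow> real) \<Rightarrow> bool" where
  "adapted_process F X \<longleftrightarrow> (\<forall>t\<ge>0. X t \<in> borel_measurable (F t))"

definition continuous_process :: "'a measure \<Rightarrow> (real \<Rightarrow> 'a \<Rightarrow> real) \<Rightarrow> bool" where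
  "continuous_process M X \<longleftrightarrow> (AE \<omega> in M. continuous_on {0..} (\<lambda>t. X t \<omega>))"

definition standard_brownian_motion ::
  "'a measure \<Rightarrow> (real \<Rightarrow> 'a measure) \<Rightarrow> (real \<Rightarrow> 'a \<Rightarrow> real) \<Rightarrow> bool" where
  "standard_brownian_motion M F W \<longleftrightarrow>
     adapted_process F W \<and> continuous_process M W \<and> (AE \<omega> in M. W 0 \<omega> = 0) \<and>
     (\<forall>s t. 0 \<le> s \<and> s < t \<longrightarrow>
        distributed M lborel (\<lambda>\<omega>. W t \<omega> - W s \<omega>) (normal_density 0 (sqrt (t - s))) \<and>
        prob_space.indep_set M (sets (F s))
          {(\<lambda>\<omega>. W t \<omega> - W s \<omega>) -` B \<inter> space M | B. B \<in> sets borel})"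

section \<open>The Ito integral\<close>

text \<open>
  The triple \<open>(m, \<tau>, \<xi>)\<close> encodes the simple process
  \<open>H s = (\<Sum>i<m. \<xi> i * 1_{(\<tau> i, \<tau> (i+1)]}(s))\<close> with bounded \<open>F (\<tau> i)\<close>-measurable \<open>\<xi> i\<close>.
\<close>

definition simple_process ::
  "(real \<Rightarrow> 'a measure) \<Rightarrow> nat \<Rightarrow> (nat \<Rightarrow> real) \<Rightarrow> (nat \<Rightarrow> 'a \<Rightarrow> real) \<Rightarrow> bool" where
  "simple_process F m \<tau> \<xi> \<longleftrightarrow>
     0 \<le> \<tau> 0 \<and>
     (\<forall>i<m. \<tau> i < \<tau> (Suc i) \<and> \<xi> i \<in> borel_measurable (F (\<tau> i)) \<and>
        (\<exists>C. \<forall>\<omega>\<in>space (F (\<tau> i)). \<bar>\<xi> i \<omega>\<bar> \<le> C))"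

definition simple_path ::
  "nat \<Rightarrow> (nat \<Rightarrow> real) \<Rightarrow> (nat \<Rightarrow> 'a \<Rightarrow> real) \<Rightarrow> real \<Rightarrow> 'a \<Rightarrow> real" where
  "simple_path m \<tau> \<xi> s \<omega> = (\<Sum>i<m. \<xi> i \<omega> * indicator {\<tau> i<..\<tau> (Suc i)} s)"

definition simple_integral ::
  "(real \<Rightarrow> 'a \<Rightarrow> real) \<Rightarrow> nat \<Rightarrow> (nat \<Rightarrow> real) \<Rightarrow> (nat \<Rightarrow> 'a \<Rightarrow> real) \<Rightarrow> real \<Rightarrow> 'a \<Rightarrow> real" where
  "simple_integral W m \<tau> \<xi> t \<omega> =
     (\<Sum>i<m. \<xi> i \<omega> * (W (min t (\<tau> (Suc i))) \<omega> - W (min t (\<tau> i)) \<omega>))"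

text \<open>
  \<open>has_ito_integral M F W H t I\<close> says that \<open>I\<close> is (a version of) \<open>\<integral>\<^sub>0\<^sup>t H dW\<close>. As usual,
  the integrands are the measurable adapted processes that are almost surely square integrable
  on \<open>[0,t]\<close>, and the integral is the limit in probability of the integrals of simple processes
  \<open>S k\<close> for which \<open>\<integral>\<^sub>0\<^sup>t (S k - H)\<^sup>2 ds\<close> tends to 0 in probability; it does not depend on the
  choice of \<open>S\<close>. The time integrals are taken in \<open>[0,\<infinity>]\<close>, so there is no junk value
  if the integrand is not integrable.
\<close>

definition has_ito_integral ::
  "'a measure \<Rightarrow> (real \<Rightarrow> 'a measure) \<Rightarrow> (real \<Rightarrow> 'a \<Rightarrow> real) \<Rightarrow> (real \<Rightarrow> 'a \<Rightarrow> real) \<Rightarrow>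
   real \<Rightarrow> ('a \<Rightarrow> real) \<Rightarrow> bool" where
  "has_ito_integral M F W H t I \<longleftrightarrow>
     adapted_process F H \<and>
     (\<lambda>(s, \<omega>). H s \<omega>) \<in> borel_measurable (restrict_space borel {0..} \<Otimes>\<^sub>M M) \<and>
     (AE \<omega> in M. (\<integral>\<^sup>+ s \<in> {0..t}. ennreal ((H s \<omega>)\<^sup>2) \<partial>lborel) < \<infinity>) \<and>
     I \<in> borel_measurable M \<and>
     (\<exists>m \<tau> \<xi>.
        (\<forall>k::nat. simple_process F (m k) (\<tau> k) (\<xi> k)) \<and>
        (\<forall>\<epsilon>>0. (\<lambda>k. measure M {\<omega> \<in> space M.
            (\<integral>\<^sup>+ s \<in> {0..t}. ennreal ((simple_path (m k) (\<tau> k) (\<xi> k) s \<omega> - H s \<omega>)\<^sup>2) \<partial>lborel)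
              > ennreal \<epsilon>}) \<longlonglongrightarrow> 0) \<and>
        (\<forall>\<epsilon>>0. (\<lambda>k. measure M {\<omega> \<in> space M.
            \<bar>simple_integral W (m k) (\<tau> k) (\<xi> k) t \<omega> - I \<omega>\<bar> > \<epsilon>}) \<longlonglongrightarrow> 0))"

text \<open>
  \<open>has_ito_differential M F W X a b\<close> renders \<open>dX\<^sub>t = a\<^sub>t dt + b\<^sub>t dW\<^sub>t\<close> on \<open>[0,\<infinity>)\<close> for a
  continuous adapted process \<open>X\<close>.
\<close>

definition has_ito_differential ::
  "'a measure \<Rightarrow> (real \<Rightarrow> 'a measure) \<Rightarrow> (real \<Rightarrow> 'a \<Rightarrow> real) \<Rightarrow> (real \<Rightarrow> 'a \<Rightarrow> real) \<Rightarrow>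
   (real \<Rightarrow> 'a \<Rightarrow> real) \<Rightarrow> (real \<Rightarrow> 'a \<Rightarrow> real) \<Rightarrow> bool" where
  "has_ito_differential M F W X a b \<longleftrightarrow>
     adapted_process F X \<and> continuous_process M X \<and>
     (\<exists>J. \<forall>t\<ge>0. has_ito_integral M F W b t (J t) \<and>
        (AE \<omega> in M. set_integrable lborel {0..t} (\<lambda>s. a s \<omega>) \<and>
           X t \<omega> = X 0 \<omega> + (LINT s:{0..t}|lborel. a s \<omega>) + J t \<omega>))"

section \<open>Brownian motion on the circle and its Euler scheme\<close>

definition circle_sde_solution ::
  "'a measure \<Rightarrow> (real \<Rightarrow> 'a measure) \<Rightarrow> (real \<Rightarrow> 'a \<Rightarrow> real) \<Rightarrow> real \<Rightarrow>
   (real \<Rightarrow> 'a \<Rightarrow> real^2) \<Rightarrow> bool" where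
  "circle_sde_solution M F W \<theta> Z \<longleftrightarrow>
     has_ito_differential M F W (\<lambda>t \<omega>. Z t \<omega> $ 1)
       (\<lambda>t \<omega>. - (1/2) * Z t \<omega> $ 1) (\<lambda>t \<omega>. - Z t \<omega> $ 2) \<and>
     has_ito_differential M F W (\<lambda>t \<omega>. Z t \<omega> $ 2)
       (\<lambda>t \<omega>. - (1/2) * Z t \<omega> $ 2) (\<lambda>t \<omega>. Z t \<omega> $ 1) \<and>
     (AE \<omega> in M. Z 0 \<omega> = vector [cos \<theta>, sin \<theta>])"

definition grid_floor :: "real \<Rightarrow> real \<Rightarrow> real" where
  "grid_floor \<delta> t = of_int \<lfloor>t / \<delta>\<rfloor> * \<delta>"

definition circle_euler_scheme ::
  "'a measure \<Rightarrow> (real \<Rightarrow> 'a measure) \<Rightarrow> (real \<Rightarrow> 'a \<Rightarrow> real) \<Rightarrow> (real \<Rightarrow> 'a \<Rightarrow> real^2) \<Rightarrow>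
   real \<Rightarrow> (real \<Rightarrow> 'a \<Rightarrow> real^2) \<Rightarrow> bool" where
  "circle_euler_scheme M F W Z \<delta> Z' \<longleftrightarrow>
     has_ito_differential M F W (\<lambda>t \<omega>. Z' t \<omega> $ 1)
       (\<lambda>t \<omega>. - (1/2) * Z' (grid_floor \<delta> t) \<omega> $ 1) (\<lambda>t \<omega>. - Z' (grid_floor \<delta> t) \<omega> $ 2) \<and>
     has_ito_differential M F W (\<lambda>t \<omega>. Z' t \<omega> $ 2)
       (\<lambda>t \<omega>. - (1/2) * Z' (grid_floor \<delta> t) \<omega> $ 2) (\<lambda>t \<omega>. Z' (grid_floor \<delta> t) \<omega> $ 1) \<and>
     (AE \<omega> in M. Z' 0 \<omega> = Z 0 \<omega>)"

definition f_circle :: "real \<Rightarrow> real^2 \<Rightarrow> real" where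
  "f_circle \<alpha> z = \<bar>(norm z)\<^sup>2 - 1\<bar> powr (2 * \<alpha>)"

end

theory Submission
  imports Defs
begin

text \<open>
  In one step of length \<open>h\<close> with increment \<open>D\<close> of \<open>W\<close>, the Euler scheme multiplies the squared norm
  by \<open>(1 - h/2)\<^sup>2 + D\<^sup>2 = 1 + (D\<^sup>2 - h) + h\<^sup>2/4\<close>, because \<open>(-y, x)\<close> is orthogonal to \<open>(x, y)\<close>. Hence
  \<open>|Z\<^sup>n\<^sub>t|\<^sup>2\<close> is a product of independent factors whose deviation from 1 equals the sum of the
  \<open>D\<^sup>2 - h\<close> up to an error of order \<open>1/n\<close> in \<open>L\<^sup>2\<close>. Multiplied by \<open>sqrt n\<close>, this sum is
  asymptotically normal with variance \<open>2 T t\<close> by the central limit theorem, and its absolute moments of order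
  \<open>2 \<alpha> \<le> 2\<close> converge as well because the second moments do.

  That \<open>|Z\<^sub>t| = 1\<close> is obtained without Ito's formula: on a fine grid \<open>Z\<close> is uniformly close, in
  probability, to the sums in which its coefficients are frozen at the left end points, and for these sums
  the increments of the squared norm can be written down exactly. The passage to the limit rests on a maximal
  inequality for Ito integrals which needs no moments of the integrand.
\<close>

section \<open>A maximal inequality for stochastic sums\<close>

text \<open>The definition of the Ito integral provides, for each time separately, only a limit in
  probability, and no moment of \<open>Z\<close> is known beforehand. The estimates therefore have
  Lenglart's form: the probability of a large sum is at most the probability that its quadratic
  variation exceeds \<open>\<eta>\<close>, plus a multiple of \<open>\<eta>\<close>. They concern
  finite sets of times, because the integrals at different times are chosen separately, each up to a
  null set.

  The constant: with step \<open>T / n\<close> there are about \<open>n t / T\<close> steps up to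
  \<open>t\<close>, each centred square has variance \<open>2 (T / n)^2\<close>, and multiplication
  by \<open>n\<close> gives \<open>2 T t\<close>. So the limit carries a factor \<open>T\<close>; it
  reads \<open>(2 t)^\<alpha>\<close> when \<open>T = 1\<close>.

  In general \<open>t\<close> is not a grid point. The grid is stopped at \<open>t\<close>, and its
  possibly shorter last step costs only order \<open>1/n\<close> in L2. The increments for different
  \<open>n\<close> form a triangular array; each sum is replaced by one with the same law, built
  from one fixed i.i.d. normal sequence, to which the central limit theorem applies.\<close>

lemmas borel_arith_measurable = borel_measurable_add borel_measurable_diff borel_measurable_times
  borel_measurable_divide borel_measurable_power borel_measurable_sum borel_measurable_prod
  borel_measurable_const

text \<open>The sum is stopped by a predictable rule, which makes the coefficients bounded.\<close>

lemma (in prob_space) stopped_maximal_inequality: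
  fixes A :: "nat \<Rightarrow> 'a measure" and \<xi> D :: "nat \<Rightarrow> 'a \<Rightarrow> real" and v :: "nat \<Rightarrow> real"
  assumes sub: "\<And>j. subalgebra M (A j)"
    and mono: "\<And>j. sets (A j) \<subseteq> sets (A (Suc j))"
    and \<xi>: "\<And>j. j < n \<Longrightarrow> \<xi> j \<in> borel_measurable (A j)"
    and D: "\<And>j. j < n \<Longrightarrow> D j \<in> borel_measurable (A (Suc j))"
    and v: "\<And>j. j < n \<Longrightarrow> 0 < v j"
    and D2: "\<And>j. j < n \<Longrightarrow> integrable M (\<lambda>w. (D j w)\<^sup>2)"
    and mart: "\<And>j z C. j < n \<Longrightarrow> z \<in> borel_measurable (A j) \<Longrightarrow> (\<And>w. \<bar>z w\<bar> \<le> C)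
      \<Longrightarrow> expectation (\<lambda>w. z w * D j w) = 0"
    and var: "\<And>j z C. j < n \<Longrightarrow> z \<in> borel_measurable (A j) \<Longrightarrow> (\<And>w. \<bar>z w\<bar> \<le> C)
      \<Longrightarrow> expectation (\<lambda>w. z w * (D j w)\<^sup>2) = expectation z * v j"
    and \<epsilon>: "0 < \<epsilon>" and \<eta>: "0 < \<eta>"
  shows "\<P>(w in M. \<exists>k\<le>n. \<bar>\<Sum>j<k. \<xi> j w * D j w\<bar> > \<epsilon>)
    \<le> \<P>(w in M. (\<Sum>j<n. (\<xi> j w)\<^sup>2 * v j) > \<eta>) + \<eta> / \<epsilon>\<^sup>2"
proof -
  define S where "S k w = (\<Sum>j<k. \<xi> j w * D j w)" for k w
  define Q where "Q k w = (\<Sum>j<k. (\<xi> j w)\<^sup>2 * v j)" for k w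
  \<comment> \<open>\<open>Q (Suc k)\<close> involves only \<open>\<xi> 0\<close> to
    \<open>\<xi> k\<close>, so it is already known at stage \<open>k\<close>. Looking one step ahead
    switches a coefficient off before it can push the quadratic variation over
    \<open>\<eta>\<close>.\<close>
  define I where "I k w = (if Q (Suc k) w \<le> \<eta> \<and> (\<forall>i\<le>k. \<bar>S i w\<bar> \<le> \<epsilon>) then 1 else 0::real)" for k w
  define T where "T k w = (\<Sum>j<k. \<xi> j w * I j w * D j w)" for k w
  have mono': "sets (A i) \<subseteq> sets (A j)" if "i \<le> j" for i j
    using that by (induction rule: dec_induct) (use mono in auto)
  have lift: "f \<in> borel_measurable (A j)" if "f \<in> borel_measurable (A i)" "i \<le> j"
    for f :: "'a \<Rightarrow> real" and i j
    by (rule measurable_from_subalg[OF _ that(1)])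
      (use sub[of i] sub[of j] mono'[OF that(2)] in \<open>auto simp: subalgebra_def\<close>)
  have liftM: "f \<in> borel_measurable M" if "f \<in> borel_measurable (A i)"
    for f :: "'a \<Rightarrow> real" and i
    by (rule measurable_from_subalg[OF sub that])
  have S_meas: "S k \<in> borel_measurable (A k)" if "k \<le> n" for k
    unfolding S_def
    by (intro borel_measurable_sum borel_measurable_times lift[OF \<xi>] lift[OF D]) (use that in auto)
  have Q_meas: "Q k \<in> borel_measurable (A (k - 1))" if "k \<le> n" for k
    unfolding Q_def
    by (intro borel_arith_measurable lift[OF \<xi>])
      (use that in auto)
  have I_meas: "I k \<in> borel_measurable (A k)" if "k < n" for k
  proof -
    have [measurable]: "Q (Suc k) \<in> borel_measurable (A k)" using Q_meas[of "Suc k"] that by auto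
    have [measurable]: "(\<lambda>w. S i w) \<in> borel_measurable (A k)" if "i \<in> {..k}" for i
      using lift[OF S_meas, of i k] \<open>k < n\<close> that by auto
    have "(\<lambda>w. if Q (Suc k) w \<le> \<eta> \<and> (\<forall>i\<in>{..k}. \<bar>S i w\<bar> \<le> \<epsilon>) then 1 else 0::real) \<in> borel_measurable (A k)"
      by measurable
    then show ?thesis by (simp add: I_def[abs_def])
  qed
  have I_down: "I j w = 1" if "I k w = 1" "j \<le> k" "k < n" for j k w
  proof -
    have "Q (Suc j) w \<le> Q (Suc k) w" unfolding Q_def
      using that by (intro sum_mono2) (auto intro!: mult_nonneg_nonneg v[THEN less_imp_le])
    then show ?thesis using that by (auto simp: I_def split: if_splits)
  qed
  have I01: "I j w = 0 \<or> I j w = 1" for j w by (auto simp: I_def)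
  have TS: "T k w = S k w" if "k < n" "I k w = 1" for k w
    unfolding T_def S_def using I_down[OF that(2) _ that(1)] by (intro sum.cong) auto
  have T_bd: "\<bar>T k w * I k w\<bar> \<le> \<epsilon>" if "k < n" for k w
    using I01[of k w] TS[OF that, of w] \<epsilon> by (auto simp: I_def split: if_splits)
  have xi_bd: "\<bar>\<xi> k w * I k w\<bar> \<le> sqrt (\<eta> / v k)" and xi2: "(\<xi> k w * I k w)\<^sup>2 \<le> \<eta> / v k"
    if k: "k < n" for k w
  proof -
    have "(\<xi> k w * I k w)\<^sup>2 \<le> \<eta> / v k"
    proof (cases "I k w = 1")
      case True
      have "(\<xi> k w)\<^sup>2 * v k \<le> Q (Suc k) w" unfolding Q_def
        by (rule member_le_sum) (use k in \<open>auto intro!: mult_nonneg_nonneg v[THEN less_imp_le]\<close>)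
      then show ?thesis using True v[OF k] by (auto simp: I_def field_simps split: if_splits)
    next
      case False
      then show ?thesis using I01[of k w] v[OF k] \<eta> by auto
    qed
    then show "(\<xi> k w * I k w)\<^sup>2 \<le> \<eta> / v k" "\<bar>\<xi> k w * I k w\<bar> \<le> sqrt (\<eta> / v k)"
      by (auto simp: real_le_rsqrt)
  qed
  have T_meas: "T k \<in> borel_measurable (A k)" if "k \<le> n" for k
    unfolding T_def
    by (intro borel_measurable_sum borel_measurable_times lift[OF \<xi>] lift[OF D] lift[OF I_meas])
      (use that in auto)
  \<comment> \<open>Expanding the square of \<open>T (Suc k)\<close> produces \<open>z\<close> times
    \<open>D k\<close> and \<open>\<kappa>\<close> times the square of \<open>D k\<close>. Thanks to
    the factor \<open>I k\<close> both \<open>z\<close> and \<open>\<kappa>\<close> are bounded, as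
    \<open>mart\<close> and \<open>var\<close> require.\<close>
  have ET: "integrable M (\<lambda>w. (T k w)\<^sup>2) \<and> expectation (\<lambda>w. (T k w)\<^sup>2) =
    (\<Sum>j<k. expectation (\<lambda>w. (\<xi> j w * I j w)\<^sup>2) * v j)" if "k \<le> n" for k
    using that
  proof (induction k)
    case 0 then show ?case by (simp add: T_def)
  next
    case (Suc k)
    then have k: "k < n" by simp

    define z where "z w = (T k w * I k w) * (\<xi> k w * I k w)" for w
    have z_meas: "z \<in> borel_measurable (A k)"
      unfolding z_def[abs_def] by (intro borel_measurable_times T_meas \<xi> I_meas) (use k in auto)
    have z_bd: "\<bar>z w\<bar> \<le> \<epsilon> * sqrt (\<eta> / v k)" for w
      unfolding z_def abs_mult[of "T k w * I k w"]
      by (intro mult_mono T_bd xi_bd k) (use \<epsilon> in auto)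
    define \<kappa> where "\<kappa> w = (\<xi> k w * I k w)\<^sup>2" for w
    have \<kappa>_meas: "\<kappa> \<in> borel_measurable (A k)"
      unfolding \<kappa>_def[abs_def] by (intro borel_measurable_times borel_measurable_power \<xi> I_meas k)
    have \<kappa>_bd: "\<bar>\<kappa> w\<bar> \<le> \<eta> / v k" for w
      using xi2[OF k, of w] by (auto simp: \<kappa>_def)
    have [measurable]: "D k \<in> borel_measurable M" "z \<in> borel_measurable M" "\<kappa> \<in> borel_measurable M"
      by (fact liftM[OF D[OF k]] liftM[OF z_meas] liftM[OF \<kappa>_meas])+
    have int_bd: "integrable M (\<lambda>w. b w * f w)" if "integrable M f" "b \<in> borel_measurable M" "\<And>w. \<bar>b w\<bar> \<le> C"
      for b f :: "'a \<Rightarrow> real" and C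
    proof (rule Bochner_Integration.integrable_bound[where f="\<lambda>w. C * f w"])
      show "AE x in M. norm (b x * f x) \<le> norm (C * f x)"
        by (intro AE_I2) (simp add: abs_mult mult_right_mono order_trans[OF that(3) abs_ge_self])
    qed (use that in auto)
    have D1: "integrable M (D k)"
      by (rule square_integrable_imp_integrable[OF _ D2[OF k]]) simp
    have eq: "(T (Suc k) w)\<^sup>2 = (T k w)\<^sup>2 + 2 * (z w * D k w) + \<kappa> w * (D k w)\<^sup>2" for w
      using I01[of k w] unfolding T_def z_def \<kappa>_def by (auto simp: power2_eq_square algebra_simps)
    have i1: "integrable M (\<lambda>w. z w * D k w)"
      by (rule int_bd[OF D1 _ z_bd]) measurable
    have i2: "integrable M (\<lambda>w. \<kappa> w * (D k w)\<^sup>2)"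
      by (rule int_bd[OF D2[OF k] _ \<kappa>_bd]) measurable
    show ?case
      using Suc i1 i2 unfolding eq
      by (simp add: mart[OF k z_meas z_bd] var[OF k \<kappa>_meas \<kappa>_bd] \<kappa>_def[symmetric])
  qed
  have Q_stop: "(\<Sum>j<k. (\<xi> j w * I j w)\<^sup>2 * v j) \<le> \<eta>" if "k \<le> n" for k w
    using that
  proof (induction k)
    case (Suc k)
    show ?case
    proof (cases "I k w = 1")
      case True
      have "(\<Sum>j<Suc k. (\<xi> j w * I j w)\<^sup>2 * v j) = Q (Suc k) w"
        unfolding Q_def using I_down[OF True] Suc by (intro sum.cong) auto
      then show ?thesis using True by (auto simp: I_def split: if_splits)
    next
      case False
      then show ?thesis using Suc I01[of k w] by auto
    qed
  qed (use \<eta> in auto)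
  have ET_le: "expectation (\<lambda>w. (T n w)\<^sup>2) \<le> \<eta>"
  proof -
    have int: "integrable M (\<lambda>w. (\<xi> j w * I j w)\<^sup>2)" if "j < n" for j
      by (rule integrable_const_bound[where B="\<eta> / v j"])
        (use xi2[OF that] liftM[OF \<xi>[OF that]] liftM[OF I_meas[OF that]] in auto)
    have "expectation (\<lambda>w. (T n w)\<^sup>2) = expectation (\<lambda>w. \<Sum>j<n. (\<xi> j w * I j w)\<^sup>2 * v j)"
      using ET[of n] int by (simp add: Bochner_Integration.integral_sum)
    also have "\<dots> \<le> expectation (\<lambda>_. \<eta>)"
      by (intro integral_mono) (use int Q_stop[of n] in auto)
    finally show ?thesis by (simp add: prob_space)
  qed
  have [measurable]: "T n \<in> borel_measurable M" using liftM T_meas by blast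
  have [measurable]: "(\<lambda>w. Q n w) \<in> borel_measurable M" using liftM Q_meas by blast
  \<comment> \<open>If \<open>Q n w \<le> \<eta>\<close>, the switch stays on exactly until the
    first index \<open>l\<close> at which \<open>S\<close> exceeds the level. The jump across the
    level is still included, so \<open>T n w = S l w\<close>, and the second moment of
    \<open>T n\<close> controls the event.\<close>
  have sub': "{w \<in> space M. \<exists>k\<le>n. \<bar>S k w\<bar> > \<epsilon>} \<subseteq>
    {w \<in> space M. Q n w > \<eta>} \<union> {w \<in> space M. \<bar>T n w\<bar> \<ge> \<epsilon>}"
  proof safe
    fix w k assume k: "w \<in> space M" "k \<le> n" "\<bar>S k w\<bar> > \<epsilon>" and nT: "\<not> \<epsilon> \<le> \<bar>T n w\<bar>"
    show "\<eta> < Q n w"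
    proof (rule ccontr)
      assume nQ: "\<not> \<eta> < Q n w"
      define l where "l = (LEAST k. \<bar>S k w\<bar> > \<epsilon>)"
      have l: "\<bar>S l w\<bar> > \<epsilon>"
        unfolding l_def by (rule LeastI[of "\<lambda>k. \<bar>S k w\<bar> > \<epsilon>" k]) fact
      have l_min: "\<bar>S i w\<bar> \<le> \<epsilon>" if "i < l" for i
        using not_less_Least[of i "\<lambda>k. \<bar>S k w\<bar> > \<epsilon>"] that unfolding l_def by simp
      have ln: "l \<le> n"
        using Least_le[of "\<lambda>k. \<bar>S k w\<bar> > \<epsilon>" k] k unfolding l_def by simp
      have I1: "I j w = 1" if "j < l" for j
      proof -
        have "Q (Suc j) w \<le> Q n w" unfolding Q_def
          using that ln by (intro sum_mono2) (auto intro!: mult_nonneg_nonneg v[THEN less_imp_le])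
        then have "Q (Suc j) w \<le> \<eta>" using nQ by linarith
        moreover have "\<forall>i\<le>j. \<bar>S i w\<bar> \<le> \<epsilon>" using that l_min by auto
        ultimately show ?thesis by (simp add: I_def)
      qed
      have I0: "I j w = 0" if "l \<le> j" for j
      proof -
        have "\<not> (\<forall>i\<le>j. \<bar>S i w\<bar> \<le> \<epsilon>)" using that l by (meson not_le)
        then show ?thesis by (auto simp: I_def)
      qed
      have "T n w = (\<Sum>j<l. \<xi> j w * I j w * D j w)"
        unfolding T_def by (rule sum.mono_neutral_right) (use ln I0 in auto)
      also have "\<dots> = S l w" unfolding S_def by (rule sum.cong) (use I1 in auto)
      finally have "T n w = S l w" .
      then show False using nT l by simp
    qed
  qed
  have "\<P>(w in M. \<exists>k\<le>n. \<bar>S k w\<bar> > \<epsilon>) \<le>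
      prob ({w \<in> space M. Q n w > \<eta>} \<union> {w \<in> space M. \<bar>T n w\<bar> \<ge> \<epsilon>})"
    by (rule finite_measure_mono[OF sub']) measurable
  also have "\<dots> \<le> \<P>(w in M. Q n w > \<eta>) + \<P>(w in M. \<bar>T n w\<bar> \<ge> \<epsilon>)"
    by (rule measure_Un_le) measurable
  also have "\<P>(w in M. \<bar>T n w\<bar> \<ge> \<epsilon>) \<le> expectation (\<lambda>w. (T n w)\<^sup>2) / \<epsilon>\<^sup>2"
    by (rule second_moment_method) (use ET[of n] \<epsilon> in auto)
  also have "\<dots> \<le> \<eta> / \<epsilon>\<^sup>2" using ET_le by (intro divide_right_mono) auto
  finally show ?thesis by (simp add: S_def Q_def)
qed

lemma strict_mono_grid:
  fixes \<sigma> :: "nat \<Rightarrow> real"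
  assumes "strict_mono \<sigma>" "0 \<le> \<sigma> 0"
  shows "0 \<le> \<sigma> j" "\<sigma> j \<le> \<sigma> (Suc j)" "\<sigma> j < \<sigma> (Suc j)"
  using assms by (auto simp: strict_mono_less_eq strict_mono_less intro: order_trans[of _ "\<sigma> 0"])

section \<open>Gaussian increments: independence of the past, moments, maximal inequalities\<close>

locale brownian_motion_space = filtered_prob_space M F
  for M :: "'a measure" and F :: "real \<Rightarrow> 'a measure" +
  fixes W :: "real \<Rightarrow> 'a \<Rightarrow> real"
  assumes bm: "standard_brownian_motion M F W"
begin

abbreviation dW :: "(nat \<Rightarrow> real) \<Rightarrow> nat \<Rightarrow> 'a \<Rightarrow> real" where
  "dW \<sigma> i w \<equiv> W (\<sigma> (Suc i)) w - W (\<sigma> i) w"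

lemma measurable_F_mono:
  fixes f :: "'a \<Rightarrow> real"
  assumes "f \<in> borel_measurable (F s)" "s \<le> t"
  shows "f \<in> borel_measurable (F t)"
  by (rule measurable_from_subalg[OF _ assms(1)])
    (use sets_F_mono[OF assms(2)] in \<open>auto simp: subalgebra_def space_F\<close>)

lemma measurable_F_M:
  fixes f :: "'a \<Rightarrow> real"
  assumes "f \<in> borel_measurable (F s)"
  shows "f \<in> borel_measurable M"
  by (rule measurable_from_subalg[OF subalgebra_F assms])

lemma W_measurable: "0 \<le> t \<Longrightarrow> W t \<in> borel_measurable (F t)"
  using bm by (auto simp: standard_brownian_motion_def adapted_process_def)

lemma increment_measurable:
  assumes "0 \<le> s" "s \<le> t"
  shows "(\<lambda>w. W t w - W s w) \<in> borel_measurable (F t)"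
  using W_measurable[of t] measurable_F_mono[OF W_measurable[of s]] assms by auto

lemma increment_distributed:
  assumes "0 \<le> s" "s < t"
  shows "distributed M lborel (\<lambda>w. W t w - W s w) (normal_density 0 (sqrt (t - s)))"
  using bm assms by (auto simp: standard_brownian_motion_def)

lemma increment_indep_var:
  assumes s: "0 \<le> s" "s < t" and \<xi>: "\<xi> \<in> borel_measurable (F s)"
  shows "indep_var borel \<xi> borel (\<lambda>w. W t w - W s w)"
proof -
  let ?D = "\<lambda>w. W t w - W s w"
  have D: "?D \<in> borel_measurable M"
    by (rule measurable_F_M[OF increment_measurable]) (use s in auto)
  have ind: "indep_set (sets (F s)) {?D -` B \<inter> space M | B. B \<in> sets borel}"
    using bm s by (auto simp: standard_brownian_motion_def)
  have sub: "subalgebra M (F s)" by (rule subalgebra_F)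
  have 1: "sigma_sets (space M) {\<xi> -` A \<inter> space M |A. A \<in> sets borel} \<subseteq> sets (F s)"
    unfolding space_F[of s, symmetric]
    by (rule sets.sigma_sets_subset) (use measurable_sets[OF \<xi>] in auto)
  have 2: "sigma_sets (space M) {?D -` A \<inter> space M |A. A \<in> sets borel}
      = {?D -` A \<inter> space M |A. A \<in> sets borel}"
  proof -
    have e: "sigma_sets UNIV (sets borel) = (sets borel :: real set set)"
      using sets.sigma_sets_eq[of borel] by simp
    show ?thesis
      by (rule sigma_sets_vimage_commute[of ?D "space M" UNIV "sets borel", unfolded e, symmetric]) simp
  qed
  show ?thesis
    unfolding indep_var_eq 2
    using D measurable_F_M[OF \<xi>] 1 ind unfolding indep_sets2_eq by blast
qed

text \<open>Independence factorizes the expectation. The degenerate case \<open>s = t\<close> is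
  included because a grid stopped at a time has steps of length zero.\<close>

lemma increment_expectation_mult:
  assumes s: "0 \<le> s" "s \<le> t" and \<xi>: "\<xi> \<in> borel_measurable (F s)" "integrable M \<xi>"
    and g: "g \<in> borel_measurable borel" "integrable M (\<lambda>w. g (W t w - W s w))"
  shows "integrable M (\<lambda>w. \<xi> w * g (W t w - W s w) :: real)"
    and "expectation (\<lambda>w. \<xi> w * g (W t w - W s w))
      = expectation \<xi> * expectation (\<lambda>w. g (W t w - W s w))"
proof -
  have "integrable M (\<lambda>w. \<xi> w * g (W t w - W s w)) \<and>
    expectation (\<lambda>w. \<xi> w * g (W t w - W s w))
      = expectation \<xi> * expectation (\<lambda>w. g (W t w - W s w))"
  proof (cases "s = t")
    case True
    then show ?thesis using \<xi> by (simp add: prob_space)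
  next
    case False
    have "indep_var borel (id \<circ> \<xi>) borel (g \<circ> (\<lambda>w. W t w - W s w))"
      by (rule indep_var_compose[OF increment_indep_var]) (use s \<xi> g False in auto)
    then have "indep_var borel \<xi> borel (\<lambda>w. g (W t w - W s w))"
      by (simp add: comp_def)
    from indep_var_integrable[OF this \<xi>(2) g(2)] indep_var_lebesgue_integral[OF this \<xi>(2) g(2)]
    show ?thesis by simp
  qed
  then show "integrable M (\<lambda>w. \<xi> w * g (W t w - W s w))"
    "expectation (\<lambda>w. \<xi> w * g (W t w - W s w))
      = expectation \<xi> * expectation (\<lambda>w. g (W t w - W s w))" by auto
qed

lemma increment_moments:
  assumes s: "0 \<le> s" "s \<le> t"
  shows increment_integrable_power: "integrable M (\<lambda>w. (W t w - W s w) ^ k)"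
    and increment_expectation: "expectation (\<lambda>w. W t w - W s w) = 0"
    and increment_expectation_power2: "expectation (\<lambda>w. (W t w - W s w)\<^sup>2) = t - s"
    and increment_expectation_power4: "expectation (\<lambda>w. (W t w - W s w) ^ 4) = 3 * (t - s)\<^sup>2"
proof -
  let ?D = "\<lambda>w. W t w - W s w"
  have "integrable M (\<lambda>w. ?D w ^ k) \<and> expectation ?D = 0 \<and> expectation (\<lambda>w. (?D w)\<^sup>2) = t - s
    \<and> expectation (\<lambda>w. ?D w ^ 4) = 3 * (t - s)\<^sup>2"
  proof (cases "s = t")
    case True
    then show ?thesis by simp
  next
    case False
    then have st: "s < t" "0 < sqrt (t - s)" using s by auto
    note d = increment_distributed[OF s(1) st(1)]
    have i: "integrable M (\<lambda>w. ?D w ^ k)" for k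
      using distributed_integrable[OF d, of "\<lambda>x. x ^ k"] integrable_normal_moment[OF st(2), of 0 k]
      by (simp add: normal_density_nonneg)
    have e: "expectation (\<lambda>w. ?D w ^ k) = (\<integral>x. normal_density 0 (sqrt (t - s)) x * x ^ k \<partial>lborel)" for k
      using distributed_integral[OF d, of "\<lambda>x. x ^ k"] by (simp add: normal_density_nonneg)
    have "expectation (\<lambda>w. ?D w ^ 1) = 0"
      unfolding e using integral_normal_moment_odd[OF st(2), of 0 0] by simp
    moreover have "expectation (\<lambda>w. ?D w ^ 2) = t - s"
      unfolding e using integral_normal_moment_even[OF st(2), of 0 1] st by (simp add: fact_numeral)
    moreover have "expectation (\<lambda>w. ?D w ^ 4) = 3 * (t - s)\<^sup>2"
      unfolding e using integral_normal_moment_even[OF st(2), of 0 2] st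
      by (simp add: fact_numeral power_divide)
    ultimately show ?thesis using i by simp
  qed
  then show "integrable M (\<lambda>w. ?D w ^ k)" "expectation ?D = 0" "expectation (\<lambda>w. (?D w)\<^sup>2) = t - s"
    "expectation (\<lambda>w. ?D w ^ 4) = 3 * (t - s)\<^sup>2" by auto
qed

text \<open>With \<open>h = t - s\<close> the Gaussian moments give
  \<open>3 h^2 - 2 h^2 + h^2 = 2 h^2\<close>; this is the origin of the 2 in
  \<open>2 T t\<close>.\<close>

lemma centered_square_moments:
  assumes s: "0 \<le> s" "s \<le> t"
  shows centered_square_integrable: "integrable M (\<lambda>w. (W t w - W s w)\<^sup>2 - (t - s))"
    and centered_square_integrable_power2: "integrable M (\<lambda>w. ((W t w - W s w)\<^sup>2 - (t - s))\<^sup>2)"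
    and centered_square_expectation: "expectation (\<lambda>w. (W t w - W s w)\<^sup>2 - (t - s)) = 0"
    and centered_square_expectation_power2:
      "expectation (\<lambda>w. ((W t w - W s w)\<^sup>2 - (t - s))\<^sup>2) = 2 * (t - s)\<^sup>2"
proof -
  note i = increment_integrable_power[OF s]
  have aux: "(x\<^sup>2 - h)\<^sup>2 = x ^ 4 - 2 * h * x\<^sup>2 + h\<^sup>2" for x h :: real
    by (simp add: power2_eq_square power4_eq_xxxx algebra_simps)
  have eq: "((W t w - W s w)\<^sup>2 - (t - s))\<^sup>2
    = (W t w - W s w) ^ 4 - 2 * (t - s) * (W t w - W s w)\<^sup>2 + (t - s)\<^sup>2" for w
    using aux .
  show "integrable M (\<lambda>w. (W t w - W s w)\<^sup>2 - (t - s))"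
    "expectation (\<lambda>w. (W t w - W s w)\<^sup>2 - (t - s)) = 0"
    using i[of 2] increment_expectation_power2[OF s] by (simp_all add: prob_space)
  show "integrable M (\<lambda>w. ((W t w - W s w)\<^sup>2 - (t - s))\<^sup>2)"
    unfolding eq by (intro Bochner_Integration.integrable_add Bochner_Integration.integrable_diff integrable_mult_right i) simp
  show "expectation (\<lambda>w. ((W t w - W s w)\<^sup>2 - (t - s))\<^sup>2) = 2 * (t - s)\<^sup>2"
    unfolding eq using i[of 2] i[of 4] increment_expectation_power2[OF s] increment_expectation_power4[OF s]
    by (simp add: prob_space) (simp add: power2_eq_square)
qed

text \<open>One statement for two uses: \<open>g j\<close> is the identity for Ito sums, and
  \<open>x^2 - h\<close> for the fluctuation of the quadratic variation. Both are centred functions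
  of an increment that is independent of the past.\<close>

lemma stochastic_sum_maximal_inequality:
  assumes \<sigma>: "strict_mono \<sigma>" "0 \<le> \<sigma> (0::nat)"
    and \<xi>: "\<And>j. j < n \<Longrightarrow> \<xi> j \<in> borel_measurable (F (\<sigma> j))"
    and g_meas: "\<And>j. g j \<in> borel_measurable borel"
    and g2: "\<And>j. integrable M (\<lambda>w. (g j (dW \<sigma> j w))\<^sup>2)"
    and Eg: "\<And>j. expectation (\<lambda>w. g j (dW \<sigma> j w)) = 0"
    and Eg2: "\<And>j. expectation (\<lambda>w. (g j (dW \<sigma> j w))\<^sup>2) = v j"
    and v: "\<And>j. 0 < v j"
    and "0 < \<epsilon>" "0 < \<eta>"
  shows "\<P>(w in M. \<exists>k\<le>n. \<bar>\<Sum>j<k. \<xi> j w * g j (dW \<sigma> j w)\<bar> > \<epsilon>)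
    \<le> \<P>(w in M. (\<Sum>j<n. (\<xi> j w)\<^sup>2 * v j) > \<eta>) + \<eta> / \<epsilon>\<^sup>2"
proof -
  note pos = strict_mono_grid[OF \<sigma>]
  define D where "D j w = dW \<sigma> j w" for j w

  have D_meas: "D j \<in> borel_measurable (F (\<sigma> (Suc j)))" for j
    unfolding D_def[abs_def] by (rule increment_measurable) (use pos in auto)
  have g1: "integrable M (\<lambda>w. g j (D j w))" for j
    by (rule square_integrable_imp_integrable)
      (use g2[of j] measurable_compose[OF measurable_F_M[OF D_meas] g_meas] in \<open>auto simp: D_def\<close>)
  have bdd: "integrable M z" if "z \<in> borel_measurable (F s)" "\<And>w. \<bar>z w\<bar> \<le> C"
    for z :: "'a \<Rightarrow> real" and C s
    by (rule integrable_const_bound[where B=C]) (use that measurable_F_M[OF that(1)] in auto)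
  have "\<P>(w in M. \<exists>k\<le>n. \<bar>\<Sum>j<k. \<xi> j w * g j (D j w)\<bar> > \<epsilon>)
    \<le> \<P>(w in M. (\<Sum>j<n. (\<xi> j w)\<^sup>2 * v j) > \<eta>) + \<eta> / \<epsilon>\<^sup>2"
  proof (rule stopped_maximal_inequality[where A = "\<lambda>j. F (\<sigma> j)"])
    show "sets (F (\<sigma> j)) \<subseteq> sets (F (\<sigma> (Suc j)))" for j
      by (rule sets_F_mono[OF pos(2)])
    show "(\<lambda>w. g j (D j w)) \<in> borel_measurable (F (\<sigma> (Suc j)))" for j
      by (rule measurable_compose[OF D_meas g_meas])

    fix j and z :: "'a \<Rightarrow> real" and C :: real
    assume z: "z \<in> borel_measurable (F (\<sigma> j))" "\<And>w. \<bar>z w\<bar> \<le> C"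
    show "expectation (\<lambda>w. z w * g j (D j w)) = 0"
      unfolding D_def using g1[of j] Eg[of j]
      by (subst increment_expectation_mult(2)[OF pos(1,2) z(1) bdd[OF z] g_meas]) (auto simp: D_def)
    have "(\<lambda>x. (g j x)\<^sup>2) \<in> borel_measurable borel" using g_meas[of j] by measurable
    from increment_expectation_mult(2)[OF pos(1,2) z(1) bdd[OF z] this]
    show "expectation (\<lambda>w. z w * (g j (D j w))\<^sup>2) = expectation z * v j"
      using g2[of j] Eg2[of j] unfolding D_def by auto
  qed (use subalgebra_F \<xi> g2 v assms(9,10) in \<open>auto simp: D_def\<close>)
  then show ?thesis by (simp add: D_def)
qed

lemma ito_sum_maximal_inequality:
  assumes \<sigma>: "strict_mono \<sigma>" "0 \<le> \<sigma> (0::nat)"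
    and \<xi>: "\<And>j. j < n \<Longrightarrow> \<xi> j \<in> borel_measurable (F (\<sigma> j))"
    and "0 < \<epsilon>" "0 < \<eta>"
  shows "\<P>(w in M. \<exists>k\<le>n. \<bar>\<Sum>j<k. \<xi> j w * dW \<sigma> j w\<bar> > \<epsilon>)
    \<le> \<P>(w in M. (\<Sum>j<n. (\<xi> j w)\<^sup>2 * (\<sigma> (Suc j) - \<sigma> j)) > \<eta>) + \<eta> / \<epsilon>\<^sup>2"
proof -
  note pos = strict_mono_grid[OF \<sigma>]
  show ?thesis
    by (rule stochastic_sum_maximal_inequality[where g = "\<lambda>j x. x", OF \<sigma> \<xi>])
      (use assms pos in \<open>auto simp: increment_integrable_power increment_expectation
        increment_expectation_power2\<close>)
qed

lemma square_sum_maximal_inequality: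
  assumes \<sigma>: "strict_mono \<sigma>" "0 \<le> \<sigma> (0::nat)"
    and \<xi>: "\<And>j. j < n \<Longrightarrow> \<xi> j \<in> borel_measurable (F (\<sigma> j))"
    and "0 < \<epsilon>" "0 < \<eta>"
  shows "\<P>(w in M. \<exists>k\<le>n. \<bar>\<Sum>j<k. \<xi> j w * ((dW \<sigma> j w)\<^sup>2 - (\<sigma> (Suc j) - \<sigma> j))\<bar> > \<epsilon>)
    \<le> \<P>(w in M. (\<Sum>j<n. (\<xi> j w)\<^sup>2 * (2 * (\<sigma> (Suc j) - \<sigma> j)\<^sup>2)) > \<eta>) + \<eta> / \<epsilon>\<^sup>2"
proof -
  note pos = strict_mono_grid[OF \<sigma>]
  show ?thesis
  proof (rule stochastic_sum_maximal_inequality[where g = "\<lambda>j x. x\<^sup>2 - (\<sigma> (Suc j) - \<sigma> j)", OF \<sigma> \<xi>])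
    show "0 < 2 * (\<sigma> (Suc j) - \<sigma> j)\<^sup>2" for j
      using pos(3)[of j] by simp
  qed (use assms centered_square_moments[OF pos(1,2)] in auto)
qed

end

section \<open>Step processes and the Ito integral\<close>

text \<open>Beyond the maximum of \<open>P\<close> the enumeration continues in unit steps, so that
  \<open>strict_mono\<close> holds on all of \<open>nat\<close> and grids carry no bound on the
  index.\<close>

lemma finite_strict_mono_enumeration:
  fixes P :: "real set"
  assumes "finite P" "P \<noteq> {}"
  obtains \<sigma> :: "nat \<Rightarrow> real" and n where "strict_mono \<sigma>" "P = \<sigma> ` {..n}"
proof -
  have "P \<noteq> {} \<longrightarrow> (\<exists>\<sigma> :: nat \<Rightarrow> real. \<exists>n. strict_mono \<sigma> \<and> P = \<sigma> ` {..n})"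
    using assms(1)
  proof (induction P rule: finite_linorder_max_induct)
    case (insert b A)
    show ?case
    proof (cases "A = {}")
      case True
      have "strict_mono (\<lambda>j. b + real j)" "insert b A = (\<lambda>j. b + real j) ` {..0}"
        using True by (auto simp: strict_mono_def)
      then show ?thesis by blast
    next
      case False
      then obtain \<sigma> :: "nat \<Rightarrow> real" and n where \<sigma>: "strict_mono \<sigma>" "A = \<sigma> ` {..n}"
        using insert.IH by blast
      define \<sigma>' where "\<sigma>' j = (if j \<le> n then \<sigma> j else b + real (j - Suc n))" for j
      have "strict_mono \<sigma>'"
      proof (rule strict_monoI)
        fix x y :: nat assume "x < y"
        moreover have "\<sigma> x < b" if "x \<le> n" using insert(2) that \<sigma> by auto
        ultimately show "\<sigma>' x < \<sigma>' y"
          using \<sigma>(1) by (auto simp: \<sigma>'_def strict_mono_less add_pos_nonneg intro: less_le_trans)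
      qed
      moreover have "insert b A = \<sigma>' ` {..Suc n}"
      proof -
        have "\<sigma>' ` {..Suc n} = insert (\<sigma>' (Suc n)) (\<sigma>' ` {..n})" by (simp add: atMost_Suc)
        also have "\<sigma>' ` {..n} = \<sigma> ` {..n}" by (rule image_cong) (auto simp: \<sigma>'_def)
        finally show ?thesis using \<sigma> by (simp add: \<sigma>'_def)
      qed
      ultimately show ?thesis by blast
    qed
  qed simp
  then show ?thesis using assms that by blast
qed

text \<open>A simple process without the bound on its coefficients. This admits coefficients such as
  the values of a solution at grid points, which may be unbounded.\<close>

definition step_process ::
  "(real \<Rightarrow> 'a measure) \<Rightarrow> nat \<Rightarrow> (nat \<Rightarrow> real) \<Rightarrow> (nat \<Rightarrow> 'a \<Rightarrow> real) \<Rightarrow> bool" where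
  "step_process F m \<tau> \<xi> \<longleftrightarrow>
     0 \<le> \<tau> 0 \<and> (\<forall>i<m. \<tau> i < \<tau> (Suc i) \<and> \<xi> i \<in> borel_measurable (F (\<tau> i)))"

lemma simple_process_imp_step_process: "simple_process F m \<tau> \<xi> \<Longrightarrow> step_process F m \<tau> \<xi>"
  by (auto simp: simple_process_def step_process_def)

lemma step_process_nonneg: "step_process F m \<tau> \<xi> \<Longrightarrow> i \<le> m \<Longrightarrow> 0 \<le> \<tau> i"
proof (induction i)
  case (Suc i)
  then have "0 \<le> \<tau> i" "\<tau> i < \<tau> (Suc i)" by (auto simp: step_process_def)
  then show ?case by linarith
qed (simp add: step_process_def)

text \<open>On a grid that contains all partition points, each increment of \<open>W\<close> over a
  partition interval telescopes. The path is evaluated at the right end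
  \<open>\<sigma> (Suc j)\<close> because its pieces are open on the left and closed on the
  right.\<close>

lemma simple_integral_refine:
  assumes \<sigma>: "strict_mono \<sigma>" and \<tau>: "\<And>i. i < m \<Longrightarrow> \<tau> i < \<tau> (Suc i)" "\<tau> ` {..m} \<subseteq> range \<sigma>"
  shows "simple_integral W m \<tau> \<xi> (\<sigma> p) w =
    (\<Sum>j<p. simple_path m \<tau> \<xi> (\<sigma> (Suc j)) w * (W (\<sigma> (Suc j)) w - W (\<sigma> j) w))"
proof -
  let ?D = "\<lambda>j. W (\<sigma> (Suc j)) w - W (\<sigma> j) w"
  have *: "W (min (\<sigma> p) (\<tau> (Suc i))) w - W (min (\<sigma> p) (\<tau> i)) w
    = (\<Sum>j<p. indicator {\<tau> i<..\<tau> (Suc i)} (\<sigma> (Suc j)) * ?D j)" if i: "i < m" for i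
  proof -
    have "\<tau> i \<in> range \<sigma>" "\<tau> (Suc i) \<in> range \<sigma>" using \<tau>(2) i by auto
    then obtain a b where ab: "\<tau> i = \<sigma> a" "\<tau> (Suc i) = \<sigma> b" by blast
    have lt: "a < b" using \<tau>(1)[OF i] ab \<sigma> by (simp add: strict_mono_less)
    have mn: "min (\<sigma> p) (\<sigma> q) = \<sigma> (min p q)" for q
      using \<sigma> by (auto simp: min_def strict_mono_less_eq)
    have "(\<Sum>j<p. indicator {\<tau> i<..\<tau> (Suc i)} (\<sigma> (Suc j)) * ?D j) = (\<Sum>j<p. if a \<le> j \<and> j < b then ?D j else 0)"
      using \<sigma> by (intro sum.cong) (auto simp: ab strict_mono_less strict_mono_less_eq indicator_def)
    also have "\<dots> = sum ?D {min p a..<min p b}"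
      by (subst sum.inter_filter[symmetric]) (auto intro!: sum.cong)
    also have "\<dots> = W (\<sigma> (min p b)) w - W (\<sigma> (min p a)) w"
      using lt by (intro sum_Suc_diff') auto
    finally show ?thesis using mn by (simp add: ab)
  qed
  have "simple_integral W m \<tau> \<xi> (\<sigma> p) w =
      (\<Sum>i<m. \<Sum>j<p. \<xi> i w * indicator {\<tau> i<..\<tau> (Suc i)} (\<sigma> (Suc j)) * ?D j)"
    unfolding simple_integral_def
    by (intro sum.cong refl) (simp only: * sum_distrib_left mult.assoc lessThan_iff)
  also have "\<dots> = (\<Sum>j<p. \<Sum>i<m. \<xi> i w * indicator {\<tau> i<..\<tau> (Suc i)} (\<sigma> (Suc j)) * ?D j)"
    by (rule sum.swap)
  finally show ?thesis by (simp only: simple_path_def sum_distrib_right)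
qed

lemma simple_path_const:
  assumes \<sigma>: "strict_mono \<sigma>" and \<tau>: "\<tau> ` {..m} \<subseteq> range \<sigma>" and s: "\<sigma> j < s" "s \<le> \<sigma> (Suc j)"
  shows "simple_path m \<tau> \<xi> s w = simple_path m \<tau> \<xi> (\<sigma> (Suc j)) w"
  unfolding simple_path_def
proof (intro sum.cong refl arg_cong2[where f="(*)"])
  fix i assume "i \<in> {..<m}"
  then have "\<tau> i \<in> range \<sigma>" "\<tau> (Suc i) \<in> range \<sigma>" using \<tau> by auto
  then obtain a b where ab: "\<tau> i = \<sigma> a" "\<tau> (Suc i) = \<sigma> b" by blast
  have le: "\<sigma> a < s \<longleftrightarrow> a < Suc j" for a
  proof
    assume "\<sigma> a < s"
    then have "\<sigma> a < \<sigma> (Suc j)" using s by simp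
    then show "a < Suc j" using \<sigma> by (simp add: strict_mono_less)
  next
    assume "a < Suc j"
    then have "\<sigma> a \<le> \<sigma> j" using \<sigma> by (simp add: strict_mono_less_eq)
    then show "\<sigma> a < s" using s by simp
  qed
  then show "indicator {\<tau> i<..\<tau> (Suc i)} s = (indicator {\<tau> i<..\<tau> (Suc i)} (\<sigma> (Suc j)) :: real)"
    using \<sigma> le[of a] le[of b] by (auto simp: ab indicator_def strict_mono_less strict_mono_less_eq not_less[symmetric])
qed

lemma simple_path_borel_measurable [measurable]:
  "(\<lambda>s. simple_path m \<tau> \<xi> s w) \<in> borel_measurable borel"
  unfolding simple_path_def by measurable

text \<open>Connects the two notions of quadratic variation: the maximal inequality for sums has a
  finite sum, the definition of the Ito integral a Lebesgue integral over time.\<close>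

lemma sum_le_nn_set_integral:
  fixes f :: "real \<Rightarrow> real"
  assumes \<sigma>: "strict_mono \<sigma>" "0 \<le> \<sigma> 0" and f: "\<And>s. 0 \<le> f s" "f \<in> borel_measurable borel"
    and const: "\<And>j s. j < p \<Longrightarrow> \<sigma> j < s \<Longrightarrow> s \<le> \<sigma> (Suc j) \<Longrightarrow> f s = f (\<sigma> (Suc j))"
  shows "ennreal (\<Sum>j<p. f (\<sigma> (Suc j)) * (\<sigma> (Suc j) - \<sigma> j)) \<le> (\<integral>\<^sup>+ s \<in> {0..\<sigma> p}. ennreal (f s) \<partial>lborel)"
  using const
proof (induction p)
  case (Suc p)
  have le: "\<sigma> p \<le> \<sigma> (Suc p)" using \<sigma> by (simp add: strict_mono_less_eq)
  have p0: "0 \<le> \<sigma> p" by (rule strict_mono_grid[OF \<sigma>])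
  have "ennreal (\<Sum>j<Suc p. f (\<sigma> (Suc j)) * (\<sigma> (Suc j) - \<sigma> j)) =
    ennreal (\<Sum>j<p. f (\<sigma> (Suc j)) * (\<sigma> (Suc j) - \<sigma> j)) + ennreal (f (\<sigma> (Suc p)) * (\<sigma> (Suc p) - \<sigma> p))"
    using f \<sigma> by (auto simp: strict_mono_less_eq intro!: ennreal_plus sum_nonneg mult_nonneg_nonneg)
  also have "ennreal (f (\<sigma> (Suc p)) * (\<sigma> (Suc p) - \<sigma> p)) = (\<integral>\<^sup>+ s \<in> {\<sigma> p<..\<sigma> (Suc p)}. ennreal (f s) \<partial>lborel)"
  proof -
    have "(\<integral>\<^sup>+ s \<in> {\<sigma> p<..\<sigma> (Suc p)}. ennreal (f s) \<partial>lborel) =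
      (\<integral>\<^sup>+ s. ennreal (f (\<sigma> (Suc p))) * indicator {\<sigma> p<..\<sigma> (Suc p)} s \<partial>lborel)"
    proof (rule nn_integral_cong)
      fix s
      show "ennreal (f s) * indicator {\<sigma> p<..\<sigma> (Suc p)} s =
          ennreal (f (\<sigma> (Suc p))) * indicator {\<sigma> p<..\<sigma> (Suc p)} s"
        using Suc.prems[of p s] by (cases "s \<in> {\<sigma> p<..\<sigma> (Suc p)}") auto
    qed
    also have "\<dots> = ennreal (f (\<sigma> (Suc p))) * ennreal (\<sigma> (Suc p) - \<sigma> p)"
      using le by (simp add: nn_integral_cmult_indicator)
    finally show ?thesis using f by (simp add: ennreal_mult')
  qed
  also have "ennreal (\<Sum>j<p. f (\<sigma> (Suc j)) * (\<sigma> (Suc j) - \<sigma> j)) + \<dots> \<le>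
    (\<integral>\<^sup>+ s \<in> {0..\<sigma> p}. ennreal (f s) \<partial>lborel) + (\<integral>\<^sup>+ s \<in> {\<sigma> p<..\<sigma> (Suc p)}. ennreal (f s) \<partial>lborel)"
    using Suc by (intro add_right_mono) auto
  also have "\<dots> = (\<integral>\<^sup>+ s. ennreal (f s) * indicator {0..\<sigma> p} s + ennreal (f s) * indicator {\<sigma> p<..\<sigma> (Suc p)} s \<partial>lborel)"
    using f by (intro nn_integral_add[symmetric]) auto
  also have "\<dots> = (\<integral>\<^sup>+ s \<in> {0..\<sigma> (Suc p)}. ennreal (f s) \<partial>lborel)"
    using le p0 by (intro nn_integral_cong) (auto simp: indicator_def)
  finally show ?case .
qed simp

text \<open>The squared L2 distance in time for a fixed outcome, valued in \<open>ennreal\<close>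
  exactly as in \<open>has_ito_integral\<close>, so that it is infinite rather than a default value
  when the difference is not square integrable.\<close>

definition path_dist2 :: "(real \<Rightarrow> 'a \<Rightarrow> real) \<Rightarrow> (real \<Rightarrow> 'a \<Rightarrow> real) \<Rightarrow> real \<Rightarrow> 'a \<Rightarrow> ennreal" where
  "path_dist2 H K t w = (\<integral>\<^sup>+ s \<in> {0..t}. ennreal ((H s w - K s w)\<^sup>2) \<partial>lborel)"

abbreviation jointly_measurable :: "'a measure \<Rightarrow> (real \<Rightarrow> 'a \<Rightarrow> real) \<Rightarrow> bool" where
  "jointly_measurable M H \<equiv> (\<lambda>(s, w). H s w) \<in> borel_measurable (restrict_space borel {0..} \<Otimes>\<^sub>M M)"

lemma path_dist2_commute: "path_dist2 H K t w = path_dist2 K H t w"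
  by (simp add: path_dist2_def power2_commute)

lemma path_dist2_mono: "s \<le> t \<Longrightarrow> path_dist2 H K s w \<le> path_dist2 H K t w"
  unfolding path_dist2_def by (intro nn_integral_mono) (auto simp: indicator_def)

lemma path_dist2_measurable:
  assumes H: "jointly_measurable M H" and K: "jointly_measurable M K"
  shows "path_dist2 H K t \<in> borel_measurable M"
proof -
  \<comment> \<open>Joint measurability is given only for nonnegative times. Replacing
    \<open>s\<close> by \<open>max 0 s\<close> produces functions on all of the real line and
    changes nothing on \<open>{0..t}\<close>.\<close>
  have max: "(\<lambda>(w, s::real). (max 0 s, w)) \<in> M \<Otimes>\<^sub>M lborel \<rightarrow>\<^sub>M restrict_space borel {0..} \<Otimes>\<^sub>M M"
    unfolding case_prod_unfold
  proof (rule measurable_Pair)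
    have [measurable]: "(\<lambda>x. max 0 (snd x)) \<in> borel_measurable (M \<Otimes>\<^sub>M (lborel :: real measure))"
      by measurable
    show "(\<lambda>x. max 0 (snd x)) \<in> M \<Otimes>\<^sub>M lborel \<rightarrow>\<^sub>M restrict_space borel {0::real..}"
      by (rule measurable_restrict_space2) auto
  qed measurable
  have [measurable]: "(\<lambda>(w, s). H (max 0 s) w) \<in> borel_measurable (M \<Otimes>\<^sub>M lborel)"
    "(\<lambda>(w, s). K (max 0 s) w) \<in> borel_measurable (M \<Otimes>\<^sub>M lborel)"
    using measurable_compose[OF max H] measurable_compose[OF max K] by (simp_all add: case_prod_unfold)
  have "(\<lambda>w. \<integral>\<^sup>+ s. ennreal ((H (max 0 s) w - K (max 0 s) w)\<^sup>2) * indicator {0..t} s \<partial>lborel) \<in> borel_measurable M"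
    by measurable
  also have "(\<lambda>w. \<integral>\<^sup>+ s. ennreal ((H (max 0 s) w - K (max 0 s) w)\<^sup>2) * indicator {0..t} s \<partial>lborel) = path_dist2 H K t"
    unfolding path_dist2_def[abs_def] by (intro ext nn_integral_cong) (auto simp: indicator_def)
  finally show ?thesis .
qed

lemma path_dist2_triangle:
  assumes H: "jointly_measurable M H" and K: "jointly_measurable M K" and L: "jointly_measurable M L"
    and w: "w \<in> space M"
  shows "path_dist2 H L t w \<le> 2 * path_dist2 H K t w + 2 * path_dist2 K L t w"
proof -
  have m: "(\<lambda>s. H (max 0 s) w) \<in> borel_measurable lborel" if "jointly_measurable M H" for H
  proof -
    have "(\<lambda>s::real. (max 0 s, w)) \<in> lborel \<rightarrow>\<^sub>M restrict_space borel {0..} \<Otimes>\<^sub>M M"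
      using w by (intro measurable_Pair measurable_restrict_space2 | simp)+
    from measurable_compose[OF this that] show ?thesis by simp
  qed
  note [measurable] = m[OF H] m[OF K] m[OF L]
  let ?d = "\<lambda>H K s. ennreal ((H (max 0 s) w - K (max 0 s) w)\<^sup>2) * indicator {0..t} s"
  have eq: "path_dist2 H K t w = (\<integral>\<^sup>+ s. ?d H K s \<partial>lborel)" for H K
    unfolding path_dist2_def by (intro nn_integral_cong) (auto simp: indicator_def)
  have sq: "(x - z)\<^sup>2 \<le> 2 * (x - y)\<^sup>2 + 2 * (y - z)\<^sup>2" for x y z :: real
    using zero_le_power2[of "x - 2 * y + z"] by (simp add: power2_eq_square algebra_simps)
  have "path_dist2 H L t w \<le> (\<integral>\<^sup>+ s. 2 * ?d H K s + 2 * ?d K L s \<partial>lborel)"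
    unfolding eq
  proof (intro nn_integral_mono)
    fix s
    have "ennreal ((H (max 0 s) w - L (max 0 s) w)\<^sup>2) \<le>
      ennreal (2 * (H (max 0 s) w - K (max 0 s) w)\<^sup>2 + 2 * (K (max 0 s) w - L (max 0 s) w)\<^sup>2)"
      by (rule ennreal_leI[OF sq])
    then show "?d H L s \<le> 2 * ?d H K s + 2 * ?d K L s"
      by (auto simp: indicator_def ennreal_plus ennreal_mult')
  qed
  also have "\<dots> = 2 * path_dist2 H K t w + 2 * path_dist2 K L t w"
    unfolding eq by (subst nn_integral_add) (auto simp: nn_integral_cmult)
  finally show ?thesis .
qed

section \<open>Maximal inequalities for step processes and for Ito integrals\<close>

context brownian_motion_space
begin

lemma simple_path_jointly_measurable:
  assumes "step_process F m \<tau> \<xi>"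
  shows "jointly_measurable M (simple_path m \<tau> \<xi>)"
proof -
  have [measurable]: "\<xi> i \<in> borel_measurable M" if "i \<in> {..<m}" for i
    using assms that measurable_F_M[of "\<xi> i" "\<tau> i"] by (auto simp: step_process_def)
  show ?thesis
    unfolding simple_path_def case_prod_unfold
  proof (intro borel_measurable_sum borel_measurable_times)
    fix i assume "i \<in> {..<m}"
    then show "(\<lambda>x. \<xi> i (snd x)) \<in> borel_measurable (restrict_space borel {0..} \<Otimes>\<^sub>M M)" by measurable
    have "fst \<in> restrict_space borel {0..} \<Otimes>\<^sub>M M \<rightarrow>\<^sub>M (restrict_space borel {0..} :: real measure)"
      by measurable
    from measurable_compose[OF this measurable_restrict_space1[OF measurable_ident]]
    have [measurable]: "(\<lambda>x. fst x) \<in> restrict_space borel {0..} \<Otimes>\<^sub>M M \<rightarrow>\<^sub>M (borel :: real measure)"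
      by simp
    show "(\<lambda>x. indicator {\<tau> i<..\<tau> (Suc i)} (fst x) :: real) \<in> borel_measurable (restrict_space borel {0..} \<Otimes>\<^sub>M M)"
      by measurable
  qed
qed

lemma simple_integral_measurable:
  assumes st: "step_process F m \<tau> \<xi>" and s: "0 \<le> s"
  shows "simple_integral W m \<tau> \<xi> s \<in> borel_measurable M"
  unfolding simple_integral_def[abs_def]
proof (intro borel_arith_measurable)
  fix i assume i: "i \<in> {..<m}"
  show "\<xi> i \<in> borel_measurable M"
    using st i measurable_F_M[of "\<xi> i" "\<tau> i"] by (auto simp: step_process_def)
  show "W (min s (\<tau> (Suc i))) \<in> borel_measurable M" "W (min s (\<tau> i)) \<in> borel_measurable M"
    using measurable_F_M[OF W_measurable] step_process_nonneg[OF st, of i] step_process_nonneg[OF st, of "Suc i"] i s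
    by auto
qed

text \<open>One grid is taken that contains both partitions, the times in \<open>Q\<close>, and
  \<open>0\<close> and \<open>t\<close>. On it the difference of the two integrals is a single
  stochastic sum, to which \<open>ito_sum_maximal_inequality\<close> applies.\<close>

lemma step_process_maximal_inequality:
  assumes A: "step_process F m \<tau> \<xi>" and B: "step_process F m' \<tau>' \<xi>'"
    and Q: "finite Q" "Q \<subseteq> {0..t}" and t: "0 \<le> t" and \<epsilon>: "0 < \<epsilon>" and \<eta>: "0 < \<eta>"
  shows "\<P>(w in M. \<exists>s\<in>Q. \<bar>simple_integral W m \<tau> \<xi> s w - simple_integral W m' \<tau>' \<xi>' s w\<bar> > \<epsilon>)
    \<le> \<P>(w in M. path_dist2 (simple_path m \<tau> \<xi>) (simple_path m' \<tau>' \<xi>') t w > ennreal \<eta>) + \<eta> / \<epsilon>\<^sup>2"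
proof -
  let ?I = "\<lambda>s w. simple_integral W m \<tau> \<xi> s w - simple_integral W m' \<tau>' \<xi>' s w"
  let ?d = "path_dist2 (simple_path m \<tau> \<xi>) (simple_path m' \<tau>' \<xi>') t"
  define P where "P = \<tau> ` {..m} \<union> \<tau>' ` {..m'} \<union> Q \<union> {0, t}"
  obtain \<sigma> :: "nat \<Rightarrow> real" and n where \<sigma>: "strict_mono \<sigma>" and P: "P = \<sigma> ` {..n}"
    by (rule finite_strict_mono_enumeration[of P]) (use Q in \<open>auto simp: P_def\<close>)
  have P0: "0 \<le> x" if "x \<in> P" for x
    using that Q t step_process_nonneg[OF A] step_process_nonneg[OF B] by (auto simp: P_def)
  have \<sigma>0: "0 \<le> \<sigma> 0" using P0 P by auto
  have sub: "\<tau> ` {..m} \<subseteq> range \<sigma>" "\<tau>' ` {..m'} \<subseteq> range \<sigma>" "Q \<subseteq> range \<sigma>" "t \<in> range \<sigma>"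
    using P unfolding P_def by blast+
  obtain p where p: "t = \<sigma> p" using sub by blast
  define X where "X s w = simple_path m \<tau> \<xi> s w - simple_path m' \<tau>' \<xi>' s w" for s w
  \<comment> \<open>Predictability: the value on the piece that ends at
    \<open>\<sigma> (Suc j)\<close> is determined at its left end. A coefficient
    \<open>\<xi> i\<close> enters only if \<open>\<tau> i < \<sigma> (Suc j)\<close>, which on the
    grid means \<open>\<tau> i \<le> \<sigma> j\<close>.\<close>
  have meas: "simple_path m \<tau> \<xi> (\<sigma> (Suc j)) \<in> borel_measurable (F (\<sigma> j))"
    if st: "step_process F m \<tau> \<xi>" and sub: "\<tau> ` {..m} \<subseteq> range \<sigma>" for m \<tau> \<xi> j
    unfolding simple_path_def[abs_def]
  proof (intro borel_measurable_sum)
    fix i assume i: "i \<in> {..<m}"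
    then have "\<tau> i \<in> range \<sigma>" using sub by auto
    then obtain a where a: "\<tau> i = \<sigma> a" by blast
    show "(\<lambda>x. \<xi> i x * indicator {\<tau> i<..\<tau> (Suc i)} (\<sigma> (Suc j))) \<in> borel_measurable (F (\<sigma> j))"
    proof (cases "\<tau> i < \<sigma> (Suc j)")
      case True
      then have "\<tau> i \<le> \<sigma> j" using \<sigma> by (simp add: a strict_mono_less strict_mono_less_eq)
      then have "\<xi> i \<in> borel_measurable (F (\<sigma> j))"
        using st i measurable_F_mono[of "\<xi> i" "\<tau> i"] by (auto simp: step_process_def)
      then show ?thesis by measurable
    qed simp
  qed
  have int: "simple_integral W m \<tau> \<xi> (\<sigma> k) w - simple_integral W m' \<tau>' \<xi>' (\<sigma> k) w =
    (\<Sum>j<k. X (\<sigma> (Suc j)) w * dW \<sigma> j w)" for k w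
    using A B sub \<sigma> by (subst (1 2) simple_integral_refine)
      (auto simp: step_process_def X_def sum_subtractf left_diff_distrib)
  have ev: "{w \<in> space M. \<exists>s\<in>Q. \<bar>?I s w\<bar> > \<epsilon>} \<subseteq>
    {w \<in> space M. \<exists>k\<le>p. \<bar>\<Sum>j<k. X (\<sigma> (Suc j)) w * dW \<sigma> j w\<bar> > \<epsilon>}"
  proof safe
    fix s w assume s: "s \<in> Q" and *: "\<epsilon> < \<bar>?I s w\<bar>"
    from s sub obtain k where k: "s = \<sigma> k" by blast
    moreover have "k \<le> p" using s Q k p \<sigma> by (auto simp: strict_mono_less_eq)
    ultimately show "\<exists>k\<le>p. \<bar>\<Sum>j<k. X (\<sigma> (Suc j)) w * dW \<sigma> j w\<bar> > \<epsilon>"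
      using * by (auto simp: int)
  qed
  have X_meas: "X (\<sigma> (Suc j)) \<in> borel_measurable (F (\<sigma> j))" for j
    unfolding X_def[abs_def] by (intro borel_measurable_diff meas A B sub)
  have \<sigma>_nn: "0 \<le> \<sigma> j" for j by (rule strict_mono_grid[OF \<sigma> \<sigma>0])
  have [measurable]: "X (\<sigma> (Suc j)) \<in> borel_measurable M" "W (\<sigma> j) \<in> borel_measurable M" for j
    using measurable_F_M[OF X_meas] measurable_F_M[OF W_measurable[OF \<sigma>_nn]] by auto
  have "\<P>(w in M. \<exists>s\<in>Q. \<bar>?I s w\<bar> > \<epsilon>) \<le>
    \<P>(w in M. \<exists>k\<le>p. \<bar>\<Sum>j<k. X (\<sigma> (Suc j)) w * dW \<sigma> j w\<bar> > \<epsilon>)"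
    by (rule finite_measure_mono[OF ev]) measurable
  also have "\<dots> \<le> \<P>(w in M. (\<Sum>j<p. (X (\<sigma> (Suc j)) w)\<^sup>2 * (\<sigma> (Suc j) - \<sigma> j)) > \<eta>) + \<eta> / \<epsilon>\<^sup>2"
    by (rule ito_sum_maximal_inequality[OF \<sigma> \<sigma>0 X_meas \<epsilon> \<eta>])
  also have "\<P>(w in M. (\<Sum>j<p. (X (\<sigma> (Suc j)) w)\<^sup>2 * (\<sigma> (Suc j) - \<sigma> j)) > \<eta>) \<le>
    \<P>(w in M. ?d w > ennreal \<eta>)"
  proof (rule finite_measure_mono)
    show "{w \<in> space M. (\<Sum>j<p. (X (\<sigma> (Suc j)) w)\<^sup>2 * (\<sigma> (Suc j) - \<sigma> j)) > \<eta>} \<subseteq>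
      {w \<in> space M. ?d w > ennreal \<eta>}"
    proof safe
      fix w assume "\<eta> < (\<Sum>j<p. (X (\<sigma> (Suc j)) w)\<^sup>2 * (\<sigma> (Suc j) - \<sigma> j))"
      then have "ennreal \<eta> < ennreal (\<Sum>j<p. (X (\<sigma> (Suc j)) w)\<^sup>2 * (\<sigma> (Suc j) - \<sigma> j))"
        using \<eta> by (simp add: ennreal_less_iff)
      also have "\<dots> \<le> (\<integral>\<^sup>+ s \<in> {0..\<sigma> p}. ennreal ((X s w)\<^sup>2) \<partial>lborel)"
      proof (rule sum_le_nn_set_integral[OF \<sigma> \<sigma>0])
        fix j s assume "\<sigma> j < s" "s \<le> \<sigma> (Suc j)"
        then show "(X s w)\<^sup>2 = (X (\<sigma> (Suc j)) w)\<^sup>2"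
          unfolding X_def using simple_path_const[OF \<sigma> sub(1), of j s \<xi> w]
            simple_path_const[OF \<sigma> sub(2), of j s \<xi>' w] by simp
      qed (auto simp: X_def)
      finally show "ennreal \<eta> < ?d w"
        by (simp add: path_dist2_def X_def p)
    qed
    have [measurable]: "?d \<in> borel_measurable M"
      by (intro path_dist2_measurable simple_path_jointly_measurable A B)
    show "{w \<in> space M. ?d w > ennreal \<eta>} \<in> events"
      by measurable
  qed
  finally show ?thesis by simp
qed

end

text \<open>Extracts a limit from bounds of Lenglart's form: first \<open>\<eta>\<close> is fixed so
  that \<open>c * \<eta>\<close> is small, then \<open>k\<close> is taken large.\<close>

lemma tendsto_0_tradeoff:
  fixes p :: "nat \<Rightarrow> real"
  assumes p: "\<And>k. 0 \<le> p k" "\<And>\<eta> k. 0 < \<eta> \<Longrightarrow> p k \<le> q \<eta> k + c * \<eta>"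
    and q: "\<And>\<eta>. 0 < \<eta> \<Longrightarrow> q \<eta> \<longlonglongrightarrow> 0" and c: "0 < c"
  shows "p \<longlonglongrightarrow> 0"
proof (rule LIMSEQ_I)
  fix e :: real assume e: "0 < e"
  define \<eta> where "\<eta> = e / (2 * c)"
  have \<eta>: "0 < \<eta>" "c * \<eta> = e / 2" using e c by (auto simp: \<eta>_def)
  from LIMSEQ_D[OF q[OF \<eta>(1)], of "e / 2"] e obtain K where
    K: "\<And>k. k \<ge> K \<Longrightarrow> \<bar>q \<eta> k\<bar> < e / 2" by auto
  show "\<exists>K. \<forall>k\<ge>K. norm (p k - 0) < e"
  proof (intro exI allI impI)
    fix k assume "k \<ge> K"
    then show "norm (p k - 0) < e" using K[of k] p(1)[of k] p(2)[OF \<eta>(1), of k] \<eta>(2) by simp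
  qed
qed

context brownian_motion_space
begin

text \<open>Passage to the limit in the inequality for step processes. A deviation above
  \<open>\<epsilon>\<close> forces one above \<open>\<epsilon> / 2\<close> either in the
  approximation, which a union bound over the finite set \<open>Q\<close> makes negligible, or
  between the step processes. The squared distance obeys the triangle inequality with a factor 2, so
  \<open>\<eta>\<close> becomes \<open>4 * \<eta>\<close>, and
  \<open>4 * \<eta> / (\<epsilon> / 2)^2\<close> is the error term.\<close>

lemma limit_step_process_maximal_inequality:
  assumes S: "\<And>k. step_process F (m k) (\<tau> k) (\<xi> k)" and B: "step_process F m' \<tau>' \<xi>'"
    and H: "jointly_measurable M H"
    and SH: "\<And>\<epsilon>. 0 < \<epsilon> \<Longrightarrow>
      (\<lambda>k. \<P>(w in M. path_dist2 (simple_path (m k) (\<tau> k) (\<xi> k)) H t w > ennreal \<epsilon>)) \<longlonglongrightarrow> 0"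
    and Q: "finite Q" "Q \<subseteq> {0..t}" and t: "0 \<le> t"
    and J: "\<And>s. s \<in> Q \<Longrightarrow> J s \<in> borel_measurable M"
    and SJ: "\<And>s \<epsilon>. s \<in> Q \<Longrightarrow> 0 < \<epsilon> \<Longrightarrow>
      (\<lambda>k. \<P>(w in M. \<bar>simple_integral W (m k) (\<tau> k) (\<xi> k) s w - J s w\<bar> > \<epsilon>)) \<longlonglongrightarrow> 0"
    and \<epsilon>: "0 < \<epsilon>" and \<eta>: "0 < \<eta>"
  shows "\<P>(w in M. \<exists>s\<in>Q. \<bar>J s w - simple_integral W m' \<tau>' \<xi>' s w\<bar> > \<epsilon>)
    \<le> \<P>(w in M. path_dist2 H (simple_path m' \<tau>' \<xi>') t w > ennreal \<eta>) + 16 * \<eta> / \<epsilon>\<^sup>2"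
proof -
  let ?B = "simple_integral W m' \<tau>' \<xi>'" and ?b = "simple_path m' \<tau>' \<xi>'"
  let ?S = "\<lambda>k. simple_integral W (m k) (\<tau> k) (\<xi> k)" and ?s = "\<lambda>k. simple_path (m k) (\<tau> k) (\<xi> k)"
  let ?E1 = "\<lambda>k s. {w \<in> space M. \<bar>?S k s w - J s w\<bar> > \<epsilon> / 2}"
  let ?E2 = "\<lambda>k. {w \<in> space M. \<exists>s\<in>Q. \<bar>?S k s w - ?B s w\<bar> > \<epsilon> / 2}"
  let ?E3 = "\<lambda>k. {w \<in> space M. path_dist2 (?s k) H t w > ennreal \<eta>}"
  let ?E4 = "{w \<in> space M. path_dist2 H ?b t w > ennreal \<eta>}"
  let ?E5 = "\<lambda>k. {w \<in> space M. path_dist2 (?s k) ?b t w > ennreal (4 * \<eta>)}"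
  have Q0: "0 \<le> s" if "s \<in> Q" for s using Q that by auto
  have jm: "jointly_measurable M (?s k)" "jointly_measurable M ?b" for k
    by (intro simple_path_jointly_measurable S B)+
  have [measurable]: "path_dist2 (?s k) H t \<in> borel_measurable M" "path_dist2 H ?b t \<in> borel_measurable M"
    "path_dist2 (?s k) ?b t \<in> borel_measurable M" for k
    using path_dist2_measurable[OF jm(1) H] path_dist2_measurable[OF H jm(2)] path_dist2_measurable[OF jm]
    by auto
  have [measurable]: "J s \<in> borel_measurable M" "?S k s \<in> borel_measurable M" "?B s \<in> borel_measurable M"
    if "s \<in> Q" for s k
    using J[OF that] simple_integral_measurable[OF S Q0[OF that]] simple_integral_measurable[OF B Q0[OF that]]
    by auto
  note [measurable] = \<open>finite Q\<close>[THEN countable_finite]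
  have meas: "?E1 k s \<in> events" if "s \<in> Q" for s k
    using that by measurable
  have meas2: "?E2 k \<in> events" for k by measurable
  have bound: "\<P>(w in M. \<exists>s\<in>Q. \<bar>J s w - ?B s w\<bar> > \<epsilon>) \<le>
    (\<Sum>s\<in>Q. prob (?E1 k s)) + (prob (?E3 k) + prob ?E4 + 16 * \<eta> / \<epsilon>\<^sup>2)" for k
  proof -
    have "{w \<in> space M. \<exists>s\<in>Q. \<bar>J s w - ?B s w\<bar> > \<epsilon>} \<subseteq> (\<Union>s\<in>Q. ?E1 k s) \<union> ?E2 k"
    proof safe
      fix w s assume *: "w \<in> space M" "s \<in> Q" "\<epsilon> < \<bar>J s w - ?B s w\<bar>"
        and n: "w \<notin> (\<Union>s\<in>Q. ?E1 k s)"
      then have "\<bar>?S k s w - J s w\<bar> \<le> \<epsilon> / 2" by (auto simp: not_less)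
      then have "\<bar>?S k s w - ?B s w\<bar> > \<epsilon> / 2" using *(3) by linarith
      then show "\<exists>s\<in>Q. \<epsilon> / 2 < \<bar>?S k s w - ?B s w\<bar>" using *(2) by blast
    qed
    then have "\<P>(w in M. \<exists>s\<in>Q. \<bar>J s w - ?B s w\<bar> > \<epsilon>) \<le> prob ((\<Union>s\<in>Q. ?E1 k s) \<union> ?E2 k)"
      by (rule finite_measure_mono) (intro sets.Un sets.finite_UN meas meas2 Q)
    also have "\<dots> \<le> prob (\<Union>s\<in>Q. ?E1 k s) + prob (?E2 k)"
      by (intro measure_Un_le sets.finite_UN meas meas2 Q)
    also have "prob (\<Union>s\<in>Q. ?E1 k s) \<le> (\<Sum>s\<in>Q. prob (?E1 k s))"
      by (intro measure_UNION_le Q meas)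
    also have "prob (?E2 k) \<le> prob (?E5 k) + (4 * \<eta>) / (\<epsilon> / 2)\<^sup>2"
      by (rule step_process_maximal_inequality[OF S B Q t]) (use \<epsilon> \<eta> in auto)
    also have "prob (?E5 k) \<le> prob (?E3 k \<union> ?E4)"
    proof (rule finite_measure_mono)
      show "?E5 k \<subseteq> ?E3 k \<union> ?E4"
      proof (safe, rule ccontr)
        fix w assume *: "w \<in> space M" "ennreal (4 * \<eta>) < path_dist2 (?s k) ?b t w"
          and n: "\<not> ennreal \<eta> < path_dist2 H ?b t w" "\<not> ennreal \<eta> < path_dist2 (?s k) H t w"
        have "path_dist2 (?s k) ?b t w \<le> 2 * path_dist2 (?s k) H t w + 2 * path_dist2 H ?b t w"
          by (rule path_dist2_triangle[OF jm(1) H jm(2) *(1)])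
        also have "\<dots> \<le> 2 * ennreal \<eta> + 2 * ennreal \<eta>"
          using n by (intro add_mono mult_left_mono) (auto simp: not_less)
        also have "\<dots> = ennreal (4 * \<eta>)"
          using \<eta> by (simp add: ennreal_mult' flip: distrib_right)
        finally show False using *(2) by simp
      qed
    qed measurable
    also have "\<dots> \<le> prob (?E3 k) + prob ?E4" by (rule measure_Un_le) measurable
    finally show ?thesis by (simp add: power_divide)
  qed
  have "(\<lambda>k. (\<Sum>s\<in>Q. prob (?E1 k s)) + (prob (?E3 k) + prob ?E4 + 16 * \<eta> / \<epsilon>\<^sup>2))
    \<longlonglongrightarrow> (\<Sum>s\<in>Q. 0) + (0 + prob ?E4 + 16 * \<eta> / \<epsilon>\<^sup>2)"
    using \<epsilon> \<eta> by (intro tendsto_intros SJ SH) auto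
  then have "\<P>(w in M. \<exists>s\<in>Q. \<bar>J s w - ?B s w\<bar> > \<epsilon>) \<le> (\<Sum>s\<in>Q. 0) + (0 + prob ?E4 + 16 * \<eta> / \<epsilon>\<^sup>2)"
    by (rule LIMSEQ_le_const) (use bound in auto)
  then show ?thesis by simp
qed

text \<open>The hypothesis supplies a separate approximating sequence for every time, whereas the
  preceding lemma wants one sequence for all of \<open>Q\<close>. The sequence belonging to the
  final time \<open>t\<close> is shown to serve at every earlier time.\<close>

lemma has_ito_integral_maximal_inequality:
  assumes J: "\<And>s. 0 \<le> s \<Longrightarrow> s \<le> t \<Longrightarrow> has_ito_integral M F W H s (J s)"
    and B: "step_process F m' \<tau>' \<xi>'"
    and Q: "finite Q" "Q \<subseteq> {0..t}" and t: "0 \<le> t"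
    and \<epsilon>: "0 < \<epsilon>" and \<eta>: "0 < \<eta>"
  shows "\<P>(w in M. \<exists>s\<in>Q. \<bar>J s w - simple_integral W m' \<tau>' \<xi>' s w\<bar> > \<epsilon>)
    \<le> \<P>(w in M. path_dist2 H (simple_path m' \<tau>' \<xi>') t w > ennreal \<eta>) + 16 * \<eta> / \<epsilon>\<^sup>2"
proof -
  have H: "jointly_measurable M H" using J[of t] t by (simp add: has_ito_integral_def)
  have J_meas: "J s \<in> borel_measurable M" if "s \<in> {0..t}" for s
    using J[of s] that by (simp add: has_ito_integral_def)
  let ?d = "\<lambda>m \<tau> \<xi> s \<epsilon> k. \<P>(w in M. path_dist2 (simple_path (m k) (\<tau> k) (\<xi> k)) H s w > ennreal \<epsilon>)"
  let ?e = "\<lambda>m \<tau> \<xi> s \<epsilon> k. \<P>(w in M. \<bar>simple_integral W (m k) (\<tau> k) (\<xi> k) s w - J s w\<bar> > \<epsilon>)"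
  have approx: "\<exists>m \<tau> \<xi>. (\<forall>k. step_process F (m k) (\<tau> k) (\<xi> k)) \<and>
    (\<forall>\<epsilon>>0. ?d m \<tau> \<xi> s \<epsilon> \<longlonglongrightarrow> 0) \<and> (\<forall>\<epsilon>>0. ?e m \<tau> \<xi> s \<epsilon> \<longlonglongrightarrow> 0)"
    if "s \<in> {0..t}" for s
  proof -
    have "has_ito_integral M F W H s (J s)" using J that by simp
    then obtain m \<tau> \<xi> where sp: "\<forall>k::nat. simple_process F (m k) (\<tau> k) (\<xi> k)"
      and c: "\<forall>\<epsilon>>0. (\<lambda>k. prob {w \<in> space M.
            (\<integral>\<^sup>+ r \<in> {0..s}. ennreal ((simple_path (m k) (\<tau> k) (\<xi> k) r w - H r w)\<^sup>2) \<partial>lborel)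
              > ennreal \<epsilon>}) \<longlonglongrightarrow> 0"
        "\<forall>\<epsilon>>0. ?e m \<tau> \<xi> s \<epsilon> \<longlonglongrightarrow> 0"
      unfolding has_ito_integral_def by (elim conjE exE)
    have "\<forall>k. step_process F (m k) (\<tau> k) (\<xi> k)"
      using sp simple_process_imp_step_process by blast
    with c show ?thesis
      unfolding path_dist2_def by (intro exI[of _ m] exI[of _ \<tau>] exI[of _ \<xi>] conjI)
  qed
  \<comment> \<open>The one-point case uses the sequence that belongs to \<open>s\<close> itself, so
    nothing has to be shown about other times.\<close>
  have single: "\<P>(w in M. \<bar>J s w - simple_integral W m' \<tau>' \<xi>' s w\<bar> > \<epsilon>)
    \<le> \<P>(w in M. path_dist2 H (simple_path m' \<tau>' \<xi>') s w > ennreal \<eta>) + 16 * \<eta> / \<epsilon>\<^sup>2"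
    if s: "s \<in> {0..t}" and B: "step_process F m' \<tau>' \<xi>'" and "0 < \<epsilon>" "0 < \<eta>" for s m' \<tau>' \<xi>' \<epsilon> \<eta>
  proof -
    obtain m \<tau> \<xi> where S: "\<And>k. step_process F (m k) (\<tau> k) (\<xi> k)"
      "\<And>\<epsilon>. 0 < \<epsilon> \<Longrightarrow> ?d m \<tau> \<xi> s \<epsilon> \<longlonglongrightarrow> 0" "\<And>\<epsilon>. 0 < \<epsilon> \<Longrightarrow> ?e m \<tau> \<xi> s \<epsilon> \<longlonglongrightarrow> 0"
      using approx[OF s] by blast
    have "\<P>(w in M. \<exists>r\<in>{s}. \<bar>J r w - simple_integral W m' \<tau>' \<xi>' r w\<bar> > \<epsilon>)
      \<le> \<P>(w in M. path_dist2 H (simple_path m' \<tau>' \<xi>') s w > ennreal \<eta>) + 16 * \<eta> / \<epsilon>\<^sup>2"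
      by (rule limit_step_process_maximal_inequality[OF S(1) B H S(2)]) (use S that J_meas in auto)
    then show ?thesis by simp
  qed
  have "t \<in> {0..t}" using t by simp
  then obtain m \<tau> \<xi> where S: "\<And>k. step_process F (m k) (\<tau> k) (\<xi> k)"
    "\<And>\<epsilon>. 0 < \<epsilon> \<Longrightarrow> ?d m \<tau> \<xi> t \<epsilon> \<longlonglongrightarrow> 0"
    using approx by blast
  \<comment> \<open>Here \<open>single\<close> is applied to the approximations of \<open>H\<close>
    on \<open>[0,t]\<close>, taken as the comparison process. Their distance to \<open>H\<close> on
    \<open>[0,s]\<close> is at most the one on \<open>[0,t]\<close>, which tends to 0 in
    probability.\<close>
  have SJ: "?e m \<tau> \<xi> s \<epsilon> \<longlonglongrightarrow> 0" if s: "s \<in> Q" and \<epsilon>: "0 < \<epsilon>" for s \<epsilon>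
  proof (rule tendsto_0_tradeoff[where q = "?d m \<tau> \<xi> t" and c = "16 / \<epsilon>\<^sup>2"])
    fix \<eta> :: real and k assume \<eta>: "0 < \<eta>"
    let ?A = "simple_path (m k) (\<tau> k) (\<xi> k)"
    have st: "s \<in> {0..t}" using s Q by auto
    have [measurable]: "path_dist2 ?A H t \<in> borel_measurable M"
      by (rule path_dist2_measurable[OF simple_path_jointly_measurable[OF S(1)] H])
    have "\<P>(w in M. path_dist2 H ?A s w > ennreal \<eta>) \<le> ?d m \<tau> \<xi> t \<eta> k"
      by (rule finite_measure_mono)
        (use path_dist2_mono[of s t] st in \<open>auto simp: path_dist2_commute[of H] intro: order.strict_trans2[OF _ path_dist2_mono]\<close>)
    then show "?e m \<tau> \<xi> s \<epsilon> k \<le> ?d m \<tau> \<xi> t \<eta> k + 16 / \<epsilon>\<^sup>2 * \<eta>"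
      using single[OF st S(1)[of k] \<epsilon> \<eta>] by (simp add: abs_minus_commute)
  qed (use S(2) \<epsilon> in auto)
  show ?thesis
    by (rule limit_step_process_maximal_inequality[OF S(1) B H S(2) Q t _ SJ \<epsilon> \<eta>])
      (use J_meas Q in auto)
qed

text \<open>If the paths agree for almost every time, the first term of the maximal inequality
  vanishes for each \<open>\<eta>\<close>, and \<open>\<eta>\<close> may tend to 0. This evaluates
  the integrals in the Euler scheme, even with unbounded coefficients.\<close>

lemma has_ito_integral_step_AE:
  assumes J: "\<And>s. 0 \<le> s \<Longrightarrow> s \<le> t \<Longrightarrow> has_ito_integral M F W H s (J s)"
    and B: "step_process F m \<tau> \<xi>" and t: "0 \<le> t"
    and eq: "AE w in M. path_dist2 H (simple_path m \<tau> \<xi>) t w = 0"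
  shows "AE w in M. J t w = simple_integral W m \<tau> \<xi> t w"
proof -
  have H: "jointly_measurable M H" using J[of t] t by (simp add: has_ito_integral_def)
  have [measurable]: "path_dist2 H (simple_path m \<tau> \<xi>) t \<in> borel_measurable M"
    by (rule path_dist2_measurable[OF H simple_path_jointly_measurable[OF B]])
  have [measurable]: "J t \<in> borel_measurable M" using J[of t] t by (simp add: has_ito_integral_def)
  have [measurable]: "simple_integral W m \<tau> \<xi> t \<in> borel_measurable M"
    by (rule simple_integral_measurable[OF B t])
  have "AE w in M. \<bar>J t w - simple_integral W m \<tau> \<xi> t w\<bar> \<le> \<epsilon>" if \<epsilon>: "0 < \<epsilon>" for \<epsilon>
  proof -
    let ?E = "{w \<in> space M. \<bar>J t w - simple_integral W m \<tau> \<xi> t w\<bar> > \<epsilon>}"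
    have le: "prob ?E \<le> 16 * \<eta> / \<epsilon>\<^sup>2" if \<eta>: "0 < \<eta>" for \<eta>
    proof -
      have "\<P>(w in M. path_dist2 H (simple_path m \<tau> \<xi>) t w > ennreal \<eta>) = 0"
        using eq by (intro prob_eq_0[THEN iffD2]) auto
      then show ?thesis
        using has_ito_integral_maximal_inequality[OF J B, of t "{t}" \<epsilon> \<eta>] t \<epsilon> \<eta> by simp
    qed
    have "prob ?E \<le> 0"
    proof (rule field_le_epsilon)
      fix e :: real assume "0 < e"
      then show "prob ?E \<le> 0 + e" using le[of "e * \<epsilon>\<^sup>2 / 16"] \<epsilon> by simp
    qed
    then have "prob ?E = 0" by (simp add: measure_le_0_iff)
    then have "AE w in M. w \<notin> ?E" by (subst prob_eq_0[symmetric]) auto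
    then show ?thesis by (auto elim!: AE_mp simp: not_less)
  qed
  then have "AE w in M. \<forall>n. \<bar>J t w - simple_integral W m \<tau> \<xi> t w\<bar> \<le> inverse (real (Suc n))"
    by (subst AE_all_countable) auto
  then show ?thesis
  proof (rule AE_mp, intro AE_I2 impI)
    fix w assume *: "\<forall>n. \<bar>J t w - simple_integral W m \<tau> \<xi> t w\<bar> \<le> inverse (real (Suc n))"
    have "\<bar>J t w - simple_integral W m \<tau> \<xi> t w\<bar> \<le> 0"
      by (rule LIMSEQ_le_const[OF LIMSEQ_inverse_real_of_nat]) (use * in auto)
    then show "J t w = simple_integral W m \<tau> \<xi> t w" by simp
  qed
qed

end

section \<open>Convergence on fine grids\<close>

text \<open>Dominated convergence for indicators. It turns pathwise facts with a random threshold,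
  such as the uniform continuity of a path, into convergence of probabilities.\<close>

lemma (in prob_space) prob_tendsto_0_if_AE_eventually_notin:
  assumes E: "\<And>n. E n \<in> events" and ev: "AE w in M. eventually (\<lambda>n. w \<notin> E n) sequentially"
  shows "(\<lambda>n. prob (E n)) \<longlonglongrightarrow> 0"
proof -
  have "(\<lambda>n. expectation (indicator (E n) :: _ \<Rightarrow> real)) \<longlonglongrightarrow> expectation (\<lambda>_. 0)"
  proof (rule integral_dominated_convergence[where w = "\<lambda>_. 1"])
    show "AE x in M. (\<lambda>n. indicator (E n) x :: real) \<longlonglongrightarrow> 0"
      using ev
    proof (rule AE_mp, intro AE_I2 impI)
      fix x assume "eventually (\<lambda>n. x \<notin> E n) sequentially"
      then have "eventually (\<lambda>n. (indicator (E n) x :: real) = 0) sequentially"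
        by eventually_elim simp
      then show "(\<lambda>n. indicator (E n) x :: real) \<longlonglongrightarrow> 0" by (rule tendsto_eventually)
    qed
  qed (use E in \<open>auto simp: indicator_def\<close>)
  then show ?thesis using E by simp
qed

text \<open>A diagonal choice: at stage \<open>k\<close> the families \<open>0\<close> to
  \<open>k\<close> all have probability below \<open>(1/2) ^ k\<close>. For each \<open>m\<close>
  the Borel-Cantelli lemma applies from \<open>k = m\<close> on, so one subsequence works for all
  \<open>m\<close>.\<close>

lemma (in prob_space) AE_subsequence_eventually_notin:
  fixes E :: "nat \<Rightarrow> nat \<Rightarrow> 'a set"
  assumes E: "\<And>m n. E m n \<in> events" and lim: "\<And>m. (\<lambda>n. prob (E m n)) \<longlonglongrightarrow> 0"
  obtains r :: "nat \<Rightarrow> nat" where "strict_mono r"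
    "AE w in M. \<forall>m. eventually (\<lambda>k. w \<notin> E m (r k)) sequentially"
proof -
  have "\<exists>r. \<forall>k. (\<forall>m\<le>k. prob (E m (r k)) < (1/2) ^ k) \<and> r k < r (Suc k)"
  proof (rule dependent_nat_choice)
    have ex: "\<exists>y>x. \<forall>m\<le>k. prob (E m y) < (1/2) ^ k" for k x :: nat
    proof -
      have "eventually (\<lambda>n. \<forall>m\<in>{..k}. prob (E m n) < (1/2) ^ k) sequentially"
        by (intro eventually_ball_finite ballI order_tendstoD(2)[OF lim]) auto
      then have "eventually (\<lambda>n. n > x \<and> (\<forall>m\<in>{..k}. prob (E m n) < (1/2) ^ k)) sequentially"
        using eventually_gt_at_top by (rule eventually_conj[rotated])
      then show ?thesis using eventually_happens'[OF sequentially_bot] by fastforce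
    qed
    show "\<exists>x. \<forall>m\<le>0. prob (E m x) < (1/2) ^ 0" using ex[of _ 0] by blast
    show "\<exists>y. (\<forall>m\<le>Suc k. prob (E m y) < (1/2) ^ Suc k) \<and> x < y" for x k
      using ex[of x "Suc k"] by blast
  qed
  then obtain r where r: "\<And>k m. m \<le> k \<Longrightarrow> prob (E m (r k)) < (1/2) ^ k" "\<And>k. r k < r (Suc k)" by blast
  have "AE w in M. eventually (\<lambda>k. w \<in> space M - E m (r k)) sequentially" for m
  proof (rule borel_cantelli_AE1)
    show "summable (\<lambda>k. prob (E m (r k)))"
    proof (rule summable_comparison_test)
      show "\<exists>N. \<forall>n\<ge>N. norm (prob (E m (r n))) \<le> (1/2) ^ n"
        using r(1) by (intro exI[of _ m]) (auto intro: less_imp_le)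
    qed (simp add: summable_geometric)
  qed (use E in \<open>auto simp: less_top[symmetric]\<close>)
  then have "AE w in M. eventually (\<lambda>k. w \<notin> E m (r k)) sequentially" for m
    by (rule AE_mp) (auto elim: eventually_mono)
  then have "AE w in M. \<forall>m. eventually (\<lambda>k. w \<notin> E m (r k)) sequentially"
    by (subst AE_all_countable) auto
  moreover have "strict_mono r" using r(2) by (simp add: strict_mono_Suc_iff)
  ultimately show ?thesis using that by blast
qed

lemma step_interval_exhaustive:
  fixes \<tau> :: "nat \<Rightarrow> real"
  assumes "\<tau> 0 < s" "s \<le> \<tau> m"
  shows "\<exists>i<m. \<tau> i < s \<and> s \<le> \<tau> (Suc i)"
  using assms(2)
proof (induction m)
  case (Suc m)
  show ?case
  proof (cases "s \<le> \<tau> m")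
    case True
    then show ?thesis using Suc.IH less_SucI by blast
  next
    case False
    then show ?thesis using Suc.prems by (intro exI[of _ m]) auto
  qed
qed (use assms(1) in auto)

lemma simple_path_eq:
  assumes \<tau>: "strict_mono \<tau>" and i: "i < m" "\<tau> i < s" "s \<le> \<tau> (Suc i)"
  shows "simple_path m \<tau> \<xi> s w = \<xi> i w"
proof -
  have "(indicator {\<tau> j<..\<tau> (Suc j)} s :: real) = (if j = i then 1 else 0)" for j
  proof -
    have "j = i" if "\<tau> j < s" "s \<le> \<tau> (Suc j)"
    proof -
      have "\<tau> j < \<tau> (Suc i)" "\<tau> i < \<tau> (Suc j)" using that i by auto
      then show ?thesis using \<tau> by (simp add: strict_mono_less)
    qed
    then show ?thesis using i by (cases "j = i") (auto simp: indicator_def)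
  qed
  then have "simple_path m \<tau> \<xi> s w = (\<Sum>j<m. if j = i then \<xi> j w else 0)"
    unfolding simple_path_def by (intro sum.cong refl) simp
  then show ?thesis using i by simp
qed

text \<open>Only the open pieces of the partition matter, so that this also applies to integrands
  which are constant on \<open>[\<tau> i, \<tau> (i+1))\<close>.\<close>

lemma path_dist2_step_le:
  assumes \<tau>: "strict_mono \<tau>" "\<tau> 0 = 0" and t: "0 \<le> t" "t \<le> \<tau> m" and e: "0 \<le> e"
    and close: "\<And>i s. i < m \<Longrightarrow> \<tau> i < s \<Longrightarrow> s < \<tau> (Suc i) \<Longrightarrow> s \<le> t \<Longrightarrow> \<bar>H s w - \<xi> i w\<bar> \<le> e"
  shows "path_dist2 H (simple_path m \<tau> \<xi>) t w \<le> ennreal (e\<^sup>2 * t)"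
proof -
  have "AE s in lborel. \<forall>i. s \<noteq> \<tau> i" by (subst AE_all_countable) (auto intro: AE_lborel_singleton)
  then have "AE s in lborel. ennreal ((H s w - simple_path m \<tau> \<xi> s w)\<^sup>2) * indicator {0..t} s
      \<le> ennreal (e\<^sup>2) * indicator {0..t} s"
  proof (rule AE_mp, intro AE_I2 impI)
    fix s assume ns: "\<forall>i. s \<noteq> \<tau> i"
    show "ennreal ((H s w - simple_path m \<tau> \<xi> s w)\<^sup>2) * indicator {0..t} s
      \<le> ennreal (e\<^sup>2) * indicator {0..t} s"
    proof (cases "s \<in> {0..t}")
      case True
      then have "\<tau> 0 < s" "s \<le> \<tau> m" using ns[rule_format, of 0] \<tau> t by auto
      from step_interval_exhaustive[of \<tau>, OF this] obtain i
        where i: "i < m" "\<tau> i < s" "s \<le> \<tau> (Suc i)" by blast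
      have "\<bar>H s w - \<xi> i w\<bar> \<le> e"
        using close[of i s] i ns[rule_format, of "Suc i"] True by auto
      then have "(H s w - \<xi> i w)\<^sup>2 \<le> e\<^sup>2" using e by (metis abs_le_square_iff abs_of_nonneg)
      then show ?thesis using simple_path_eq[OF \<tau>(1) i, of \<xi> w] by (auto intro!: mult_right_mono ennreal_leI)
    qed simp
  qed
  then have "path_dist2 H (simple_path m \<tau> \<xi>) t w \<le> (\<integral>\<^sup>+ s. ennreal (e\<^sup>2) * indicator {0..t} s \<partial>lborel)"
    unfolding path_dist2_def by (rule nn_integral_mono_AE)
  also have "\<dots> = ennreal (e\<^sup>2 * t)" using t by (simp add: nn_integral_cmult_indicator ennreal_mult)
  finally show ?thesis .
qed

text \<open>With \<open>e > 0\<close> this estimates a Riemann sum error; with \<open>e = 0\<close>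
  it evaluates the integral of a step function exactly, whatever its values at the partition points.
  Pieces of length zero are allowed, as stopped grids have them.\<close>

lemma set_integral_step_approx:
  fixes \<tau> :: "nat \<Rightarrow> real" and x :: "real \<Rightarrow> real"
  assumes int: "set_integrable lborel {\<tau> 0..\<tau> n} x" and \<tau>: "\<And>i. i < n \<Longrightarrow> \<tau> i \<le> \<tau> (Suc i)"
    and close: "\<And>i s. i < n \<Longrightarrow> \<tau> i < s \<Longrightarrow> s < \<tau> (Suc i) \<Longrightarrow> \<bar>x s - c i\<bar> \<le> e"
  shows "\<bar>(LINT s:{\<tau> 0..\<tau> n}|lborel. x s) - (\<Sum>i<n. c i * (\<tau> (Suc i) - \<tau> i))\<bar> \<le> e * (\<tau> n - \<tau> 0)"
  using assms
proof (induction n)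
  case 0
  have "(LINT s:{\<tau> 0..\<tau> 0}|lborel. x s) = 0"
    unfolding set_lebesgue_integral_def
    by (rule integral_eq_zero_AE, rule AE_mp[OF AE_lborel_singleton[of "\<tau> 0"]])
      (auto simp: indicator_def)
  then show ?case by simp
next
  case (Suc n)
  have "\<tau> 0 \<le> \<tau> k" if "k \<le> n" for k
    using that by (induction k) (use Suc.prems(2) in \<open>auto intro: order_trans\<close>)
  then have le: "\<tau> n \<le> \<tau> (Suc n)" "\<tau> 0 \<le> \<tau> n"
    using Suc.prems(2)[of n] by auto
  let ?A = "{\<tau> 0..\<tau> n}" and ?B = "{\<tau> n<..\<tau> (Suc n)}"
  have un: "{\<tau> 0..\<tau> (Suc n)} = ?A \<union> ?B" using le by auto
  have iA: "set_integrable lborel ?A x" and iB: "set_integrable lborel ?B x"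
    by (rule set_integrable_subset[OF Suc.prems(1)], use le in auto)+
  have "(LINT s:{\<tau> 0..\<tau> (Suc n)}|lborel. x s) = (LINT s:?A|lborel. x s) + (LINT s:?B|lborel. x s)"
    unfolding un by (rule set_integral_Un[OF _ iA iB]) auto
  moreover have "\<bar>(LINT s:?B|lborel. x s) - c n * (\<tau> (Suc n) - \<tau> n)\<bar> \<le> e * (\<tau> (Suc n) - \<tau> n)"
  proof -
    have iBc: "set_integrable lborel ?B (\<lambda>s. k)" for k :: real
      using le by (simp add: set_integrable_def integrable_real_indicator)
    have vc: "(LINT s:?B|lborel. k) = k * (\<tau> (Suc n) - \<tau> n)" for k :: real
      using le by (simp add: set_lebesgue_integral_def)
    have "(LINT s:?B|lborel. x s) - c n * (\<tau> (Suc n) - \<tau> n) = (LINT s:?B|lborel. x s - c n)"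
      using set_integral_diff(2)[OF iB iBc[of "c n"]] vc by simp
    also have "\<bar>\<dots>\<bar> \<le> (LINT s:?B|lborel. \<bar>x s - c n\<bar>)"
      using set_integral_norm_bound[OF set_integral_diff(1)[OF iB iBc[of "c n"]]] by simp
    also have "\<dots> \<le> (LINT s:?B|lborel. e)"
      unfolding set_lebesgue_integral_def
    proof (rule integral_mono_AE)
      show "integrable lborel (\<lambda>s. indicat_real ?B s *\<^sub>R \<bar>x s - c n\<bar>)"
        using set_integrable_abs[OF set_integral_diff(1)[OF iB iBc[of "c n"]]]
        by (simp add: set_integrable_def)
      show "integrable lborel (\<lambda>s. indicat_real ?B s *\<^sub>R e)"
        using iBc[of e] by (simp add: set_integrable_def)
      show "AE s in lborel. indicat_real ?B s *\<^sub>R \<bar>x s - c n\<bar> \<le> indicat_real ?B s *\<^sub>R e"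
        by (rule AE_mp[OF AE_lborel_singleton[of "\<tau> (Suc n)"]])
          (use Suc.prems(3)[of n] in \<open>auto simp: indicator_def\<close>)
    qed
    finally show ?thesis using vc by simp
  qed
  moreover have "\<bar>(LINT s:?A|lborel. x s) - (\<Sum>i<n. c i * (\<tau> (Suc i) - \<tau> i))\<bar> \<le> e * (\<tau> n - \<tau> 0)"
    using Suc iA by auto
  ultimately show ?case by (simp add: algebra_simps)
qed

section \<open>Uniform grids and Riemann sums for Ito differentials\<close>

definition uniform_grid :: "real \<Rightarrow> nat \<Rightarrow> nat \<Rightarrow> real" where
  "uniform_grid t N i = real i * t / real N"

lemma uniform_grid_simps [simp]:
  "uniform_grid t N 0 = 0" "0 < N \<Longrightarrow> uniform_grid t N N = t"
  "uniform_grid t N (Suc i) - uniform_grid t N i = t / real N"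
  by (auto simp: uniform_grid_def add_divide_distrib ring_distribs)

lemma uniform_grid_strict_mono: "0 < t \<Longrightarrow> 0 < N \<Longrightarrow> strict_mono (uniform_grid t N)"
  by (rule strict_monoI) (simp add: uniform_grid_def divide_strict_right_mono)

lemma uniform_grid_nonneg [simp]: "0 \<le> t \<Longrightarrow> 0 \<le> uniform_grid t N i"
  by (simp add: uniform_grid_def)

lemma uniform_grid_le: "0 < t \<Longrightarrow> i \<le> N \<Longrightarrow> 0 < N \<Longrightarrow> uniform_grid t N i \<le> t"
  by (simp add: uniform_grid_def field_simps mult_left_mono)

lemma uniform_grid_close:
  fixes x :: "real \<Rightarrow> real"
  assumes x: "continuous_on {0..} x" and t: "0 < t" and e: "0 < e"
  shows "eventually (\<lambda>N. \<forall>i<N. \<forall>s. uniform_grid t N i \<le> s \<longrightarrow> s \<le> uniform_grid t N (Suc i) \<longrightarrow>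
    \<bar>x s - x (uniform_grid t N i)\<bar> \<le> e) sequentially"
proof -
  have "uniformly_continuous_on {0..t} x"
    by (rule compact_uniformly_continuous) (auto intro: continuous_on_subset[OF x])
  then obtain d where d: "0 < d" "\<And>u v. u \<in> {0..t} \<Longrightarrow> v \<in> {0..t} \<Longrightarrow> dist u v < d \<Longrightarrow> dist (x u) (x v) < e"
    unfolding uniformly_continuous_on_def using e by metis
  have "(\<lambda>N. t / real N) \<longlonglongrightarrow> 0" by (rule lim_const_over_n)
  then have "eventually (\<lambda>N. t / real N < d) sequentially" using d(1) by (rule order_tendstoD)
  then show ?thesis
  proof eventually_elim
    case (elim N)
    show ?case
    proof (intro allI impI)
      fix i s assume i: "i < N" and s: "uniform_grid t N i \<le> s" "s \<le> uniform_grid t N (Suc i)"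
      have "0 \<le> uniform_grid t N i" "uniform_grid t N (Suc i) \<le> t" "uniform_grid t N i \<le> t"
        using i t by (auto intro!: uniform_grid_le)
      moreover have "s - uniform_grid t N i < d" using s uniform_grid_simps(3)[of t N i] elim by linarith
      ultimately have "dist (x s) (x (uniform_grid t N i)) < e"
        using s by (intro d(2)) (auto simp: dist_real_def)
      then show "\<bar>x s - x (uniform_grid t N i)\<bar> \<le> e" by (simp add: dist_real_def)
    qed
  qed
qed

text \<open>A discrete Ito formula for the squared norm. The coefficients \<open>x\<close>,
  \<open>y\<close> stand for the solution at the left end points, \<open>u\<close>, \<open>v\<close>
  for the sums formed with them. The drift contributes \<open>- (x^2 + y^2) * h\<close>, which turns
  the square of \<open>D\<close> into its centred version; all other terms contain
  \<open>u - x\<close>, \<open>v - y\<close> or a factor \<open>h^2\<close>.\<close>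

lemma rotation_step_identity:
  fixes x y u v D :: "nat \<Rightarrow> real" and h :: real
  assumes u: "\<And>j. u (Suc j) = u j + (- (1/2) * x j * h + - y j * D j)"
    and v: "\<And>j. v (Suc j) = v j + (- (1/2) * y j * h + x j * D j)"
  shows "(u n)\<^sup>2 + (v n)\<^sup>2 = (u 0)\<^sup>2 + (v 0)\<^sup>2 + (\<Sum>j<n. ((x j)\<^sup>2 + (y j)\<^sup>2) * ((D j)\<^sup>2 - h))
    + (\<Sum>j<n. 2 * ((v j - y j) * x j - (u j - x j) * y j) * D j)
    + (\<Sum>j<n. ((x j)\<^sup>2 + (y j)\<^sup>2) * h\<^sup>2 / 4 - ((u j - x j) * x j + (v j - y j) * y j) * h)"
proof (induction n)
  case (Suc n)
  have "(u (Suc n))\<^sup>2 + (v (Suc n))\<^sup>2 = (u n)\<^sup>2 + (v n)\<^sup>2 + ((x n)\<^sup>2 + (y n)\<^sup>2) * ((D n)\<^sup>2 - h)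
    + 2 * ((v n - y n) * x n - (u n - x n) * y n) * D n
    + (((x n)\<^sup>2 + (y n)\<^sup>2) * h\<^sup>2 / 4 - ((u n - x n) * x n + (v n - y n) * y n) * h)"
    unfolding u v by (simp add: power2_eq_square algebra_simps)
  then show ?case using Suc by simp
qed simp

context brownian_motion_space
begin

text \<open>The coefficients are read off the given processes, not off the sum itself. For the exact
  solution this is a Riemann-Ito sum that approximates it; for the Euler scheme on its own grid the
  sum reproduces the scheme.\<close>

definition euler_sum ::
  "(real \<Rightarrow> 'a \<Rightarrow> real) \<Rightarrow> (real \<Rightarrow> 'a \<Rightarrow> real) \<Rightarrow> (real \<Rightarrow> 'a \<Rightarrow> real) \<Rightarrow> (nat \<Rightarrow> real) \<Rightarrow> nat \<Rightarrow> 'a \<Rightarrow> real" where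
  "euler_sum X a b \<sigma> k w = X 0 w +
    (\<Sum>j<k. a (\<sigma> j) w * (\<sigma> (Suc j) - \<sigma> j) + b (\<sigma> j) w * dW \<sigma> j w)"

lemma euler_sum_measurable:
  assumes "adapted_process F X" "adapted_process F a" "adapted_process F b"
    and \<sigma>: "strict_mono \<sigma>" "0 \<le> \<sigma> 0"
  shows "euler_sum X a b \<sigma> k \<in> borel_measurable (F (\<sigma> k))"
proof -
  have \<sigma>_nn: "0 \<le> \<sigma> j" for j by (rule strict_mono_grid[OF \<sigma>])
  have lift: "Y (\<sigma> j) \<in> borel_measurable (F (\<sigma> k))" if "adapted_process F Y" "j \<le> k" for Y j
    by (rule measurable_F_mono[of _ "\<sigma> j"])
      (use that \<sigma>_nn \<sigma> in \<open>auto simp: adapted_process_def strict_mono_less_eq\<close>)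
  have W: "adapted_process F W" using W_measurable by (simp add: adapted_process_def)
  have X0: "X 0 \<in> borel_measurable (F (\<sigma> k))"
    by (rule measurable_F_mono[of _ 0]) (use assms \<sigma>_nn in \<open>auto simp: adapted_process_def\<close>)
  show ?thesis
    unfolding euler_sum_def[abs_def]
    by (intro borel_arith_measurable lift assms W X0) auto
qed

text \<open>The drift error is small path by path, by uniform continuity of \<open>a\<close> on
  \<open>[0,t]\<close>. The stochastic error is handled by the maximal inequality, with
  \<open>b\<close> frozen at left end points as step process and its distance to \<open>b\<close>
  again small by uniform continuity.\<close>

lemma ito_differential_max_error_tendsto_0:
  assumes X: "has_ito_differential M F W X a b"
    and a: "adapted_process F a" "continuous_process M a" and b: "continuous_process M b"
    and t: "0 < t" and \<epsilon>: "0 < \<epsilon>"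
  shows "(\<lambda>n. \<P>(w in M. \<exists>i\<le>Suc n. \<bar>X (uniform_grid t (Suc n) i) w
    - euler_sum X a b (uniform_grid t (Suc n)) i w\<bar> > \<epsilon>)) \<longlonglongrightarrow> 0"
proof -
  let ?g = "\<lambda>n. uniform_grid t (Suc n)"
  obtain J where J: "\<And>s. 0 \<le> s \<Longrightarrow> has_ito_integral M F W b s (J s)"
    "\<And>s. 0 \<le> s \<Longrightarrow> AE w in M. set_integrable lborel {0..s} (\<lambda>s. a s w) \<and>
      X s w = X 0 w + (LINT s:{0..s}|lborel. a s w) + J s w"
    and XA: "adapted_process F X"
    using X unfolding has_ito_differential_def by blast
  have bA: "adapted_process F b" and bj: "jointly_measurable M b" using J(1)[of 0] by (auto simp: has_ito_integral_def)
  have g: "strict_mono (?g n)" for n using t by (intro uniform_grid_strict_mono) auto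
  have g0: "0 \<le> ?g n i" for n i using t by simp
  have gt: "?g n i \<le> t" if "i \<le> Suc n" for n i using t that by (intro uniform_grid_le) auto
  have step: "step_process F (Suc n) (?g n) (\<lambda>i. b (?g n i))" for n
    using g g0 bA unfolding step_process_def adapted_process_def by (auto simp: strict_mono_less)
  define B where "B n = simple_integral W (Suc n) (?g n) (\<lambda>i. b (?g n i))" for n
  define pd where "pd n = path_dist2 b (simple_path (Suc n) (?g n) (\<lambda>i. b (?g n i))) t" for n
  have [measurable]: "pd n \<in> borel_measurable M" for n
    unfolding pd_def by (rule path_dist2_measurable[OF bj simple_path_jointly_measurable[OF step]])
  have XM[measurable]: "X s \<in> borel_measurable M" "a s \<in> borel_measurable M" "J s \<in> borel_measurable M"
    if "s \<in> {0..}" for s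
    using XA a J(1)[of s] that measurable_F_M[of "X s" s] measurable_F_M[of "a s" s]
    by (auto simp: adapted_process_def has_ito_integral_def)
  \<comment> \<open>After removal of \<open>J\<close>, what remains is the drift integral minus its
    Riemann sum.\<close>
  define R where "R n i w = X (?g n i) w - X 0 w - J (?g n i) w - (\<Sum>j<i. a (?g n j) w * (?g n (Suc j) - ?g n j))"
    for n i w
  have R_meas[measurable]: "R n i \<in> borel_measurable M" for n i
    unfolding R_def[abs_def]
    by (intro borel_arith_measurable XM)
      (use g0 in auto)
  define ER where "ER n = {w \<in> space M. \<exists>i\<le>Suc n. \<bar>R n i w\<bar> > \<epsilon> / 2}" for n
  have ER_meas[measurable]: "ER n \<in> events" for n
    unfolding ER_def by measurable
  have ER: "(\<lambda>n. prob (ER n)) \<longlonglongrightarrow> 0"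
  proof (rule prob_tendsto_0_if_AE_eventually_notin)
    have all: "AE w in M. \<forall>n i. set_integrable lborel {0..?g n i} (\<lambda>s. a s w) \<and>
      X (?g n i) w = X 0 w + (LINT s:{0..?g n i}|lborel. a s w) + J (?g n i) w"
      unfolding AE_all_countable using J(2)[OF g0] by blast
    have "AE w in M. continuous_on {0..} (\<lambda>s. a s w)" using a by (simp add: continuous_process_def)
    with all show "AE w in M. eventually (\<lambda>n. w \<notin> ER n) sequentially"
    proof eventually_elim
      case (elim w)
      have "0 < \<epsilon> / (2 * t)" using \<epsilon> t by simp
      from uniform_grid_close[OF elim(2) t this]
      have "eventually (\<lambda>n. \<forall>i<Suc n. \<forall>s. ?g n i \<le> s \<longrightarrow> s \<le> ?g n (Suc i) \<longrightarrow>
        \<bar>a s w - a (?g n i) w\<bar> \<le> \<epsilon> / (2 * t)) sequentially"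
        by (rule filterlim_Suc[THEN filterlim_iff[THEN iffD1], rule_format])
      then show ?case
      proof eventually_elim
        case (elim n)
        note * = \<open>\<forall>n i. _ n i\<close>[rule_format, of n]
        have "\<bar>R n i w\<bar> \<le> \<epsilon> / 2" if i: "i \<le> Suc n" for i
        proof -
          have "R n i w = (LINT s:{?g n 0..?g n i}|lborel. a s w) - (\<Sum>j<i. a (?g n j) w * (?g n (Suc j) - ?g n j))"
            using *[of i] by (simp add: R_def)
          also have "\<bar>\<dots>\<bar> \<le> \<epsilon> / (2 * t) * (?g n i - ?g n 0)"
            by (rule set_integral_step_approx) (use *[of i] elim i g[of n] in \<open>auto simp: strict_mono_less_eq\<close>)
          also have "\<dots> \<le> \<epsilon> / (2 * t) * t"
            using gt[OF i] t \<epsilon> by (intro mult_left_mono) auto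
          finally show ?thesis using t by simp
        qed
        then show ?case by (auto simp: ER_def not_less)
      qed
    qed
  qed simp
  have pd: "(\<lambda>n. \<P>(w in M. pd n w > ennreal \<eta>)) \<longlonglongrightarrow> 0" if \<eta>: "0 < \<eta>" for \<eta>
  proof (rule prob_tendsto_0_if_AE_eventually_notin)
    have "AE w in M. continuous_on {0..} (\<lambda>s. b s w)" using b by (simp add: continuous_process_def)
    then show "AE w in M. eventually (\<lambda>n. w \<notin> {w \<in> space M. pd n w > ennreal \<eta>}) sequentially"
    proof eventually_elim
      case (elim w)
      have e: "0 < sqrt (\<eta> / t)" using \<eta> t by simp
      from uniform_grid_close[OF elim t e]
      have "eventually (\<lambda>n. \<forall>i<Suc n. \<forall>s. ?g n i \<le> s \<longrightarrow> s \<le> ?g n (Suc i) \<longrightarrow>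
        \<bar>b s w - b (?g n i) w\<bar> \<le> sqrt (\<eta> / t)) sequentially"
        by (rule filterlim_Suc[THEN filterlim_iff[THEN iffD1], rule_format])
      then show ?case
      proof eventually_elim
        case (elim n)
        have "pd n w \<le> ennreal ((sqrt (\<eta> / t))\<^sup>2 * t)"
          unfolding pd_def
          by (rule path_dist2_step_le[OF g]) (use elim t e in \<open>auto intro: less_imp_le\<close>)
        then show ?case using t \<eta> by (simp add: not_less)
      qed
    qed
  qed measurable
  have Bg: "B n (?g n i) w = (\<Sum>j<i. b (?g n j) w * (W (?g n (Suc j)) w - W (?g n j) w))"
    if "i \<le> Suc n" for n i w
    unfolding B_def
  proof (subst simple_integral_refine[OF g])
    show "(\<Sum>j<i. simple_path (Suc n) (?g n) (\<lambda>i. b (?g n i)) (?g n (Suc j)) w *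
        (W (?g n (Suc j)) w - W (?g n j) w)) =
      (\<Sum>j<i. b (?g n j) w * (W (?g n (Suc j)) w - W (?g n j) w))"
    proof (intro sum.cong refl arg_cong2[where f="(*)"])
      fix j assume "j \<in> {..<i}"
      then have j: "j < Suc n" "?g n j < ?g n (Suc j)" using that g[of n] by (auto simp: strict_mono_less)
      show "simple_path (Suc n) (?g n) (\<lambda>i. b (?g n i)) (?g n (Suc j)) w = b (?g n j) w"
        by (rule simple_path_eq[OF g j order_refl])
    qed
  qed (use g[of n] in \<open>auto simp: strict_mono_less\<close>)
  let ?E = "\<lambda>n. {w \<in> space M. \<exists>i\<le>Suc n. \<bar>X (?g n i) w - euler_sum X a b (?g n) i w\<bar> > \<epsilon>}"
  let ?Q = "\<lambda>n. ?g n ` {..Suc n}"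
  let ?E' = "\<lambda>n. {w \<in> space M. \<exists>s\<in>?Q n. \<bar>J s w - B n s w\<bar> > \<epsilon> / 2}"
  \<comment> \<open>The level \<open>\<epsilon>\<close> is shared equally between drift and
    stochastic error, and \<open>16 / (\<epsilon> / 2)^2 = 64 / \<epsilon>^2\<close>.\<close>
  have "prob (?E n) \<le> (prob (ER n) + \<P>(w in M. pd n w > ennreal \<eta>)) + 64 / \<epsilon>\<^sup>2 * \<eta>"
    if \<eta>: "0 < \<eta>" for n \<eta>
  proof -
    have [measurable]: "B n s \<in> borel_measurable M" if "s \<in> {0..}" for s
      unfolding B_def using simple_integral_measurable[OF step] that by auto
    have "?E n \<subseteq> ER n \<union> ?E' n"
    proof safe
      fix w i assume *: "w \<in> space M" "i \<le> Suc n" "\<epsilon> < \<bar>X (?g n i) w - euler_sum X a b (?g n) i w\<bar>"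
        and n: "w \<notin> ER n"
      have "\<bar>R n i w\<bar> \<le> \<epsilon> / 2" using n * by (auto simp: ER_def not_less)
      moreover have "X (?g n i) w - euler_sum X a b (?g n) i w = R n i w + (J (?g n i) w - B n (?g n i) w)"
        unfolding Bg[OF *(2)] R_def euler_sum_def by (simp add: sum.distrib)
      ultimately have "\<bar>J (?g n i) w - B n (?g n i) w\<bar> > \<epsilon> / 2" using *(3) by linarith
      then show "\<exists>s\<in>?Q n. \<epsilon> / 2 < \<bar>J s w - B n s w\<bar>" using *(2) by blast
    qed
    have E'_meas: "?E' n \<in> events"
    proof -
      have "?E' n = (\<Union>s\<in>?Q n. {w \<in> space M. \<bar>J s w - B n s w\<bar> > \<epsilon> / 2})" by blast
      also have "\<dots> \<in> events"
      proof (rule sets.finite_UN)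
        fix s assume "s \<in> ?Q n"
        then have "s \<in> {0..}" using g0 by auto
        then show "{w \<in> space M. \<bar>J s w - B n s w\<bar> > \<epsilon> / 2} \<in> events" by measurable
      qed simp
      finally show ?thesis .
    qed
    have "prob (?E n) \<le> prob (ER n \<union> ?E' n)"
      by (rule finite_measure_mono[OF \<open>?E n \<subseteq> _\<close>]) (intro sets.Un ER_meas E'_meas)
    also have "\<dots> \<le> prob (ER n) + prob (?E' n)" by (rule measure_Un_le[OF ER_meas E'_meas])
    also have "prob (?E' n) \<le> \<P>(w in M. pd n w > ennreal \<eta>) + 16 * \<eta> / (\<epsilon> / 2)\<^sup>2"
      unfolding B_def pd_def
      by (rule has_ito_integral_maximal_inequality[OF J(1) step]) (use t \<epsilon> \<eta> g0 gt in auto)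
    finally show ?thesis by (simp add: power_divide)
  qed
  then show ?thesis
    by (rule tendsto_0_tradeoff[where q="\<lambda>\<eta> n. prob (ER n) + \<P>(w in M. pd n w > ennreal \<eta>)", rotated])
      (use \<epsilon> tendsto_add[OF ER pd] in auto)
qed

text \<open>The discrete identity is passed to the limit along a subsequence: the sums
  \<open>U\<close>, \<open>V\<close> at the last grid point tend to \<open>X t\<close>,
  \<open>Y t\<close>, while the stochastic sums \<open>SD\<close>, \<open>SC\<close> and the
  remainder \<open>rest\<close> tend to 0. All limits hold almost surely because convergence in
  probability yields a subsequence.\<close>

lemma circle_sde_norm_invariant:
  assumes X: "has_ito_differential M F W X (\<lambda>t w. - (1/2) * X t w) (\<lambda>t w. - Y t w)"
    and Y: "has_ito_differential M F W Y (\<lambda>t w. - (1/2) * Y t w) (\<lambda>t w. X t w)"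
    and t: "0 < t"
  shows "AE w in M. (X t w)\<^sup>2 + (Y t w)\<^sup>2 = (X 0 w)\<^sup>2 + (Y 0 w)\<^sup>2"
proof -
  let ?aX = "\<lambda>t w. - (1/2) * X t w" and ?bX = "\<lambda>t w. - Y t w" and ?aY = "\<lambda>t w. - (1/2) * Y t w"
  have XA: "adapted_process F X" and YA: "adapted_process F Y"
    and XC: "continuous_process M X" and YC: "continuous_process M Y"
    using X Y by (auto simp: has_ito_differential_def)
  have A: "adapted_process F ?aX" "adapted_process F ?bX" "adapted_process F ?aY"
    using XA YA by (auto simp: adapted_process_def)
  have C1: "continuous_process M (\<lambda>t w. k * x t w)" if "continuous_process M x" for x k
    using that unfolding continuous_process_def by eventually_elim (intro continuous_intros)
  have C: "continuous_process M ?aX" "continuous_process M ?bX" "continuous_process M ?aY"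
    using C1[OF XC, of "- (1/2)"] C1[OF YC, of "- 1"] C1[OF YC, of "- (1/2)"] by simp_all
  define g where "g n = uniform_grid t (Suc n)" for n
  define h where "h n = t / real (Suc n)" for n
  have g: "strict_mono (g n)" for n using t unfolding g_def by (intro uniform_grid_strict_mono) auto
  have g0: "0 \<le> g n i" "g n 0 = 0" "g n (Suc n) = t" for n i using t by (auto simp: g_def)
  have gt: "g n i \<le> t" if "i \<le> Suc n" for n i using t that by (auto simp: g_def intro: uniform_grid_le)
  have gh: "g n (Suc i) - g n i = h n" for n i unfolding g_def h_def by (rule uniform_grid_simps)
  have h: "0 < h n" "h \<longlonglongrightarrow> 0" for n
    using t LIMSEQ_Suc[OF lim_const_over_n[of t]] by (auto simp: h_def[abs_def])
  have nh: "real (Suc n) * h n = t" for n by (simp add: h_def)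
  define U where "U n i = euler_sum X ?aX ?bX (g n) i" for n i
  define V where "V n i = euler_sum Y ?aY X (g n) i" for n i
  define D where "D n j w = W (g n (Suc j)) w - W (g n j) w" for n j w
  have XF: "X (g n j) \<in> borel_measurable (F (g n j))" and YF: "Y (g n j) \<in> borel_measurable (F (g n j))"
    for n j using XA YA g0 by (auto simp: adapted_process_def)
  have UF: "U n j \<in> borel_measurable (F (g n j))" and VF: "V n j \<in> borel_measurable (F (g n j))" for n j
    unfolding U_def V_def by (intro euler_sum_measurable XA YA A g; simp add: g0)+
  have DF: "D n j \<in> borel_measurable (F (g n (Suc j)))" for n j
    unfolding D_def[abs_def] using g by (intro increment_measurable) (auto simp: g0 strict_mono_less_eq)
  note [measurable] = measurable_F_M[OF XF] measurable_F_M[OF YF] measurable_F_M[OF UF]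
    measurable_F_M[OF VF] measurable_F_M[OF DF]
  let ?u = "\<lambda>n j w. U n j w - X (g n j) w" and ?v = "\<lambda>n j w. V n j w - Y (g n j) w"
  let ?near = "\<lambda>n w e. \<forall>i\<le>Suc n. \<bar>?u n i w\<bar> \<le> e \<and> \<bar>?v n i w\<bar> \<le> e"
  let ?EX = "\<lambda>m n. {w \<in> space M. \<exists>i\<le>Suc n. \<bar>X (g n i) w - U n i w\<bar> > inverse (real (Suc m))}"
  let ?EY = "\<lambda>m n. {w \<in> space M. \<exists>i\<le>Suc n. \<bar>Y (g n i) w - V n i w\<bar> > inverse (real (Suc m))}"
  define E where "E m n = ?EX m n \<union> ?EY m n" for m n
  have E: "E m n \<in> events" for m n unfolding E_def by measurable
  have E_lim: "(\<lambda>n. prob (E m n)) \<longlonglongrightarrow> 0" for m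
  proof (rule tendsto_sandwich[OF _ _ tendsto_const])
    have "0 < inverse (real (Suc m))" by simp
    from tendsto_add[OF ito_differential_max_error_tendsto_0[OF X A(1) C(1) C(2) t this]
        ito_differential_max_error_tendsto_0[OF Y A(3) C(3) XC t this]]
    show "(\<lambda>n. prob (?EX m n) + prob (?EY m n)) \<longlonglongrightarrow> 0"
      unfolding g_def U_def V_def by simp
    show "eventually (\<lambda>n. prob (E m n) \<le> prob (?EX m n) + prob (?EY m n)) sequentially"
      unfolding E_def by (intro always_eventually allI measure_Un_le) measurable
  qed auto
  \<comment> \<open>The tolerances \<open>inverse (real (Suc m))\<close> range over a null sequence,
    so along \<open>r\<close> the maximal errors tend to 0 for almost every path.\<close>
  obtain r where r: "strict_mono r" "AE w in M. \<forall>m. eventually (\<lambda>k. w \<notin> E m (r k)) sequentially"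
    by (rule AE_subsequence_eventually_notin[OF E E_lim])
  \<comment> \<open>The bound \<open>B\<close> depends on the path. This suffices because the
    maximal inequalities use only the probability that a quadratic variation is large.\<close>
  have bounded: "AE w in M. \<exists>B\<ge>1. \<forall>n. \<forall>i\<le>Suc n. \<bar>X (g n i) w\<bar> \<le> B \<and> \<bar>Y (g n i) w\<bar> \<le> B"
    using XC YC unfolding continuous_process_def
  proof eventually_elim
    case (elim w)
    have bd: "\<exists>B. \<forall>s\<in>{0..t}. \<bar>x s\<bar> \<le> B" if "continuous_on {0..} x" for x :: "real \<Rightarrow> real"
    proof -
      have "compact (x ` {0..t})"
        by (rule compact_continuous_image) (auto intro: continuous_on_subset[OF that])
      from compact_imp_bounded[OF this] show ?thesis by (auto simp: bounded_iff)
    qed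
    from bd[OF elim(1)] bd[OF elim(2)] obtain B1 B2 where
      "\<And>s. s \<in> {0..t} \<Longrightarrow> \<bar>X s w\<bar> \<le> B1" "\<And>s. s \<in> {0..t} \<Longrightarrow> \<bar>Y s w\<bar> \<le> B2" by blast
    then show ?case
      using g0 gt by (intro exI[of _ "max 1 (max B1 B2)"]) (auto intro: max.coboundedI2 simp: le_max_iff_disj)
  qed
  have close: "AE w in M. \<forall>e>0. eventually (\<lambda>k. ?near (r k) w e) sequentially"
    using r(2) AE_space
  proof eventually_elim
    case (elim w)
    show ?case
    proof (intro allI impI)
      fix e :: real assume "0 < e"
      then obtain m where m: "inverse (real (Suc m)) < e" using reals_Archimedean by blast
      from elim(1)[rule_format, of m]
      show "eventually (\<lambda>k. ?near (r k) w e) sequentially"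
      proof eventually_elim
        case (elim k)
        show ?case
        proof (intro allI impI)
          fix i assume "i \<le> Suc (r k)"
          then have "\<bar>X (g (r k) i) w - U (r k) i w\<bar> \<le> inverse (real (Suc m))"
            "\<bar>Y (g (r k) i) w - V (r k) i w\<bar> \<le> inverse (real (Suc m))"
            using elim \<open>w \<in> space M\<close> by (auto simp: E_def not_less)
          then show "\<bar>?u (r k) i w\<bar> \<le> e \<and> \<bar>?v (r k) i w\<bar> \<le> e"
            using m by linarith
        qed
      qed
    qed
  qed
  \<comment> \<open>The coefficient of the increment in \<open>rotation_step_identity\<close>; it is
    linear in the errors \<open>U - X\<close> and \<open>V - Y\<close>.\<close>
  define c where "c n j w = 2 * (?v n j w * X (g n j) w - ?u n j w * Y (g n j) w)" for n j w
  define d where "d n j w = (X (g n j) w)\<^sup>2 + (Y (g n j) w)\<^sup>2" for n j w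
  have cF: "c n j \<in> borel_measurable (F (g n j))" and dF: "d n j \<in> borel_measurable (F (g n j))" for n j
    unfolding c_def[abs_def] d_def[abs_def] using UF VF XF YF
    by (intro borel_arith_measurable; simp)+
  note [measurable] = measurable_F_M[OF cF] measurable_F_M[OF dF]
  define SC where "SC n w = (\<Sum>j<Suc n. c n j w * D n j w)" for n w
  define SD where "SD n w = (\<Sum>j<Suc n. d n j w * ((D n j w)\<^sup>2 - h n))" for n w
  have [measurable]: "SC n \<in> borel_measurable M" "SD n \<in> borel_measurable M" for n
    unfolding SC_def[abs_def] SD_def[abs_def] by measurable
  have sum_le: "(\<Sum>j<Suc n. f j * h n) \<le> K * t" if "\<And>j. j \<le> n \<Longrightarrow> f j \<le> K" for f K n
  proof -
    have "(\<Sum>j<Suc n. f j * h n) \<le> (\<Sum>j<Suc n. K * h n)"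
      by (intro sum_mono mult_right_mono) (use that h(1)[of n] in auto)
    also have "\<dots> = K * t" using nh[of n] by (simp only: sum_constant card_lessThan) (simp add: algebra_simps)
    finally show ?thesis .
  qed
  have c_small: "\<bar>c n j w\<bar> \<le> 4 * e * B"
    if "\<bar>X (g n j) w\<bar> \<le> B" "\<bar>Y (g n j) w\<bar> \<le> B"
      "\<bar>?u n j w\<bar> \<le> e" "\<bar>?v n j w\<bar> \<le> e" for n j w e B
  proof -
    have "\<bar>?v n j w * X (g n j) w\<bar> \<le> e * B" "\<bar>?u n j w * Y (g n j) w\<bar> \<le> e * B"
      unfolding abs_mult using that by (auto intro!: mult_mono)
    then have "\<bar>?v n j w * X (g n j) w - ?u n j w * Y (g n j) w\<bar> \<le> 2 * (e * B)"
      by linarith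
    moreover have "4 * e * B = \<bar>2\<bar> * (2 * (e * B))" by simp
    ultimately show ?thesis unfolding c_def abs_mult[of 2] by (metis mult_left_mono abs_ge_zero)
  qed
  let ?QC = "\<lambda>n w. \<Sum>j<Suc n. (c n j w)\<^sup>2 * h n"
  let ?QD = "\<lambda>n w. \<Sum>j<Suc n. (d n j w)\<^sup>2 * (2 * (h n)\<^sup>2)"
  \<comment> \<open>The limit is taken along \<open>r\<close>, since the pathwise smallness of
    \<open>c\<close> is available only there.\<close>
  have SC_lim: "(\<lambda>k. \<P>(w in M. \<bar>SC (r k) w\<bar> > \<epsilon>)) \<longlonglongrightarrow> 0" if \<epsilon>: "0 < \<epsilon>" for \<epsilon>
  proof (rule tendsto_0_tradeoff[where c = "1 / \<epsilon>\<^sup>2"])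
    show "\<P>(w in M. \<bar>SC (r k) w\<bar> > \<epsilon>) \<le>
      \<P>(w in M. ?QC (r k) w > \<eta>) + 1 / \<epsilon>\<^sup>2 * \<eta>"
      if \<eta>: "0 < \<eta>" for \<eta> k
    proof -
      have "\<P>(w in M. \<bar>SC (r k) w\<bar> > \<epsilon>) \<le>
        \<P>(w in M. \<exists>i\<le>Suc (r k). \<bar>\<Sum>j<i. c (r k) j w * D (r k) j w\<bar> > \<epsilon>)"
        by (rule finite_measure_mono) (auto simp only: SC_def, measurable)
      also have "\<dots> \<le> \<P>(w in M. ?QC (r k) w > \<eta>) + \<eta> / \<epsilon>\<^sup>2"
        using ito_sum_maximal_inequality[OF g _ cF \<epsilon> \<eta>, of "r k" "Suc (r k)"] by (simp only: gh D_def g0)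
      finally show ?thesis by simp
    qed
    show "(\<lambda>k. \<P>(w in M. ?QC (r k) w > \<eta>)) \<longlonglongrightarrow> 0"
      if \<eta>: "0 < \<eta>" for \<eta>
    proof (rule prob_tendsto_0_if_AE_eventually_notin)
      show "AE w in M. eventually (\<lambda>k. w \<notin> {w \<in> space M. ?QC (r k) w > \<eta>}) sequentially"
        using bounded close
      proof eventually_elim
        case (elim w)
        then obtain B where B: "1 \<le> B" "\<And>n i. i \<le> Suc n \<Longrightarrow> \<bar>X (g n i) w\<bar> \<le> B \<and> \<bar>Y (g n i) w\<bar> \<le> B" by blast
        \<comment> \<open>Chosen so that \<open>c_small\<close> bounds \<open>c\<close> by
          \<open>sqrt (\<eta> / t)\<close>; the quadratic variation over \<open>[0,t]\<close> is
          then at most \<open>\<eta>\<close>.\<close>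
        define e where "e = sqrt (\<eta> / t) / (4 * B)"
        have e: "0 < e" "4 * e * B = sqrt (\<eta> / t)" using \<eta> t B by (auto simp: e_def)
        from elim(2)[rule_format, OF e(1)] show ?case
        proof eventually_elim
          case (elim k)
          have "?QC (r k) w \<le> (\<eta> / t) * t"
          proof (rule sum_le)
            fix j assume "j \<le> r k"
            then have "\<bar>c (r k) j w\<bar> \<le> sqrt (\<eta> / t)"
              unfolding e(2)[symmetric] using elim B(2) by (intro c_small) auto
            then show "(c (r k) j w)\<^sup>2 \<le> \<eta> / t"
              using \<eta> t by (metis abs_le_square_iff abs_of_nonneg real_sqrt_ge_zero real_sqrt_pow2 divide_nonneg_nonneg less_imp_le)
          qed
          then show ?case using t by (simp add: not_less)
        qed
      qed
    qed measurable
  qed (use \<epsilon> in auto)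
  \<comment> \<open>Here the coefficients are merely bounded along a path. Smallness comes from the
    variances \<open>2 (h n)^2\<close>, whose sum over the grid is
    \<open>2 * h n * t\<close>.\<close>
  have SD_lim: "(\<lambda>n. \<P>(w in M. \<bar>SD n w\<bar> > \<epsilon>)) \<longlonglongrightarrow> 0" if \<epsilon>: "0 < \<epsilon>" for \<epsilon>
  proof (rule tendsto_0_tradeoff[where c = "1 / \<epsilon>\<^sup>2"])
    show "\<P>(w in M. \<bar>SD n w\<bar> > \<epsilon>) \<le>
      \<P>(w in M. ?QD n w > \<eta>) + 1 / \<epsilon>\<^sup>2 * \<eta>"
      if \<eta>: "0 < \<eta>" for \<eta> n
    proof -
      have "\<P>(w in M. \<bar>SD n w\<bar> > \<epsilon>) \<le>
        \<P>(w in M. \<exists>i\<le>Suc n. \<bar>\<Sum>j<i. d n j w * ((D n j w)\<^sup>2 - h n)\<bar> > \<epsilon>)"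
        by (rule finite_measure_mono) (auto simp only: SD_def, measurable)
      also have "\<dots> \<le> \<P>(w in M. ?QD n w > \<eta>) + \<eta> / \<epsilon>\<^sup>2"
        using square_sum_maximal_inequality[OF g _ dF \<epsilon> \<eta>, of n "Suc n"] by (simp only: gh D_def g0)
      finally show ?thesis by simp
    qed
    show "(\<lambda>n. \<P>(w in M. ?QD n w > \<eta>)) \<longlonglongrightarrow> 0"
      if \<eta>: "0 < \<eta>" for \<eta>
    proof (rule prob_tendsto_0_if_AE_eventually_notin)
      show "AE w in M. eventually (\<lambda>n. w \<notin> {w \<in> space M. ?QD n w > \<eta>}) sequentially"
        using bounded
      proof eventually_elim
        case (elim w)
        then obtain B where B: "1 \<le> B" "\<And>n i. i \<le> Suc n \<Longrightarrow> \<bar>X (g n i) w\<bar> \<le> B \<and> \<bar>Y (g n i) w\<bar> \<le> B" by blast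
        have "(\<lambda>n. (2 * B\<^sup>2)\<^sup>2 * 2 * h n * t) \<longlonglongrightarrow> (2 * B\<^sup>2)\<^sup>2 * 2 * 0 * t"
          by (intro tendsto_intros h)
        then have "eventually (\<lambda>n. (2 * B\<^sup>2)\<^sup>2 * 2 * h n * t < \<eta>) sequentially"
          by (rule order_tendstoD(2)) (use \<eta> in simp)
        then show ?case
        proof eventually_elim
          case (elim n)
          have "(\<Sum>j<Suc n. ((d n j w)\<^sup>2 * (2 * h n)) * h n) \<le> ((2 * B\<^sup>2)\<^sup>2 * (2 * h n)) * t"
          proof (rule sum_le)
            fix j assume "j \<le> n"
            then have "\<bar>X (g n j) w\<bar> \<le> \<bar>B\<bar>" "\<bar>Y (g n j) w\<bar> \<le> \<bar>B\<bar>" using B(1) B(2)[of j n] by auto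
            then have "d n j w \<le> 2 * B\<^sup>2" unfolding d_def by (simp add: abs_le_square_iff)
            then have "(d n j w)\<^sup>2 \<le> (2 * B\<^sup>2)\<^sup>2" by (rule power_mono) (simp add: d_def)
            then show "(d n j w)\<^sup>2 * (2 * h n) \<le> (2 * B\<^sup>2)\<^sup>2 * (2 * h n)"
              using h(1)[of n] by (intro mult_right_mono) auto
          qed
          then show ?case using elim by (simp add: not_less power2_eq_square mult.assoc del: sum.lessThan_Suc)
        qed
      qed
    qed measurable
  qed (use \<epsilon> in auto)
  let ?ESC = "\<lambda>m k. {w \<in> space M. \<bar>SC (r k) w\<bar> > inverse (real (Suc m))}"
  let ?ESD = "\<lambda>m k. {w \<in> space M. \<bar>SD (r k) w\<bar> > inverse (real (Suc m))}"
  define E' where "E' m k = ?ESC m k \<union> ?ESD m k" for m k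
  have E': "E' m n \<in> events" for m n unfolding E'_def by measurable
  have E'_lim: "(\<lambda>n. prob (E' m n)) \<longlonglongrightarrow> 0" for m
  proof (rule tendsto_sandwich[OF _ _ tendsto_const])
    have p: "0 < inverse (real (Suc m))" by simp
    show "(\<lambda>k. prob (?ESC m k) + prob (?ESD m k)) \<longlonglongrightarrow> 0"
      using tendsto_add[OF SC_lim[OF p] LIMSEQ_subseq_LIMSEQ[OF SD_lim[OF p] r(1)]] by (simp add: comp_def)
    show "eventually (\<lambda>k. prob (E' m k) \<le> prob (?ESC m k) + prob (?ESD m k)) sequentially"
      unfolding E'_def by (intro always_eventually allI measure_Un_le) measurable
  qed auto
  \<comment> \<open>A further subsequence within \<open>r\<close>, so that the closeness of
    \<open>U\<close>, \<open>V\<close> to the solution is inherited.\<close>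
  obtain q where q: "strict_mono q" "AE w in M. \<forall>m. eventually (\<lambda>k. w \<notin> E' m (q k)) sequentially"
    by (rule AE_subsequence_eventually_notin[OF E' E'_lim])
  define p where "p k = r (q k)" for k
  have p_top: "filterlim p at_top sequentially"
    unfolding p_def using filterlim_compose[OF filterlim_subseq[OF r(1)] filterlim_subseq[OF q(1)]] .
  show ?thesis
    using bounded close q(2) AE_space
  proof eventually_elim
    case (elim w)
    from elim(1) obtain B where B: "1 \<le> B" "\<And>n i. i \<le> Suc n \<Longrightarrow> \<bar>X (g n i) w\<bar> \<le> B \<and> \<bar>Y (g n i) w\<bar> \<le> B" by blast
    have close': "eventually (\<lambda>k. ?near (p k) w e) sequentially" if "0 < e" for e
      unfolding p_def using elim(2)[rule_format, OF that] filterlim_subseq[OF q(1)]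
      by (auto simp: filterlim_iff)
    define rest where "rest n = (\<Sum>j<Suc n. d n j w * (h n)\<^sup>2 / 4 -
      (?u n j w * X (g n j) w + ?v n j w * Y (g n j) w) * h n)" for n
    have identity: "(U n (Suc n) w)\<^sup>2 + (V n (Suc n) w)\<^sup>2 = (X 0 w)\<^sup>2 + (Y 0 w)\<^sup>2 + SD n w + SC n w + rest n" for n
      using rotation_step_identity[of "\<lambda>j. U n j w" "\<lambda>j. X (g n j) w" "h n" "\<lambda>j. Y (g n j) w" "\<lambda>j. D n j w"
          "\<lambda>j. V n j w" "Suc n"]
      by (simp add: U_def V_def euler_sum_def SD_def SC_def rest_def c_def d_def D_def gh del: sum.lessThan_Suc)
        (simp add: U_def V_def euler_sum_def D_def gh)
    have lim_UV: "(\<lambda>k. U (p k) (Suc (p k)) w) \<longlonglongrightarrow> X t w" "(\<lambda>k. V (p k) (Suc (p k)) w) \<longlonglongrightarrow> Y t w"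
    proof -
      have "eventually (\<lambda>k. dist (U (p k) (Suc (p k)) w) (X t w) < e) sequentially"
        "eventually (\<lambda>k. dist (V (p k) (Suc (p k)) w) (Y t w) < e) sequentially" if "0 < e" for e
      proof -
        have "eventually (\<lambda>k. dist (U (p k) (Suc (p k)) w) (X t w) < e \<and> dist (V (p k) (Suc (p k)) w) (Y t w) < e) sequentially"
          using close'[OF half_gt_zero[OF that]]
        proof eventually_elim
          case (elim k)
          from elim[rule_format, OF order_refl] that show ?case by (auto simp: g0 dist_real_def)
        qed
        then show "eventually (\<lambda>k. dist (U (p k) (Suc (p k)) w) (X t w) < e) sequentially"
          "eventually (\<lambda>k. dist (V (p k) (Suc (p k)) w) (Y t w) < e) sequentially"
          by (auto elim: eventually_mono)
      qed
      then show "(\<lambda>k. U (p k) (Suc (p k)) w) \<longlonglongrightarrow> X t w" "(\<lambda>k. V (p k) (Suc (p k)) w) \<longlonglongrightarrow> Y t w"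
        by (auto simp: tendsto_iff)
    qed
    have lim_S: "(\<lambda>k. SC (p k) w) \<longlonglongrightarrow> 0" "(\<lambda>k. SD (p k) w) \<longlonglongrightarrow> 0"
    proof -
      have "eventually (\<lambda>k. dist (SC (p k) w) 0 < e) sequentially \<and> eventually (\<lambda>k. dist (SD (p k) w) 0 < e) sequentially"
        if e: "0 < e" for e
      proof -
        obtain m where m: "inverse (real (Suc m)) < e" using reals_Archimedean[OF e] by blast
        have "eventually (\<lambda>k. dist (SC (p k) w) 0 < e \<and> dist (SD (p k) w) 0 < e) sequentially"
          using elim(3)[rule_format, of m]
        proof eventually_elim
          case (elim k)
          then show ?case using m \<open>w \<in> space M\<close> by (auto simp: E'_def p_def not_less)
        qed
        then show ?thesis by (auto elim: eventually_mono)
      qed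
      then show "(\<lambda>k. SC (p k) w) \<longlonglongrightarrow> 0" "(\<lambda>k. SD (p k) w) \<longlonglongrightarrow> 0"
        by (auto simp: tendsto_iff)
    qed
    have lim_rest: "(\<lambda>k. rest (p k)) \<longlonglongrightarrow> 0"
    proof (rule LIMSEQ_I)
      fix e :: real assume e: "0 < e"
      define e' where "e' = e / (8 * B * t)"
      have e': "0 < e'" "2 * e' * B * t = e / 4" using e B t by (auto simp: e'_def)
      have "(\<lambda>k. B\<^sup>2 / 2 * h (p k) * t) \<longlonglongrightarrow> B\<^sup>2 / 2 * 0 * t"
        by (intro tendsto_intros filterlim_compose[OF h(2) p_top])
      then have "eventually (\<lambda>k. B\<^sup>2 / 2 * h (p k) * t < e / 4) sequentially"
        by (rule order_tendstoD(2)) (use e in simp)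
      then have "eventually (\<lambda>k. norm (rest (p k) - 0) < e) sequentially"
        using close'[OF e'(1)]
      proof eventually_elim
        case (elim k)
        define n where "n = p k"
        have "\<bar>rest n\<bar> \<le> (\<Sum>j<Suc n. (B\<^sup>2 / 2 * h n + 2 * e' * B) * h n)"
          unfolding rest_def
        proof (rule order_trans[OF sum_abs sum_mono])
          fix j assume "j \<in> {..<Suc n}"
          then have j: "\<bar>X (g n j) w\<bar> \<le> B" "\<bar>Y (g n j) w\<bar> \<le> B"
            "\<bar>?u n j w\<bar> \<le> e'" "\<bar>?v n j w\<bar> \<le> e'"
            using B(2)[of j n] elim(2) by (auto simp: n_def)
          have "\<bar>X (g n j) w\<bar> \<le> \<bar>B\<bar>" "\<bar>Y (g n j) w\<bar> \<le> \<bar>B\<bar>" using j B(1) by auto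
          then have d: "d n j w \<le> 2 * B\<^sup>2" unfolding d_def by (simp add: abs_le_square_iff)
          have "\<bar>?u n j w * X (g n j) w\<bar> \<le> e' * B" "\<bar>?v n j w * Y (g n j) w\<bar> \<le> e' * B"
            unfolding abs_mult using j by (auto intro!: mult_mono)
          then have "\<bar>?u n j w * X (g n j) w + ?v n j w * Y (g n j) w\<bar> \<le> 2 * e' * B"
            by linarith
          then have 1: "\<bar>(?u n j w * X (g n j) w + ?v n j w * Y (g n j) w) * h n\<bar> \<le> 2 * e' * B * h n"
            unfolding abs_mult using h(1)[of n] by (simp add: mult_right_mono)
          have "d n j w * (h n)\<^sup>2 / 4 \<le> 2 * B\<^sup>2 * (h n)\<^sup>2 / 4"
            by (intro divide_right_mono mult_right_mono d) auto
          moreover have "0 \<le> d n j w * (h n)\<^sup>2 / 4" by (simp add: d_def)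
          ultimately have 2: "\<bar>d n j w * (h n)\<^sup>2 / 4\<bar> \<le> B\<^sup>2 / 2 * h n * h n" by (simp add: power2_eq_square)
          show "\<bar>d n j w * (h n)\<^sup>2 / 4 - (?u n j w * X (g n j) w + ?v n j w * Y (g n j) w) * h n\<bar>
            \<le> (B\<^sup>2 / 2 * h n + 2 * e' * B) * h n"
            using order_trans[OF abs_triangle_ineq4 add_mono[OF 2 1]] by (simp add: distrib_right)
        qed
        also have "\<dots> \<le> (B\<^sup>2 / 2 * h n + 2 * e' * B) * t" by (rule sum_le) simp
        also have "\<dots> < e" using elim(1) e'(2) e unfolding n_def distrib_right by linarith
        finally show ?case by (simp add: n_def)
      qed
      then show "\<exists>K. \<forall>k\<ge>K. norm (rest (p k) - 0) < e" by (simp add: eventually_sequentially)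
    qed
    have "(\<lambda>k. (X 0 w)\<^sup>2 + (Y 0 w)\<^sup>2 + SD (p k) w + SC (p k) w + rest (p k)) \<longlonglongrightarrow> (X 0 w)\<^sup>2 + (Y 0 w)\<^sup>2 + 0 + 0 + 0"
      by (intro tendsto_intros lim_S lim_rest)
    moreover have "(\<lambda>k. (U (p k) (Suc (p k)) w)\<^sup>2 + (V (p k) (Suc (p k)) w)\<^sup>2) \<longlonglongrightarrow> (X t w)\<^sup>2 + (Y t w)\<^sup>2"
      by (intro tendsto_intros lim_UV)
    ultimately show ?case unfolding identity using LIMSEQ_unique by fastforce
  qed
qed

end

section \<open>The Euler scheme\<close>

lemma grid_floor_eq:
  assumes "0 < \<delta>" "real i * \<delta> \<le> s" "s < real (Suc i) * \<delta>"
  shows "grid_floor \<delta> s = real i * \<delta>"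
proof -
  have "\<lfloor>s / \<delta>\<rfloor> = int i"
    using assms by (intro floor_unique) (auto simp: field_simps)
  then show ?thesis by (simp add: grid_floor_def)
qed

context brownian_motion_space
begin

text \<open>The integrand is constant on each interval between grid points, so the stochastic
  integral is that of a step process and the drift integral a finite sum. The stopped grid
  \<open>\<sigma>\<close> makes \<open>t\<close> itself a grid point; from there on all steps have
  length zero.\<close>

lemma frozen_coefficients_AE:
  assumes X: "has_ito_differential M F W X (\<lambda>s w. a (grid_floor \<delta> s) w) (\<lambda>s w. b (grid_floor \<delta> s) w)"
    and \<delta>: "0 < \<delta>" and t: "0 \<le> t"
  defines "\<sigma> \<equiv> \<lambda>k. min t (real k * \<delta>)"
  shows "AE w in M. X (\<sigma> k) w = euler_sum X a b \<sigma> k w"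
proof -
  obtain J where J: "\<And>s. 0 \<le> s \<Longrightarrow> has_ito_integral M F W (\<lambda>s w. b (grid_floor \<delta> s) w) s (J s)"
    "\<And>s. 0 \<le> s \<Longrightarrow> AE w in M. set_integrable lborel {0..s} (\<lambda>s. a (grid_floor \<delta> s) w) \<and>
      X s w = X 0 w + (LINT s:{0..s}|lborel. a (grid_floor \<delta> s) w) + J s w"
    using X unfolding has_ito_differential_def by blast
  define \<tau> where "\<tau> i = real i * \<delta>" for i
  have \<tau>: "strict_mono \<tau>" "\<tau> 0 = 0" using \<delta> by (auto simp: \<tau>_def strict_mono_def)
  have gf: "grid_floor \<delta> s = \<tau> i" if "\<tau> i \<le> s" "s < \<tau> (Suc i)" for i s
    unfolding \<tau>_def by (rule grid_floor_eq[OF \<delta>]) (use that in \<open>auto simp: \<tau>_def\<close>)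
  have \<sigma>k: "0 \<le> \<sigma> i" "\<sigma> i \<le> \<tau> i" "\<sigma> 0 = 0" for i using t \<delta> by (auto simp: \<sigma>_def \<tau>_def)
  have mono: "\<sigma> i \<le> \<sigma> (Suc i)" for i using \<delta> by (auto simp: \<sigma>_def distrib_right)
  have mn: "min (\<sigma> k) (\<tau> i) = \<sigma> i" if "i \<le> k" for i
  proof -
    have "real i * \<delta> \<le> real k * \<delta>" using that \<delta> by (intro mult_right_mono) auto
    then show ?thesis by (auto simp: \<sigma>_def \<tau>_def)
  qed
  \<comment> \<open>Either the grid point has not been cut off by \<open>t\<close>, or the step that
    starts there has length zero. In both cases \<open>\<tau> i\<close> may be replaced by
    \<open>\<sigma> i\<close> in the sums.\<close>
  have frozen: "\<tau> i = \<sigma> i \<or> \<sigma> (Suc i) = \<sigma> i" for i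
    using \<delta> by (auto simp: \<sigma>_def \<tau>_def min_def distrib_right)
  have step: "step_process F k \<tau> (\<lambda>i. b (\<tau> i))"
  proof -
    have "b (grid_floor \<delta> (\<tau> i)) \<in> borel_measurable (F (\<tau> i))" for i
      using J(1)[of 0] \<delta> by (auto simp: has_ito_integral_def adapted_process_def \<tau>_def)
    moreover have "grid_floor \<delta> (\<tau> i) = \<tau> i" for i
      by (rule gf) (use \<tau> in \<open>auto simp: strict_mono_less\<close>)
    ultimately show ?thesis using \<tau> by (simp add: step_process_def strict_mono_less)
  qed
  have Jk: "AE w in M. J (\<sigma> k) w = simple_integral W k \<tau> (\<lambda>i. b (\<tau> i)) (\<sigma> k) w"
  proof (rule has_ito_integral_step_AE[OF J(1) step \<sigma>k(1)])
    show "AE w in M. path_dist2 (\<lambda>s w. b (grid_floor \<delta> s) w) (simple_path k \<tau> (\<lambda>i. b (\<tau> i))) (\<sigma> k) w = 0"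
    proof (intro AE_I2)
      fix w
      have "path_dist2 (\<lambda>s w. b (grid_floor \<delta> s) w) (simple_path k \<tau> (\<lambda>i. b (\<tau> i))) (\<sigma> k) w \<le> ennreal (0\<^sup>2 * \<sigma> k)"
        by (rule path_dist2_step_le[OF \<tau> \<sigma>k(1) \<sigma>k(2)]) (simp_all add: gf[OF less_imp_le])
      then show "path_dist2 (\<lambda>s w. b (grid_floor \<delta> s) w) (simple_path k \<tau> (\<lambda>i. b (\<tau> i))) (\<sigma> k) w = 0"
        by simp
    qed
  qed
  have Jk_eq: "simple_integral W k \<tau> (\<lambda>i. b (\<tau> i)) (\<sigma> k) w =
    (\<Sum>i<k. b (\<sigma> i) w * dW \<sigma> i w)" for w
    unfolding simple_integral_def
  proof (intro sum.cong refl)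
    fix i assume "i \<in> {..<k}"
    then show "b (\<tau> i) w * (W (min (\<sigma> k) (\<tau> (Suc i))) w - W (min (\<sigma> k) (\<tau> i)) w) =
      b (\<sigma> i) w * dW \<sigma> i w"
      using mn[of i] mn[of "Suc i"] frozen[of i] by auto
  qed
  from Jk J(2)[OF \<sigma>k(1)[of k]] show ?thesis
  proof eventually_elim
    case (elim w)
    have "\<bar>(LINT s:{\<sigma> 0..\<sigma> k}|lborel. a (grid_floor \<delta> s) w) - (\<Sum>i<k. a (\<tau> i) w * (\<sigma> (Suc i) - \<sigma> i))\<bar> \<le> 0 * (\<sigma> k - \<sigma> 0)"
    proof (rule set_integral_step_approx)
      show "\<bar>a (grid_floor \<delta> s) w - a (\<tau> i) w\<bar> \<le> 0" if "\<sigma> i < s" "s < \<sigma> (Suc i)" for i s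
        using gf[of i s] that by (auto simp: \<sigma>_def \<tau>_def)
    qed (use mono elim \<sigma>k in auto)
    then have "(LINT s:{0..\<sigma> k}|lborel. a (grid_floor \<delta> s) w) = (\<Sum>i<k. a (\<tau> i) w * (\<sigma> (Suc i) - \<sigma> i))"
      using \<sigma>k by simp
    also have "\<dots> = (\<Sum>i<k. a (\<sigma> i) w * (\<sigma> (Suc i) - \<sigma> i))"
      by (intro sum.cong refl) (use frozen in force)
    finally show ?case using elim Jk_eq[of w] by (simp add: euler_sum_def sum.distrib)
  qed
qed

text \<open>The computation is purely algebraic and the same for every step length, so it also
  covers the shortened step that ends at \<open>t\<close>.\<close>

lemma euler_scheme_norm_AE:
  assumes X: "has_ito_differential M F W X (\<lambda>s w. - (1/2) * X (grid_floor \<delta> s) w) (\<lambda>s w. - Y (grid_floor \<delta> s) w)"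
    and Y: "has_ito_differential M F W Y (\<lambda>s w. - (1/2) * Y (grid_floor \<delta> s) w) (\<lambda>s w. X (grid_floor \<delta> s) w)"
    and \<delta>: "0 < \<delta>" and t: "0 \<le> t"
  defines "\<sigma> \<equiv> \<lambda>k. min t (real k * \<delta>)"
  shows "AE w in M. (X (\<sigma> k) w)\<^sup>2 + (Y (\<sigma> k) w)\<^sup>2 = ((X 0 w)\<^sup>2 + (Y 0 w)\<^sup>2) *
    (\<Prod>i<k. (1 - (\<sigma> (Suc i) - \<sigma> i) / 2)\<^sup>2 + (dW \<sigma> i w)\<^sup>2)"
proof -
  have "AE w in M. \<forall>k. X (\<sigma> k) w = euler_sum X (\<lambda>s w. - (1/2) * X s w) (\<lambda>s w. - Y s w) \<sigma> k w"
    unfolding AE_all_countable \<sigma>_def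
    by (intro allI frozen_coefficients_AE[where a = "\<lambda>s w. - (1/2) * X s w" and b = "\<lambda>s w. - Y s w", OF X \<delta> t])
  moreover have "AE w in M. \<forall>k. Y (\<sigma> k) w = euler_sum Y (\<lambda>s w. - (1/2) * Y s w) X \<sigma> k w"
    unfolding AE_all_countable \<sigma>_def
    by (intro allI frozen_coefficients_AE[where a = "\<lambda>s w. - (1/2) * Y s w" and b = X, OF Y \<delta> t])
  ultimately show ?thesis
  proof eventually_elim
    case (elim w)
    show ?case
    proof (induction k)
      case 0
      then show ?case using t by (simp add: \<sigma>_def)
    next
      case (Suc k)
      let ?h = "\<sigma> (Suc k) - \<sigma> k" and ?D = "dW \<sigma> k w"
      have X': "X (\<sigma> (Suc k)) w = X (\<sigma> k) w + (- (1/2) * X (\<sigma> k) w * ?h - Y (\<sigma> k) w * ?D)"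
        using elim(1)[rule_format, of k] elim(1)[rule_format, of "Suc k"] by (simp add: euler_sum_def)
      have Y': "Y (\<sigma> (Suc k)) w = Y (\<sigma> k) w + (- (1/2) * Y (\<sigma> k) w * ?h + X (\<sigma> k) w * ?D)"
        using elim(2)[rule_format, of k] elim(2)[rule_format, of "Suc k"] by (simp add: euler_sum_def)
      have alg: "(x + (- (1/2) * x * h - y * d))\<^sup>2 + (y + (- (1/2) * y * h + x * d))\<^sup>2
        = (x\<^sup>2 + y\<^sup>2) * ((1 - h / 2)\<^sup>2 + d\<^sup>2)" for x y h d :: real
        by (simp add: power2_eq_square field_simps)
      show ?case unfolding X' Y' alg Suc by simp
    qed
  qed
qed

text \<open>Put \<open>z = D^2 - h\<close> and \<open>c = h^2 / 4\<close>: then \<open>S\<close>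
  sums the \<open>z\<close>, and \<open>R\<close> multiplies the factors \<open>1 + c + z\<close>.
  In the expansion of the second moment of \<open>R - 1 - S\<close> all terms linear in
  \<open>q\<close> cancel: \<open>E R^2\<close> contributes at most \<open>5/2 q\<close>,
  \<open>E S^2\<close> is \<open>2 q\<close>, while \<open>- 2 E R\<close> and
  \<open>- 2 E (R S)\<close> contribute at most \<open>- q/2\<close> and \<open>- 4 q\<close>. Only
  \<open>10 q^2\<close> is left. The grid is merely \<open>mono\<close>, so steps of length zero may
  occur.\<close>

lemma euler_norm_second_moment_bound:
  fixes \<sigma> :: "nat \<Rightarrow> real" and n :: nat
  assumes \<sigma>: "mono \<sigma>" "0 \<le> \<sigma> (0::nat)"
  defines "h \<equiv> \<lambda>i. \<sigma> (Suc i) - \<sigma> i"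
  defines "R \<equiv> \<lambda>k w. \<Prod>i<k. (1 - h i / 2)\<^sup>2 + (dW \<sigma> i w)\<^sup>2"
    and "S \<equiv> \<lambda>k w. \<Sum>i<k. (dW \<sigma> i w)\<^sup>2 - h i"
    and "q \<equiv> \<Sum>i<n. (\<sigma> (Suc i) - \<sigma> i)\<^sup>2"
  shows "integrable M (\<lambda>w. (R n w)\<^sup>2)" "integrable M (\<lambda>w. (S n w)\<^sup>2)"
    "expectation (\<lambda>w. (S n w)\<^sup>2) = 2 * q"
    "q \<le> 1 / 3 \<Longrightarrow> expectation (\<lambda>w. (R n w - 1 - S n w)\<^sup>2) \<le> 10 * q\<^sup>2"
proof -
  have q_def: "q = (\<Sum>i<n. (h i)\<^sup>2)"
    by (simp add: q_def h_def)
  define D where "D i w = dW \<sigma> i w" for i w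
  define c where "c i = (h i)\<^sup>2 / 4" for i
  define z where "z i x = x\<^sup>2 - h i" for i and x :: real
  have c0: "0 \<le> c i" for i by (simp add: c_def)
  have pos: "0 \<le> \<sigma> i" "\<sigma> i \<le> \<sigma> (Suc i)" for i
    using monoD[OF \<sigma>(1), of 0 i] monoD[OF \<sigma>(1), of i "Suc i"] \<sigma>(2) by auto
  have DF: "D i \<in> borel_measurable (F (\<sigma> (Suc i)))" for i
    unfolding D_def[abs_def] using pos by (intro increment_measurable) auto
  have R_Suc: "R (Suc k) w = R k w * (1 + c k + z k (D k w))" for k w
    by (simp add: R_def D_def c_def z_def power2_eq_square field_simps)
  have S_Suc: "S (Suc k) w = S k w + z k (D k w)" for k w
    by (simp add: S_def D_def z_def)
  have RF: "R k \<in> borel_measurable (F (\<sigma> k))" and SF: "S k \<in> borel_measurable (F (\<sigma> k))" for k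
  proof -
    have *: "(\<lambda>w. dW \<sigma> i w) \<in> borel_measurable (F (\<sigma> k))" if "i \<in> {..<k}" for i
      using measurable_F_mono[OF DF, of i "\<sigma> k"] that monoD[OF \<sigma>(1), of "Suc i" k] by (simp add: D_def[abs_def])
    show "R k \<in> borel_measurable (F (\<sigma> k))"
      unfolding R_def by (intro borel_arith_measurable *)
    show "S k \<in> borel_measurable (F (\<sigma> k))"
      unfolding S_def by (intro borel_arith_measurable *)
  qed
  note [measurable] = measurable_F_M[OF RF] measurable_F_M[OF SF] measurable_F_M[OF DF]
  have z_mom: "integrable M (\<lambda>w. z k (D k w))" "integrable M (\<lambda>w. (z k (D k w))\<^sup>2)"
    "expectation (\<lambda>w. z k (D k w)) = 0" "expectation (\<lambda>w. (z k (D k w))\<^sup>2) = 2 * (h k)\<^sup>2" for k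
    using centered_square_moments[OF pos, of k] by (simp_all add: z_def D_def h_def)
  have mult: "integrable M (\<lambda>w. \<xi> w * f (D k w)) \<and> expectation (\<lambda>w. \<xi> w * f (D k w)) = expectation \<xi> * expectation (\<lambda>w. f (D k w))"
    if "\<xi> \<in> borel_measurable (F (\<sigma> k))" "integrable M \<xi>" "f \<in> borel_measurable borel" "integrable M (\<lambda>w. f (D k w))"
    for \<xi> :: "'a \<Rightarrow> real" and f k
    using increment_expectation_mult[OF pos that(1,2,3) that(4)[unfolded D_def]] by (simp add: D_def)
  define g where "g k x = 1 + c k + z k x" for k x
  have g_borel: "g k \<in> borel_measurable borel" "z k \<in> borel_measurable borel" for k
    by (simp_all add: g_def[abs_def] z_def[abs_def])
  have sq: "(g k x)\<^sup>2 = (1 + c k)\<^sup>2 + 2 * (1 + c k) * z k x + (z k x)\<^sup>2"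
    "g k x * z k x = (1 + c k) * z k x + (z k x)\<^sup>2" for k x
    by (simp_all add: g_def power2_eq_square algebra_simps)
  have g_mom: "integrable M (\<lambda>w. g k (D k w))" "integrable M (\<lambda>w. (g k (D k w))\<^sup>2)"
    "integrable M (\<lambda>w. g k (D k w) * z k (D k w))"
    "expectation (\<lambda>w. g k (D k w)) = 1 + c k"
    "expectation (\<lambda>w. (g k (D k w))\<^sup>2) = (1 + c k)\<^sup>2 + 2 * (h k)\<^sup>2"
    "expectation (\<lambda>w. g k (D k w) * z k (D k w)) = 2 * (h k)\<^sup>2" for k
    unfolding sq unfolding g_def using z_mom[of k] by (simp_all add: prob_space)
  let ?P = "\<lambda>k. \<Prod>i<k. (1 + c i)\<^sup>2 + 2 * (h i)\<^sup>2" and ?Q = "\<lambda>k. \<Sum>i<k. 2 * (h i)\<^sup>2"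
  have moments: "integrable M (R k) \<and> integrable M (\<lambda>w. (R k w)\<^sup>2) \<and> integrable M (S k) \<and>
    integrable M (\<lambda>w. (S k w)\<^sup>2) \<and> integrable M (\<lambda>w. R k w * S k w) \<and>
    expectation (R k) = (\<Prod>i<k. 1 + c i) \<and>
    expectation (\<lambda>w. (R k w)\<^sup>2) = ?P k \<and>
    expectation (S k) = 0 \<and> expectation (\<lambda>w. (S k w)\<^sup>2) = ?Q k \<and>
    expectation (\<lambda>w. R k w * S k w) \<ge> ?Q k" for k
  proof (induction k)
    case 0
    then show ?case by (simp add: R_def S_def prob_space)
  next
    case (Suc k)
    then have IH: "integrable M (R k)" "integrable M (\<lambda>w. (R k w)\<^sup>2)" "integrable M (S k)"
      "integrable M (\<lambda>w. (S k w)\<^sup>2)" "integrable M (\<lambda>w. R k w * S k w)"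
      "expectation (R k) = (\<Prod>i<k. 1 + c i)"
      "expectation (\<lambda>w. (R k w)\<^sup>2) = ?P k"
      "expectation (S k) = 0" "expectation (\<lambda>w. (S k w)\<^sup>2) = ?Q k"
      "expectation (\<lambda>w. R k w * S k w) \<ge> ?Q k" by auto
    have R2F: "(\<lambda>w. (R k w)\<^sup>2) \<in> borel_measurable (F (\<sigma> k))" and RSF: "(\<lambda>w. R k w * S k w) \<in> borel_measurable (F (\<sigma> k))"
      by (intro borel_measurable_power borel_measurable_times RF SF)+
    have fb: "(\<lambda>x. (g k x)\<^sup>2) \<in> borel_measurable borel" "(\<lambda>x. g k x * z k x) \<in> borel_measurable borel"
      by (intro borel_measurable_power borel_measurable_times g_borel)+
    note m1 = mult[OF RF IH(1) g_borel(1) g_mom(1)]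
    note m2 = mult[OF R2F IH(2) fb(1) g_mom(2)]
    note m3 = mult[OF SF IH(3) g_borel(2) z_mom(1)]
    note m4 = mult[OF RSF IH(5) g_borel(1) g_mom(1)]
    note m5 = mult[OF RF IH(1) fb(2) g_mom(3)]
    have e1: "R (Suc k) = (\<lambda>w. R k w * g k (D k w))" by (simp add: fun_eq_iff R_Suc g_def)
    have e2: "(\<lambda>w. (R (Suc k) w)\<^sup>2) = (\<lambda>w. (R k w)\<^sup>2 * (g k (D k w))\<^sup>2)" by (simp add: e1 power_mult_distrib)
    have e3: "S (Suc k) = (\<lambda>w. S k w + z k (D k w))" by (simp add: fun_eq_iff S_Suc)
    have e4: "(\<lambda>w. (S (Suc k) w)\<^sup>2) = (\<lambda>w. (S k w)\<^sup>2 + 2 * (S k w * z k (D k w)) + (z k (D k w))\<^sup>2)"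
      by (simp add: e3 power2_eq_square algebra_simps)
    have e5: "(\<lambda>w. R (Suc k) w * S (Suc k) w) =
      (\<lambda>w. (R k w * S k w) * g k (D k w) + R k w * (g k (D k w) * z k (D k w)))"
      by (simp add: e1 e3 algebra_simps)
    have "1 \<le> (\<Prod>i<k. 1 + c i)" by (rule prod_ge_1) (simp add: c0)
    then have R1: "1 \<le> expectation (R k)" using IH by simp
    \<comment> \<open>By independence \<open>E (R S)\<close> is multiplied by
      \<open>1 + c k \<ge> 1\<close> in each step and increased by \<open>E R\<close> times
      \<open>2 (h k)^2\<close>, where \<open>E R \<ge> 1\<close>.\<close>
    have "?Q k * 1 + 1 * (2 * (h k)\<^sup>2) \<le>
      expectation (\<lambda>w. R k w * S k w) * (1 + c k) + expectation (R k) * (2 * (h k)\<^sup>2)"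
    proof -
      have "0 \<le> ?Q k" by (intro sum_nonneg) simp
      then show ?thesis using IH(10) R1 c0[of k] by (intro add_mono mult_mono) auto
    qed
    also have "\<dots> = expectation (\<lambda>w. R (Suc k) w * S (Suc k) w)"
      unfolding e5 using m4 m5 g_mom by simp
    finally have RS: "?Q (Suc k) \<le> expectation (\<lambda>w. R (Suc k) w * S (Suc k) w)" by simp
    have "integrable M (R (Suc k))" "expectation (R (Suc k)) = (\<Prod>i<Suc k. 1 + c i)"
      unfolding e1 using m1 IH g_mom by auto
    moreover have "integrable M (\<lambda>w. (R (Suc k) w)\<^sup>2)"
      "expectation (\<lambda>w. (R (Suc k) w)\<^sup>2) = ?P (Suc k)"
      unfolding e2 using m2 IH g_mom by auto
    moreover have "integrable M (S (Suc k))" "expectation (S (Suc k)) = 0"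
      unfolding e3 using IH z_mom[of k] by auto
    moreover have "integrable M (\<lambda>w. (S (Suc k) w)\<^sup>2)" "expectation (\<lambda>w. (S (Suc k) w)\<^sup>2) = ?Q (Suc k)"
      unfolding e4 using m3 IH z_mom[of k] by auto
    moreover have "integrable M (\<lambda>w. R (Suc k) w * S (Suc k) w)"
      unfolding e5 using m4 m5 by auto
    ultimately show ?case using RS by blast
  qed
  from moments[of n] show "integrable M (\<lambda>w. (R n w)\<^sup>2)" "integrable M (\<lambda>w. (S n w)\<^sup>2)"
    "expectation (\<lambda>w. (S n w)\<^sup>2) = 2 * q"
    by (auto simp: q_def sum_distrib_left)
  have q0: "0 \<le> q" by (simp add: q_def sum_nonneg)
  \<comment> \<open>A product of factors \<open>1 + c i\<close> with \<open>c i \<ge> 0\<close> is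
    at least 1 plus the sum of the \<open>c i\<close>, which is \<open>q / 4\<close>.\<close>
  have R_lower: "1 + q / 4 \<le> expectation (R n)"
  proof -
    have "1 + (\<Sum>i<k. c i) \<le> (\<Prod>i<k. 1 + c i)" for k
    proof (induction k)
      case (Suc k)
      have "1 + (\<Sum>i<Suc k. c i) \<le> (1 + (\<Sum>i<k. c i)) * (1 + c k)"
        using c0 by (simp add: algebra_simps sum_nonneg)
      also have "\<dots> \<le> (\<Prod>i<k. 1 + c i) * (1 + c k)" using Suc c0 by (intro mult_right_mono) auto
      finally show ?case by simp
    qed simp
    from this[of n] show ?thesis using moments[of n] by (simp add: q_def c_def sum_divide_distrib)
  qed
  \<comment> \<open>Each factor is \<open>1 + x i\<close>, where \<open>5/2 = 2 * 1/4 + 2\<close>.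
    The assumption \<open>q \<le> 1 / 3\<close> keeps the exponent below 1, so that
    \<open>exp y \<le> 1 + y + y^2\<close> applies, and gives \<open>y \<le> 3 * q\<close>; the
    quadratic part is then \<open>q^2 + 9 q^2\<close>.\<close>
  have R2_upper: "expectation (\<lambda>w. (R n w)\<^sup>2) \<le> 1 + 5 / 2 * q + 10 * q\<^sup>2" if q: "q \<le> 1 / 3"
  proof -
    define x where "x i = 5 / 2 * (h i)\<^sup>2 + (c i)\<^sup>2" for i
    have "(\<Prod>i<n. (1 + c i)\<^sup>2 + 2 * (h i)\<^sup>2) \<le> (\<Prod>i<n. exp (x i))"
    proof (rule prod_mono)
      fix i assume "i \<in> {..<n}"
      have "(1 + c i)\<^sup>2 + 2 * (h i)\<^sup>2 = 1 + x i" by (simp add: x_def c_def power2_eq_square field_simps)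
      then show "0 \<le> (1 + c i)\<^sup>2 + 2 * (h i)\<^sup>2 \<and> (1 + c i)\<^sup>2 + 2 * (h i)\<^sup>2 \<le> exp (x i)"
        using exp_ge_add_one_self[of "x i"] by (auto simp: x_def)
    qed
    also have "\<dots> = exp (\<Sum>i<n. x i)" by (simp add: exp_sum)
    also have "(\<Sum>i<n. x i) \<le> 5 / 2 * q + q\<^sup>2"
    proof -
      have "(\<Sum>i<n. (c i)\<^sup>2) \<le> (\<Sum>i<n. (h i)\<^sup>2 * q)"
      proof (rule sum_mono)
        fix i assume i: "i \<in> {..<n}"
        have "(h i)\<^sup>2 \<le> q" unfolding q_def by (rule member_le_sum) (use i in auto)
        then have "(h i)\<^sup>2 * (h i)\<^sup>2 \<le> (h i)\<^sup>2 * q" by (intro mult_left_mono) auto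
        moreover have "(c i)\<^sup>2 = (h i)\<^sup>2 * (h i)\<^sup>2 / 16" by (simp add: c_def power2_eq_square)
        moreover have "0 \<le> (h i)\<^sup>2 * (h i)\<^sup>2" by simp
        ultimately show "(c i)\<^sup>2 \<le> (h i)\<^sup>2 * q" by linarith
      qed
      also have "\<dots> = q\<^sup>2" by (simp add: q_def sum_distrib_right[symmetric] power2_eq_square)
      finally show ?thesis by (simp add: x_def sum.distrib sum_distrib_left q_def)
    qed
    also have "exp (5 / 2 * q + q\<^sup>2) \<le> 1 + (5 / 2 * q + q\<^sup>2) + (5 / 2 * q + q\<^sup>2)\<^sup>2"
    proof (rule exp_bound)
      have "q * q \<le> 1/3 * (1/3)" using q q0 by (intro mult_mono) auto
      then show "5 / 2 * q + q\<^sup>2 \<le> 1" using q by (simp add: power2_eq_square)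
    qed (use q0 in simp)
    also have "(5 / 2 * q + q\<^sup>2)\<^sup>2 \<le> (3 * q)\<^sup>2"
    proof (rule power_mono)
      have "q * q \<le> q * (1/3)" using q q0 by (intro mult_left_mono) auto
      then show "5 / 2 * q + q\<^sup>2 \<le> 3 * q" using q0 by (simp add: power2_eq_square)
    qed (use q0 in simp)
    finally show ?thesis using moments[of n] by (simp add: power_mult_distrib)
  qed
  have "(\<lambda>w. (R n w - 1 - S n w)\<^sup>2) =
    (\<lambda>w. (R n w)\<^sup>2 + 1 + (S n w)\<^sup>2 - 2 * R n w - 2 * (R n w * S n w) + 2 * S n w)"
    by (simp add: fun_eq_iff power2_eq_square algebra_simps)
  then have "expectation (\<lambda>w. (R n w - 1 - S n w)\<^sup>2) = expectation (\<lambda>w. (R n w)\<^sup>2) + 1 + 2 * q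
    - 2 * expectation (R n) - 2 * expectation (\<lambda>w. R n w * S n w)"
    using moments[of n] by (simp add: prob_space q_def sum_distrib_left)
  moreover have "2 * q \<le> expectation (\<lambda>w. R n w * S n w)"
    using moments[of n] by (simp add: q_def sum_distrib_left)
  ultimately show "expectation (\<lambda>w. (R n w - 1 - S n w)\<^sup>2) \<le> 10 * q\<^sup>2" if "q \<le> 1 / 3"
    using R_lower R2_upper[OF that] by linarith
qed

end

section \<open>Absolute moments and the central limit theorem\<close>

text \<open>Above a level \<open>A \<ge> 1\<close> the excess of the \<open>p\<close>-th power is
  dominated by that of the square: with \<open>r = |x| / A \<ge> 1\<close> both factors of
  \<open>A^p (r^p - 1)\<close> grow with \<open>p\<close>. Tails of second moments thus control
  tails of lower ones.\<close>

lemma powr_truncation_le: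
  fixes x A p :: real
  assumes A: "1 \<le> A" and p: "1 \<le> p" "p \<le> 2"
  shows "\<bar>x\<bar> powr p - min \<bar>x\<bar> A powr p \<le> x\<^sup>2 - (min \<bar>x\<bar> A)\<^sup>2"
proof (cases "\<bar>x\<bar> \<le> A")
  case True
  then show ?thesis by (simp add: min_def)
next
  case False
  define r where "r = \<bar>x\<bar> / A"
  have r: "1 \<le> r" "\<bar>x\<bar> = A * r" using False A by (auto simp: r_def)
  have "A powr p * (r powr p - 1) \<le> A powr 2 * (r powr 2 - 1)"
    using A r p by (intro mult_mono powr_mono diff_right_mono) (auto intro!: ge_one_powr_ge_zero)
  then have "\<bar>x\<bar> powr p - A powr p \<le> \<bar>x\<bar> powr 2 - A powr 2"
    using A r by (simp add: powr_mult algebra_simps)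
  moreover have "\<bar>x\<bar> powr 2 = x\<^sup>2" "A powr 2 = A\<^sup>2" using A False by (simp_all add: powr_numeral)
  ultimately show ?thesis using False by (simp add: min_def)
qed

text \<open>The mean value theorem, with the derivative \<open>p z^(p-1)\<close> bounded by
  \<open>2 (1 + z)\<close> for exponents in \<open>[1,2]\<close>.\<close>

lemma abs_powr_diff_le:
  fixes a b p :: real
  assumes p: "1 \<le> p" "p \<le> 2"
  shows "\<bar>\<bar>b\<bar> powr p - \<bar>a\<bar> powr p\<bar> \<le> 2 * \<bar>b - a\<bar> * (1 + \<bar>a\<bar> + \<bar>b\<bar>)"
proof -
  have *: "\<bar>y powr p - x powr p\<bar> \<le> 2 * (y - x) * (1 + y)" if xy: "0 \<le> x" "x \<le> y" for x y :: real
  proof (cases "x < y")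
    case True
    obtain z where z: "x < z" "z < y" "y powr p - x powr p = p * z powr (p - 1) * (y - x)"
    proof (rule mvt[of x y "\<lambda>z. z powr p" "\<lambda>z h. p * z powr (p - 1) * h"])
      show "continuous_on {x..y} (\<lambda>z. z powr p)"
        using xy p by (intro continuous_on_powr' continuous_intros) auto
      show "((\<lambda>z. z powr p) has_derivative (\<lambda>h. p * z powr (p - 1) * h)) (at z)" if "x < z" for z
        using has_real_derivative_powr[of z p] that xy by (simp add: has_field_derivative_def)
    qed (use True in auto)
    have z_le: "z powr (p - 1) \<le> 1 + z"
    proof (cases "z \<le> 1")
      case True
      then have "z powr (p - 1) \<le> 1 powr (p - 1)" using z xy p by (intro powr_mono2) auto
      then show ?thesis using z xy by simp
    next
      case False
      then have "z powr (p - 1) \<le> z powr 1" using p by (intro powr_mono) auto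
      then show ?thesis using False by simp
    qed
    have "p * z powr (p - 1) \<le> 2 * (1 + y)"
      using p z_le z xy by (intro mult_mono) auto
    then have "p * z powr (p - 1) * (y - x) \<le> 2 * (1 + y) * (y - x)"
      using True by (intro mult_right_mono) auto
    moreover have "x powr p \<le> y powr p" using xy p by (intro powr_mono2) auto
    ultimately have "\<bar>y powr p - x powr p\<bar> \<le> 2 * (1 + y) * (y - x)" using z(3) by simp
    also have "\<dots> = 2 * (y - x) * (1 + y)" by (simp only: mult_ac)
    finally show ?thesis .
  qed (use that in auto)
  have "\<bar>\<bar>b\<bar> powr p - \<bar>a\<bar> powr p\<bar> \<le> 2 * \<bar>\<bar>b\<bar> - \<bar>a\<bar>\<bar> * (1 + \<bar>a\<bar> + \<bar>b\<bar>)"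
  proof (cases "\<bar>a\<bar> \<le> \<bar>b\<bar>")
    case True
    from *[OF _ True] have "\<bar>\<bar>b\<bar> powr p - \<bar>a\<bar> powr p\<bar> \<le> 2 * (\<bar>b\<bar> - \<bar>a\<bar>) * (1 + \<bar>b\<bar>)" by simp
    also have "\<dots> \<le> 2 * (\<bar>b\<bar> - \<bar>a\<bar>) * (1 + \<bar>a\<bar> + \<bar>b\<bar>)" using True by (intro mult_left_mono) auto
    finally show ?thesis using True by simp
  next
    case False
    then have le: "\<bar>b\<bar> \<le> \<bar>a\<bar>" by simp
    from *[OF _ le] have "\<bar>\<bar>b\<bar> powr p - \<bar>a\<bar> powr p\<bar> \<le> 2 * (\<bar>a\<bar> - \<bar>b\<bar>) * (1 + \<bar>a\<bar>)"
      by (simp add: abs_minus_commute)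
    also have "\<dots> \<le> 2 * (\<bar>a\<bar> - \<bar>b\<bar>) * (1 + \<bar>a\<bar> + \<bar>b\<bar>)" using le by (intro mult_left_mono) auto
    finally show ?thesis using le by simp
  qed
  also have "\<dots> \<le> 2 * \<bar>b - a\<bar> * (1 + \<bar>a\<bar> + \<bar>b\<bar>)"
    by (intro mult_right_mono mult_left_mono abs_triangle_ineq3) auto
  finally show ?thesis .
qed

lemma abs_powr_le: "1 \<le> p \<Longrightarrow> p \<le> 2 \<Longrightarrow> \<bar>x\<bar> powr p \<le> 1 + x\<^sup>2" for x p :: real
proof (cases "\<bar>x\<bar> \<le> 1")
  case True
  moreover assume "1 \<le> p" "p \<le> 2"
  ultimately have "\<bar>x\<bar> powr p \<le> 1 powr p" by (intro powr_mono2) auto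
  then show ?thesis by (simp add: add_increasing2)
next
  case False
  moreover assume "1 \<le> p" "p \<le> 2"
  ultimately have "\<bar>x\<bar> powr p \<le> \<bar>x\<bar> powr 2" by (intro powr_mono) auto
  then show ?thesis using False by (simp add: powr_numeral)
qed

text \<open>Truncated moments converge because they integrate bounded continuous functions. The
  truncation errors are at most those of the second moment, and convergence of second moments makes
  these small uniformly for large \<open>n\<close>. The argument includes
  \<open>p = 2\<close>.\<close>

lemma weak_conv_abs_moment:
  fixes \<mu> :: "nat \<Rightarrow> real measure" and \<nu> :: "real measure" and p :: real
  assumes \<mu>: "\<And>n. real_distribution (\<mu> n)" and \<nu>: "real_distribution \<nu>" and conv: "weak_conv_m \<mu> \<nu>"
    and int: "\<And>n. integrable (\<mu> n) (\<lambda>x. x\<^sup>2)" "integrable \<nu> (\<lambda>x. x\<^sup>2)"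
    and lim2: "(\<lambda>n. \<integral>x. x\<^sup>2 \<partial>\<mu> n) \<longlonglongrightarrow> (\<integral>x. x\<^sup>2 \<partial>\<nu>)"
    and p: "1 \<le> p" "p \<le> 2"
  shows "(\<lambda>n. \<integral>x. \<bar>x\<bar> powr p \<partial>\<mu> n) \<longlonglongrightarrow> (\<integral>x. \<bar>x\<bar> powr p \<partial>\<nu>)"
proof (rule LIMSEQ_I)
  interpret \<nu>: real_distribution \<nu> by fact
  interpret \<mu>: real_distribution "\<mu> n" for n by fact
  fix e :: real assume e: "0 < e"
  define f where "f A r x = min \<bar>x\<bar> A powr r" for A r x :: real
  have f2: "f A 2 x = (min \<bar>x\<bar> A)\<^sup>2" if "0 \<le> A" for A x
    using that by (cases "min \<bar>x\<bar> A = 0") (auto simp: f_def powr_numeral)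
  have f_cont: "continuous_on UNIV (f A r)" if "0 \<le> A" "0 < r" for A r
    unfolding f_def[abs_def] using that by (intro continuous_on_powr' continuous_intros) auto
  have f_meas[measurable]: "f A r \<in> borel_measurable borel" for A r
    unfolding f_def[abs_def] by measurable
  have f_bd: "\<bar>f A r x\<bar> \<le> A powr r" if "0 \<le> A" "0 < r" for A r x
    unfolding f_def using that by (auto intro!: powr_mono2)
  have int_f: "integrable (\<mu> n) (f A r)" "integrable \<nu> (f A r)" if "0 \<le> A" "0 < r" for A r n
    by (rule \<mu>.integrable_const_bound[where B = "A powr r"], use f_bd that in auto)
      (rule \<nu>.integrable_const_bound[where B = "A powr r"], use f_bd that in auto)
  have lim_f: "(\<lambda>n. \<integral>x. f A r x \<partial>\<mu> n) \<longlonglongrightarrow> (\<integral>x. f A r x \<partial>\<nu>)" if "0 \<le> A" "0 < r" for A r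
    by (rule weak_conv_imp_integral_bdd_continuous_conv[OF \<mu> \<nu> conv, where B = "A powr r"])
      (use f_cont[OF that] f_bd[OF that] in \<open>auto simp: continuous_on_eq_continuous_at\<close>)
  \<comment> \<open>The truncation level is selected for the limit measure alone.\<close>
  have "(\<lambda>k. \<integral>x. f (real (Suc k)) 2 x \<partial>\<nu>) \<longlonglongrightarrow> (\<integral>x. x\<^sup>2 \<partial>\<nu>)"
  proof (rule integral_dominated_convergence[where w = "\<lambda>x. x\<^sup>2"])
    show "AE x in \<nu>. (\<lambda>k. f (real (Suc k)) 2 x) \<longlonglongrightarrow> x\<^sup>2"
    proof (intro AE_I2 tendsto_eventually)
      fix x :: real
      obtain k0 :: nat where "\<bar>x\<bar> \<le> real k0" using real_arch_simple by blast
      then have "f (real (Suc k)) 2 x = x\<^sup>2" if "k0 \<le> k" for k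
        using that by (subst f2) auto
      then show "eventually (\<lambda>k. f (real (Suc k)) 2 x = x\<^sup>2) sequentially"
        by (auto simp: eventually_sequentially)
    qed
    show "AE x in \<nu>. norm (f (real (Suc k)) 2 x) \<le> x\<^sup>2" for k
    proof (intro AE_I2)
      fix x :: real
      have "(min \<bar>x\<bar> (real (Suc k)))\<^sup>2 \<le> \<bar>x\<bar>\<^sup>2" by (intro power_mono) auto
      then show "norm (f (real (Suc k)) 2 x) \<le> x\<^sup>2" by (simp add: f2)
    qed
  qed (use int in auto)
  from LIMSEQ_D[OF this, of "e / 4"] e obtain k where
    k: "\<bar>(\<integral>x. f (real (Suc k)) 2 x \<partial>\<nu>) - (\<integral>x. x\<^sup>2 \<partial>\<nu>)\<bar> < e / 4" by auto
  define A where "A = real (Suc k)"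
  have A: "1 \<le> A" by (simp add: A_def)
  then have A0: "0 \<le> A" and p0: "0 < p" using p by auto
  have ip: "integrable (\<mu> n) (\<lambda>x. \<bar>x\<bar> powr p)" "integrable \<nu> (\<lambda>x. \<bar>x\<bar> powr p)" for n
    by (rule Bochner_Integration.integrable_bound[where f="\<lambda>x. 1 + x\<^sup>2"],
        use int abs_powr_le[OF p] in auto)+
  have tail: "\<bar>(\<integral>x. \<bar>x\<bar> powr p \<partial>M) - (\<integral>x. f A p x \<partial>M)\<bar> \<le> (\<integral>x. x\<^sup>2 \<partial>M) - (\<integral>x. f A 2 x \<partial>M)"
    if i: "integrable M (\<lambda>x. \<bar>x\<bar> powr p)" "integrable M (f A p)" "integrable M (\<lambda>x. x\<^sup>2)" "integrable M (f A 2)"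
    for M :: "real measure"
  proof -
    have "f A p x \<le> \<bar>x\<bar> powr p" for x unfolding f_def using p0 A by (intro powr_mono2) auto
    then have "(\<integral>x. f A p x \<partial>M) \<le> (\<integral>x. \<bar>x\<bar> powr p \<partial>M)" using i by (intro integral_mono) auto
    moreover have "\<bar>x\<bar> powr p - f A p x \<le> x\<^sup>2 - f A 2 x" for x
      unfolding f2[OF A0] unfolding f_def by (rule powr_truncation_le[OF A p])
    then have "(\<integral>x. \<bar>x\<bar> powr p - f A p x \<partial>M) \<le> (\<integral>x. x\<^sup>2 - f A 2 x \<partial>M)"
      using i by (intro integral_mono Bochner_Integration.integrable_diff) auto
    ultimately show ?thesis using i by simp
  qed
  \<comment> \<open>The level chosen for \<open>\<nu>\<close> also serves \<open>\<mu> n\<close> for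
    large \<open>n\<close>: the full and the truncated second moment both converge, hence so does
    their difference.\<close>
  have "(\<lambda>n. (\<integral>x. x\<^sup>2 \<partial>\<mu> n) - (\<integral>x. f A 2 x \<partial>\<mu> n)) \<longlonglongrightarrow> (\<integral>x. x\<^sup>2 \<partial>\<nu>) - (\<integral>x. f A 2 x \<partial>\<nu>)"
    by (intro tendsto_diff lim2 lim_f A0) simp
  then have "eventually (\<lambda>n. (\<integral>x. x\<^sup>2 \<partial>\<mu> n) - (\<integral>x. f A 2 x \<partial>\<mu> n) < e / 4) sequentially"
    by (rule order_tendstoD(2)) (use k in \<open>unfold A_def, linarith\<close>)
  moreover have "eventually (\<lambda>n. dist (\<integral>x. f A p x \<partial>\<mu> n) (\<integral>x. f A p x \<partial>\<nu>) < e / 4) sequentially"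
    by (rule tendstoD[OF lim_f[OF A0 p0]]) (use e in simp)
  ultimately have "eventually (\<lambda>n. norm ((\<integral>x. \<bar>x\<bar> powr p \<partial>\<mu> n) - (\<integral>x. \<bar>x\<bar> powr p \<partial>\<nu>)) < e) sequentially"
  proof eventually_elim
    case (elim n)
    have "\<bar>(\<integral>x. \<bar>x\<bar> powr p \<partial>\<mu> n) - (\<integral>x. f A p x \<partial>\<mu> n)\<bar> \<le> (\<integral>x. x\<^sup>2 \<partial>\<mu> n) - (\<integral>x. f A 2 x \<partial>\<mu> n)"
      by (intro tail ip int int_f A0 p0) simp
    moreover have "\<bar>(\<integral>x. \<bar>x\<bar> powr p \<partial>\<nu>) - (\<integral>x. f A p x \<partial>\<nu>)\<bar> \<le> (\<integral>x. x\<^sup>2 \<partial>\<nu>) - (\<integral>x. f A 2 x \<partial>\<nu>)"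
      by (intro tail ip int int_f A0 p0) simp
    ultimately show ?case using elim k unfolding A_def[symmetric] dist_real_def real_norm_def by linarith
  qed
  then show "\<exists>N. \<forall>n\<ge>N. norm ((\<integral>x. \<bar>x\<bar> powr p \<partial>\<mu> n) - (\<integral>x. \<bar>x\<bar> powr p \<partial>\<nu>)) < e"
    by (simp add: eventually_sequentially)
qed

lemma integrable_power2_diff:
  fixes f g :: "'a \<Rightarrow> real"
  assumes "f \<in> borel_measurable M" "g \<in> borel_measurable M"
    and "integrable M (\<lambda>x. (f x)\<^sup>2)" "integrable M (\<lambda>x. (g x)\<^sup>2)"
  shows "integrable M (\<lambda>x. (f x - g x)\<^sup>2)"
proof (rule Bochner_Integration.integrable_bound[where f = "\<lambda>x. 2 * (f x)\<^sup>2 + 2 * (g x)\<^sup>2"])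
  have "(u - v)\<^sup>2 \<le> 2 * u\<^sup>2 + 2 * v\<^sup>2" for u v :: real
    using zero_le_power2[of "u + v"] by (simp add: power2_eq_square algebra_simps)
  then show "AE x in M. norm ((f x - g x)\<^sup>2) \<le> norm (2 * (f x)\<^sup>2 + 2 * (g x)\<^sup>2)" by simp
qed (use assms in auto)

text \<open>The difference of the powers is at most the distance of \<open>a\<close> and
  \<open>b\<close> times a factor with bounded second moment. Young's inequality with parameter
  \<open>\<eta>\<close> puts this into the form treated by
  \<open>tendsto_0_tradeoff\<close>.\<close>

lemma (in prob_space) abs_moment_perturbation:
  fixes a b :: "nat \<Rightarrow> 'a \<Rightarrow> real" and p :: real
  assumes meas: "\<And>n. a n \<in> borel_measurable M" "\<And>n. b n \<in> borel_measurable M"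
    and int: "\<And>n. integrable M (\<lambda>w. (a n w)\<^sup>2)" "\<And>n. integrable M (\<lambda>w. (b n w)\<^sup>2)"
    and a_bd: "\<And>n. expectation (\<lambda>w. (a n w)\<^sup>2) \<le> C"
    and close: "(\<lambda>n. expectation (\<lambda>w. (b n w - a n w)\<^sup>2)) \<longlonglongrightarrow> 0"
    and p: "1 \<le> p" "p \<le> 2"
  shows "(\<lambda>n. expectation (\<lambda>w. \<bar>b n w\<bar> powr p) - expectation (\<lambda>w. \<bar>a n w\<bar> powr p)) \<longlonglongrightarrow> 0"
proof -
  note [measurable] = meas
  define d where "d n = expectation (\<lambda>w. (b n w - a n w)\<^sup>2)" for n
  have int_d: "integrable M (\<lambda>w. (b n w - a n w)\<^sup>2)" for n
    by (intro integrable_power2_diff meas int)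
  have int_p: "integrable M (\<lambda>w. \<bar>a n w\<bar> powr p)" "integrable M (\<lambda>w. \<bar>b n w\<bar> powr p)" for n
    by (rule Bochner_Integration.integrable_bound[where f="\<lambda>w. 1 + (a n w)\<^sup>2"], use int abs_powr_le[OF p] in auto)
      (rule Bochner_Integration.integrable_bound[where f="\<lambda>w. 1 + (b n w)\<^sup>2"], use int abs_powr_le[OF p] in auto)
  have C0: "0 \<le> C" by (rule order_trans[OF _ a_bd]) simp
  have "(\<lambda>n. \<bar>expectation (\<lambda>w. \<bar>b n w\<bar> powr p) - expectation (\<lambda>w. \<bar>a n w\<bar> powr p)\<bar>) \<longlonglongrightarrow> 0"
  proof (rule tendsto_0_tradeoff[where q = "\<lambda>\<eta> n. d n / \<eta> + 3 * \<eta> * d n" and c = "3 * (1 + 4 * C)"])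
    fix \<eta> :: real and n assume \<eta>: "0 < \<eta>"
    have pw: "\<bar>\<bar>y\<bar> powr p - \<bar>x\<bar> powr p\<bar> \<le> (y - x)\<^sup>2 / \<eta> + 3 * \<eta> * (1 + 4 * x\<^sup>2 + (y - x)\<^sup>2)" for x y :: real
    proof -
      define u v where "u = \<bar>y - x\<bar>" and "v = 1 + \<bar>x\<bar> + \<bar>y\<bar>"
      have "\<bar>\<bar>y\<bar> powr p - \<bar>x\<bar> powr p\<bar> \<le> 2 * u * v" unfolding u_def v_def by (rule abs_powr_diff_le[OF p])
      \<comment> \<open>Young's inequality, from the nonnegativity of
        \<open>(u - \<eta> * v)^2 / \<eta>\<close>. The factor 3 below comes from the square of a
        sum of three terms.\<close>
      also have "2 * u * v \<le> u\<^sup>2 / \<eta> + \<eta> * v\<^sup>2"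
      proof -
        have "0 \<le> (u - \<eta> * v)\<^sup>2 / \<eta>" using \<eta> by simp
        also have "\<dots> = u\<^sup>2 / \<eta> - 2 * u * v + \<eta> * v\<^sup>2" using \<eta> by (simp add: power2_eq_square field_simps)
        finally show ?thesis by simp
      qed
      also have "\<dots> \<le> u\<^sup>2 / \<eta> + \<eta> * (3 * (1 + 4 * x\<^sup>2 + u\<^sup>2))"
      proof -
        have "v \<le> 1 + 2 * \<bar>x\<bar> + u" "0 \<le> v" unfolding u_def v_def by auto
        then have "v\<^sup>2 \<le> (1 + 2 * \<bar>x\<bar> + u)\<^sup>2" by (intro power_mono)
        also have "\<dots> \<le> 3 * (1 + (2 * \<bar>x\<bar>)\<^sup>2 + u\<^sup>2)"
          using zero_le_power2[of "1 - 2 * \<bar>x\<bar>"] zero_le_power2[of "1 - u"] zero_le_power2[of "2 * \<bar>x\<bar> - u"]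
          by (simp add: power2_eq_square algebra_simps)
        finally have "v\<^sup>2 \<le> 3 * (1 + 4 * x\<^sup>2 + u\<^sup>2)" by (simp add: power_mult_distrib)
        then show ?thesis using \<eta> by simp
      qed
      also have "\<dots> = (y - x)\<^sup>2 / \<eta> + 3 * \<eta> * (1 + 4 * x\<^sup>2 + (y - x)\<^sup>2)"
        unfolding u_def power2_abs by (simp only: mult_ac)
      finally show ?thesis .
    qed
    have "\<bar>expectation (\<lambda>w. \<bar>b n w\<bar> powr p) - expectation (\<lambda>w. \<bar>a n w\<bar> powr p)\<bar>
      = \<bar>expectation (\<lambda>w. \<bar>b n w\<bar> powr p - \<bar>a n w\<bar> powr p)\<bar>" using int_p by simp
    also have "\<dots> \<le> expectation (\<lambda>w. \<bar>\<bar>b n w\<bar> powr p - \<bar>a n w\<bar> powr p\<bar>)" by (rule integral_abs_bound)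
    also have "\<dots> \<le> expectation (\<lambda>w. (b n w - a n w)\<^sup>2 / \<eta> + 3 * \<eta> * (1 + 4 * (a n w)\<^sup>2 + (b n w - a n w)\<^sup>2))"
      using int_p int_d int pw by (intro integral_mono) auto
    also have "\<dots> = d n / \<eta> + 3 * \<eta> * (1 + 4 * expectation (\<lambda>w. (a n w)\<^sup>2) + d n)"
      using int_d int by (simp add: d_def prob_space)
    also have "\<dots> \<le> d n / \<eta> + 3 * \<eta> * (1 + 4 * C + d n)"
      using a_bd[of n] \<eta> by simp
    finally show "\<bar>expectation (\<lambda>w. \<bar>b n w\<bar> powr p) - expectation (\<lambda>w. \<bar>a n w\<bar> powr p)\<bar> \<le>
      d n / \<eta> + 3 * \<eta> * d n + 3 * (1 + 4 * C) * \<eta>" by (simp add: algebra_simps)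
  next
    fix \<eta> :: real assume "0 < \<eta>"
    then have "(\<lambda>n. d n / \<eta> + 3 * \<eta> * d n) \<longlonglongrightarrow> 0 / \<eta> + 3 * \<eta> * 0"
      using close unfolding d_def by (intro tendsto_intros) auto
    then show "(\<lambda>n. d n / \<eta> + 3 * \<eta> * d n) \<longlonglongrightarrow> 0" by simp
  qed (use C0 in auto)
  then show ?thesis by (rule tendsto_rabs_zero_cancel)
qed

section \<open>The central limit theorem for centred squares of independent normal variables\<close>

abbreviation std_normal_sequence :: "(nat \<Rightarrow> real) measure" where
  "std_normal_sequence \<equiv> Pi\<^sub>M UNIV (\<lambda>_. std_normal_distribution)"

lemma prob_space_std_normal: "prob_space std_normal_distribution"
  by (rule real_distribution.axioms(1)[OF real_dist_normal_dist])

lemma prob_space_std_normal_sequence: "prob_space std_normal_sequence"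
  by (intro prob_space_PiM prob_space_std_normal)

lemma std_normal_sequence_measurable: "(\<lambda>w. w i) \<in> borel_measurable std_normal_sequence"
  by (rule measurable_compose[OF measurable_component_singleton[of i]]) auto

lemma std_normal_sequence_indep_vars:
  "prob_space.indep_vars std_normal_sequence (\<lambda>_. borel) (\<lambda>i w. w i) UNIV"
proof -
  interpret prob_space std_normal_sequence by (rule prob_space_std_normal_sequence)
  have "indep_vars (\<lambda>_. std_normal_distribution) (\<lambda>i w. w i) UNIV"
  proof (subst indep_vars_iff_distr_eq_PiM)
    have "distr std_normal_sequence std_normal_sequence (\<lambda>x. \<lambda>i\<in>UNIV. x i) = std_normal_sequence"
      by (simp add: restrict_def distr_id)
    also have "\<dots> = Pi\<^sub>M UNIV (\<lambda>i. distr std_normal_sequence std_normal_distribution (\<lambda>w. w i))"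
      by (intro PiM_cong refl distr_PiM_component[symmetric] prob_space_std_normal) auto
    finally show "distr std_normal_sequence std_normal_sequence (\<lambda>x. \<lambda>i\<in>UNIV. x i) =
      Pi\<^sub>M UNIV (\<lambda>i. distr std_normal_sequence std_normal_distribution (\<lambda>w. w i))" .
  qed auto
  from indep_vars_compose2[OF this, of "\<lambda>_ x. x" "\<lambda>_. borel"] show ?thesis by simp
qed

lemma std_normal_sequence_distr:
  assumes "f \<in> borel_measurable borel"
  shows "distr std_normal_sequence borel (\<lambda>w. f (w i)) = distr std_normal_distribution borel f"
proof -
  have "distr std_normal_distribution borel f =
    distr (distr std_normal_sequence std_normal_distribution (\<lambda>w. w i)) borel f"
    by (subst distr_PiM_component) (auto intro: prob_space_std_normal)
  also have "\<dots> = distr std_normal_sequence borel (\<lambda>w. f (w i))"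
    using assms by (subst distr_distr) (auto simp: comp_def)
  finally show ?thesis by simp
qed

lemma std_normal_distribution_moments:
  "integrable std_normal_distribution (\<lambda>x. x ^ k)"
  "(\<integral>x. x\<^sup>2 \<partial>std_normal_distribution) = 1" "(\<integral>x. x ^ 4 \<partial>std_normal_distribution) = 3"
  using integrable_std_normal_distribution_moment[of k]
    std_normal_distribution_even_moments[of 1] std_normal_distribution_even_moments[of 2]
  by (auto simp: fact_numeral)

text \<open>Normalized to variance 1 for \<open>K > 0\<close>: the centred square of a standard
  normal variable has variance 2, written \<open>(sqrt 2)^2\<close> to fit the normalization in the
  central limit theorem.\<close>

abbreviation chi_square_mean :: "nat \<Rightarrow> (nat \<Rightarrow> real) \<Rightarrow> real" where
  "chi_square_mean K \<equiv> \<lambda>w. (\<Sum>i<K. (w i)\<^sup>2 - 1) / sqrt (real K * (sqrt 2)\<^sup>2)"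

lemma centered_chi_square_clt:
  "weak_conv_m (\<lambda>K. distr std_normal_sequence borel (chi_square_mean K)) std_normal_distribution"
proof -
  interpret prob_space std_normal_sequence by (rule prob_space_std_normal_sequence)
  interpret N: real_distribution std_normal_distribution by (rule real_dist_normal_dist)
  have d: "distr std_normal_sequence borel (\<lambda>w. w i) = std_normal_distribution" for i
    using std_normal_sequence_distr[of "\<lambda>x. x" i] by (simp add: distr_id2)
  have tr: "integrable std_normal_sequence (\<lambda>w. f (w i)) \<longleftrightarrow> integrable std_normal_distribution f"
    "expectation (\<lambda>w. f (w i)) = (\<integral>x. f x \<partial>std_normal_distribution)"
    if "f \<in> borel_measurable borel" for f :: "real \<Rightarrow> real" and i
    using integrable_distr_eq[OF std_normal_sequence_measurable that, of i]
      integral_distr[OF std_normal_sequence_measurable that, of i] by (simp_all add: d)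
  note mom = std_normal_distribution_moments
  have sq: "(x\<^sup>2 - 1)\<^sup>2 = x ^ 4 - 2 * x\<^sup>2 + 1" for x :: real
    by (simp add: power2_eq_square power4_eq_xxxx algebra_simps)
  have i2: "integrable std_normal_distribution (\<lambda>x. (x\<^sup>2 - 1)\<^sup>2)"
    and e2: "(\<integral>x. (x\<^sup>2 - 1)\<^sup>2 \<partial>std_normal_distribution) = 2"
    and e1: "(\<integral>x. x\<^sup>2 - 1 \<partial>std_normal_distribution) = 0"
    unfolding sq using mom(1)[of 2] mom(1)[of 4] mom(2,3) N.prob_space by simp_all
  show ?thesis
  proof (rule central_limit_theorem_zero_mean)
    show "indep_vars (\<lambda>i. borel) (\<lambda>i w. (w i)\<^sup>2 - 1) UNIV"
      by (rule indep_vars_compose2[OF std_normal_sequence_indep_vars]) measurable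
    show "expectation (\<lambda>w. (w n)\<^sup>2 - 1) = 0" for n
      using tr(2)[of "\<lambda>x. x\<^sup>2 - 1" n] e1 by simp
    then show "variance (\<lambda>w. (w n)\<^sup>2 - 1) = (sqrt 2)\<^sup>2" for n
      using tr(2)[of "\<lambda>x. (x\<^sup>2 - 1)\<^sup>2" n] e2 by simp
    show "integrable std_normal_sequence (\<lambda>w. ((w n)\<^sup>2 - 1)\<^sup>2)" for n
      using tr(1)[of "\<lambda>x. (x\<^sup>2 - 1)\<^sup>2" n] i2 by simp
    show "distr std_normal_sequence borel (\<lambda>w. (w n)\<^sup>2 - 1) = distr std_normal_distribution borel (\<lambda>x. x\<^sup>2 - 1)" for n
      by (rule std_normal_sequence_distr) measurable
  qed simp
qed

section \<open>Transfer to Brownian increments and the limit of the error\<close>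

context brownian_motion_space
begin

lemma increment_square_distr:
  assumes s: "0 \<le> s" "s < t"
  shows "distr M borel (\<lambda>w. (W t w - W s w)\<^sup>2 - (t - s))
    = distr std_normal_distribution borel (\<lambda>x. (t - s) * (x\<^sup>2 - 1))"
proof -
  let ?X = "\<lambda>w. (W t w - W s w) / sqrt (t - s)"
  have st: "0 < sqrt (t - s)" using s by simp
  have d: "distributed M lborel ?X std_normal_density"
    using increment_distributed[OF s] normal_standard_normal_convert[OF st, of "\<lambda>w. W t w - W s w" 0] by simp
  have X: "?X \<in> borel_measurable M"
    using measurable_F_M[OF increment_measurable[of s t]] s by simp
  have "distr M borel ?X = std_normal_distribution"
    using distributed_distr_eq_density[OF d] by (simp cong: distr_cong)
  then have "distr std_normal_distribution borel (\<lambda>x. (t - s) * (x\<^sup>2 - 1)) =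
      distr (distr M borel ?X) borel (\<lambda>x. (t - s) * (x\<^sup>2 - 1))" by simp
  also have "\<dots> = distr M borel (\<lambda>w. (t - s) * ((?X w)\<^sup>2 - 1))"
    using X by (subst distr_distr) (auto simp: comp_def)
  also have "(\<lambda>w. (t - s) * ((?X w)\<^sup>2 - 1)) = (\<lambda>w. (W t w - W s w)\<^sup>2 - (t - s))"
    using s by (simp add: power_divide right_diff_distrib)
  finally show ?thesis by simp
qed

text \<open>Both characteristic functions are the \<open>K\<close>-th power of that of one summand,
  and Levy's uniqueness theorem applies. On the Brownian side the last increment is split off, being
  independent of the partial sum before it.\<close>

lemma quadratic_sum_distr:
  assumes \<delta>: "0 < \<delta>"
  shows "distr M borel (\<lambda>w. \<Sum>i<K. (W (real (Suc i) * \<delta>) w - W (real i * \<delta>) w)\<^sup>2 - \<delta>)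
    = distr std_normal_sequence borel (\<lambda>w. \<Sum>i<K. \<delta> * ((w i)\<^sup>2 - 1))"
proof -
  interpret P: prob_space std_normal_sequence by (rule prob_space_std_normal_sequence)
  define g where "g i = real i * \<delta>" for i
  define Q where "Q i w = (W (g (Suc i)) w - W (g i) w)\<^sup>2 - \<delta>" for i w
  have g: "0 \<le> g i" "g i < g (Suc i)" "g (Suc i) - g i = \<delta>" for i
    using \<delta> by (auto simp: g_def distrib_right)
  have g_mono: "g i \<le> g j" if "i \<le> j" for i j using that \<delta> by (simp add: g_def mult_right_mono)
  have QF: "Q i \<in> borel_measurable (F (g (Suc i)))" for i
    unfolding Q_def[abs_def]
    by (intro borel_arith_measurable)
      (auto intro!: W_measurable measurable_F_mono[OF W_measurable] g less_imp_le[OF g(2)])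
  have sumF: "(\<lambda>w. \<Sum>i<K. Q i w) \<in> borel_measurable (F (g K))" for K
    by (intro borel_measurable_sum measurable_F_mono[OF QF] g_mono) auto
  define \<mu> where "\<mu> = distr std_normal_distribution borel (\<lambda>x. \<delta> * (x\<^sup>2 - 1))"
  have Q_distr: "distr M borel (Q i) = \<mu>" for i
    using increment_square_distr[OF g(1,2), of i] unfolding Q_def[abs_def] g(3) \<mu>_def .
  have 1: "char (distr M borel (\<lambda>w. \<Sum>i<K. Q i w)) u = char \<mu> u ^ K" for u
  proof (induction K)
    case 0
    then show ?case by (simp add: char_def integral_distr prob_space del: distr_const)
  next
    case (Suc K)
    have "indep_var borel (id \<circ> (\<lambda>w. \<Sum>i<K. Q i w)) borel ((\<lambda>x. x\<^sup>2 - \<delta>) \<circ> (\<lambda>w. W (g (Suc K)) w - W (g K) w))"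
      by (rule indep_var_compose[OF increment_indep_var[OF g(1,2) sumF]]) auto
    then have "indep_var borel (\<lambda>w. \<Sum>i<K. Q i w) borel (Q K)"
      by (simp add: comp_def Q_def[abs_def])
    from char_distr_add[OF this, of u] Suc show ?case by (simp add: Q_distr)
  qed
  have 2: "char (distr std_normal_sequence borel (\<lambda>w. \<Sum>i<K. \<delta> * ((w i)\<^sup>2 - 1))) u = char \<mu> u ^ K" for u
  proof -
    have "P.indep_vars (\<lambda>i. borel) (\<lambda>i w. \<delta> * ((w i)\<^sup>2 - 1)) {..<K}"
      by (rule P.indep_vars_subset[OF P.indep_vars_compose2[OF std_normal_sequence_indep_vars]]) measurable
    from P.char_distr_sum[OF this, of u] show ?thesis
      using std_normal_sequence_distr[of "\<lambda>x. \<delta> * (x\<^sup>2 - 1)"] by (simp add: \<mu>_def)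
  qed
  have meas: "(\<lambda>w. \<Sum>i<K. \<delta> * ((w i)\<^sup>2 - 1)) \<in> borel_measurable std_normal_sequence"
    by (intro borel_arith_measurable std_normal_sequence_measurable)
  have "distr M borel (\<lambda>w. \<Sum>i<K. Q i w) = distr std_normal_sequence borel (\<lambda>w. \<Sum>i<K. \<delta> * ((w i)\<^sup>2 - 1))"
    by (rule Levy_uniqueness) (use 1 2 meas measurable_F_M[OF sumF] in auto)
  then show ?thesis by (simp add: Q_def g_def)
qed

text \<open>The factor \<open>\<delta> * sqrt (2 * real K)\<close> is the standard deviation of the
  sum, since each of its \<open>K\<close> terms has variance \<open>2 \<delta>^2\<close>.\<close>

lemma quadratic_sum_abs_moment:
  assumes \<delta>: "0 < \<delta>"
  shows "expectation (\<lambda>w. \<bar>\<Sum>i<K. (W (real (Suc i) * \<delta>) w - W (real i * \<delta>) w)\<^sup>2 - \<delta>\<bar> powr p)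
    = (\<delta> * sqrt (2 * real K)) powr p * (\<integral>x. \<bar>x\<bar> powr p \<partial>distr std_normal_sequence borel (chi_square_mean K))"
proof -
  let ?S = "\<lambda>w. \<Sum>i<K. (W (real (Suc i) * \<delta>) w - W (real i * \<delta>) w)\<^sup>2 - \<delta>"
  let ?V = "\<lambda>w. chi_square_mean K w"
  note [measurable] = std_normal_sequence_measurable
  have W: "W (real i * \<delta>) \<in> borel_measurable M" for i
    by (rule measurable_F_M[OF W_measurable]) (use \<delta> in simp)
  note [measurable] = W W[of "Suc _"]
  have S: "?S \<in> borel_measurable M" by measurable
  have V: "?V \<in> borel_measurable std_normal_sequence"
    by (intro borel_arith_measurable std_normal_sequence_measurable)
  have S': "(\<lambda>w. \<Sum>i<K. \<delta> * ((w i)\<^sup>2 - 1)) \<in> borel_measurable std_normal_sequence"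
    by (intro borel_arith_measurable std_normal_sequence_measurable)
  have f: "(\<lambda>x::real. \<bar>x\<bar> powr p) \<in> borel_measurable borel" by measurable
  have eq: "\<bar>\<Sum>i<K. \<delta> * ((w i)\<^sup>2 - 1)\<bar> powr p = (\<delta> * sqrt (2 * real K)) powr p * \<bar>?V w\<bar> powr p" for w :: "nat \<Rightarrow> real"
  proof (cases "K = 0")
    case False
    then have "(\<Sum>i<K. \<delta> * ((w i)\<^sup>2 - 1)) = \<delta> * sqrt (2 * real K) * ?V w"
      by (simp add: sum_distrib_left[symmetric] mult.commute)
    then have "\<bar>\<Sum>i<K. \<delta> * ((w i)\<^sup>2 - 1)\<bar> = \<bar>\<delta> * sqrt (2 * real K)\<bar> * \<bar>?V w\<bar>"
      by (simp only: abs_mult)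
    also have "\<bar>\<delta> * sqrt (2 * real K)\<bar> = \<delta> * sqrt (2 * real K)" using \<delta> by simp
    finally show ?thesis using \<delta> powr_mult[of "\<delta> * sqrt (2 * real K)" "\<bar>?V w\<bar>" p]
      by (simp only:)
  qed simp
  have "expectation (\<lambda>w. \<bar>?S w\<bar> powr p) = (\<integral>x. \<bar>x\<bar> powr p \<partial>distr M borel ?S)"
    by (rule integral_distr[OF S f, symmetric])
  also have "\<dots> = (\<integral>w. \<bar>\<Sum>i<K. \<delta> * ((w i)\<^sup>2 - 1)\<bar> powr p \<partial>std_normal_sequence)"
    unfolding quadratic_sum_distr[OF \<delta>] by (rule integral_distr[OF S' f])
  also have "\<dots> = (\<delta> * sqrt (2 * real K)) powr p * (\<integral>w. \<bar>?V w\<bar> powr p \<partial>std_normal_sequence)"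
    unfolding eq by simp
  also have "(\<integral>w. \<bar>?V w\<bar> powr p \<partial>std_normal_sequence) = (\<integral>x. \<bar>x\<bar> powr p \<partial>distr std_normal_sequence borel ?V)"
    by (rule integral_distr[OF V f, symmetric])
  finally show ?thesis .
qed

text \<open>The argument runs over \<open>Suc K\<close>, because for \<open>K = 0\<close> the
  normalized sum is 0 and its second moment is not 1.\<close>

lemma centered_chi_square_abs_moment:
  assumes p: "1 \<le> p" "p \<le> 2"
  shows "(\<lambda>K. \<integral>x. \<bar>x\<bar> powr p \<partial>distr std_normal_sequence borel (chi_square_mean K))
    \<longlonglongrightarrow> (\<integral>x. \<bar>x\<bar> powr p \<partial>std_normal_distribution)"
proof -
  interpret P: prob_space std_normal_sequence by (rule prob_space_std_normal_sequence)
  let ?V = "\<lambda>K w. chi_square_mean K w"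
  let ?D = "\<lambda>K. distr std_normal_sequence borel (?V K)"
  have V: "?V K \<in> borel_measurable std_normal_sequence" for K
    by (intro borel_arith_measurable std_normal_sequence_measurable)
  have mom: "integrable (?D (Suc K)) (\<lambda>x. x\<^sup>2)" "(\<integral>x. x\<^sup>2 \<partial>?D (Suc K)) = 1" for K
  proof -
    \<comment> \<open>The second moment is imported from Brownian motion on the integer grid, where
      the sum has the same law and its second moment is already known.\<close>
    let ?S = "\<lambda>w. \<Sum>i<Suc K. (W (real (Suc i) * 1) w - W (real i * 1) w)\<^sup>2 - 1"
    have m: "mono (\<lambda>i. real i * 1)" by (auto simp: mono_def)
    have S: "integrable M (\<lambda>w. (?S w)\<^sup>2)" "expectation (\<lambda>w. (?S w)\<^sup>2) = 2 * real (Suc K)"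
      using euler_norm_second_moment_bound(2,3)[OF m, of "Suc K"] by (simp_all del: sum.lessThan_Suc)
    have W: "W (real i * 1) \<in> borel_measurable M" for i
      by (rule measurable_F_M[OF W_measurable]) simp
    have S_meas: "?S \<in> borel_measurable M"
      by (intro borel_arith_measurable W)
    have f: "(\<lambda>x::real. x\<^sup>2) \<in> borel_measurable borel" by measurable
    have S': "(\<lambda>w. \<Sum>i<Suc K. 1 * ((w i)\<^sup>2 - 1)) \<in> borel_measurable std_normal_sequence"
      by (intro borel_arith_measurable std_normal_sequence_measurable)
    have eq: "(?V (Suc K) w)\<^sup>2 = (\<Sum>i<Suc K. 1 * ((w i)\<^sup>2 - 1))\<^sup>2 / (2 * real (Suc K))" for w
      by (simp add: power_divide mult.commute del: sum.lessThan_Suc)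
    have "integrable (distr M borel ?S) (\<lambda>x. x\<^sup>2)" "(\<integral>x. x\<^sup>2 \<partial>distr M borel ?S) = 2 * real (Suc K)"
      using S integrable_distr_eq[OF S_meas f] integral_distr[OF S_meas f] by simp_all
    then have "integrable std_normal_sequence (\<lambda>w. (\<Sum>i<Suc K. 1 * ((w i)\<^sup>2 - 1))\<^sup>2)"
      "P.expectation (\<lambda>w. (\<Sum>i<Suc K. 1 * ((w i)\<^sup>2 - 1))\<^sup>2) = 2 * real (Suc K)"
      unfolding quadratic_sum_distr[OF zero_less_one]
      using integrable_distr_eq[OF S' f] integral_distr[OF S' f] by simp_all
    then show "integrable (?D (Suc K)) (\<lambda>x. x\<^sup>2)" "(\<integral>x. x\<^sup>2 \<partial>?D (Suc K)) = 1"
      unfolding integrable_distr_eq[OF V f] integral_distr[OF V f] eq by simp_all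
  qed
  have conv: "weak_conv_m (\<lambda>K. ?D (Suc K)) std_normal_distribution"
    using centered_chi_square_clt LIMSEQ_Suc unfolding weak_conv_m_def weak_conv_def by fastforce
  have "(\<lambda>K. \<integral>x. \<bar>x\<bar> powr p \<partial>?D (Suc K)) \<longlonglongrightarrow> (\<integral>x. \<bar>x\<bar> powr p \<partial>std_normal_distribution)"
  proof (rule weak_conv_abs_moment[OF _ real_dist_normal_dist conv _ _ _ p])
    show "real_distribution (?D (Suc K))" for K using V by simp
    show "(\<lambda>n. \<integral>x. x\<^sup>2 \<partial>?D (Suc n)) \<longlonglongrightarrow> (\<integral>x. x\<^sup>2 \<partial>std_normal_distribution)"
      unfolding mom(2) std_normal_distribution_moments(2) by simp
  qed (use mom(1) std_normal_distribution_moments(1)[of 2] in auto)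
  then show ?thesis by (rule LIMSEQ_imp_Suc)
qed

text \<open>There are \<open>K n\<close> full steps before \<open>t\<close> and one more of length
  between 0 and \<open>\<delta> n\<close>, hence \<open>Suc (K n)\<close> factors. Two replacements
  lead from \<open>R - 1\<close> to a sum of \<open>K n\<close> identically distributed terms:
  linearization of the product, and omission of the last step. Scaled by \<open>sqrt n\<close>, both
  disappear in L2.\<close>

lemma euler_norm_error_limit:
  fixes T t p :: real
  assumes T: "0 < T" and t: "0 \<le> t" and p: "1 \<le> p" "p \<le> 2"
  defines "\<delta> \<equiv> \<lambda>n. T / real (Suc n)"
  defines "\<sigma> \<equiv> \<lambda>n k. min t (real k * \<delta> n)" and "K \<equiv> \<lambda>n. nat \<lfloor>t / \<delta> n\<rfloor>"
  defines "R \<equiv> \<lambda>n w. \<Prod>i<Suc (K n). (1 - (\<sigma> n (Suc i) - \<sigma> n i) / 2)\<^sup>2 + (W (\<sigma> n (Suc i)) w - W (\<sigma> n i) w)\<^sup>2"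
  shows "(\<lambda>n. real (Suc n) powr (p / 2) * expectation (\<lambda>w. \<bar>R n w - 1\<bar> powr p))
    \<longlonglongrightarrow> (2 * T * t) powr (p / 2) * (\<integral>x. \<bar>x\<bar> powr p \<partial>std_normal_distribution)"
proof -
  have \<delta>: "0 < \<delta> n" for n using T by (simp add: \<delta>_def)
  have N\<delta>: "real (Suc n) * \<delta> n = T" for n by (simp add: \<delta>_def)
  have \<delta>_lim: "\<delta> \<longlonglongrightarrow> 0" unfolding \<delta>_def using LIMSEQ_Suc[OF lim_const_over_n[of T]] by simp
  have K: "real (K n) * \<delta> n \<le> t" "t < real (Suc (K n)) * \<delta> n" for n
  proof -
    have "0 \<le> t / \<delta> n" using t \<delta>[of n] by simp
    then have "real (K n) \<le> t / \<delta> n" "t / \<delta> n < real (K n) + 1"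
      unfolding K_def by linarith+
    then show "real (K n) * \<delta> n \<le> t" "t < real (Suc (K n)) * \<delta> n"
      using \<delta>[of n] by (simp_all add: field_simps)
  qed
  have \<sigma>_mono: "mono (\<sigma> n)" for n
    using \<delta>[of n] by (intro monoI) (simp only: \<sigma>_def, intro min.mono mult_right_mono, auto)
  have \<sigma>0: "\<sigma> n 0 = 0" "\<sigma> n (Suc (K n)) = t" for n using t K[of n] by (auto simp: \<sigma>_def)
  have \<sigma>_grid: "\<sigma> n i = real i * \<delta> n" if "i \<le> K n" for n i
  proof -
    have "real i * \<delta> n \<le> real (K n) * \<delta> n" using that \<delta>[of n] by (intro mult_right_mono) auto
    then show ?thesis using K(1)[of n] by (simp add: \<sigma>_def)
  qed
  define h where "h n i = \<sigma> n (Suc i) - \<sigma> n i" for n i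
  have \<sigma>_nn: "0 \<le> \<sigma> n i" for n i using t \<delta>[of n] by (simp add: \<sigma>_def)
  have \<sigma>_le: "\<sigma> n i \<le> \<sigma> n (Suc i)" for n i by (rule monoD[OF \<sigma>_mono]) simp
  have h: "0 \<le> h n i" "h n i \<le> \<delta> n" for n i
    using \<sigma>_le[of n i] \<delta>[of n] by (auto simp: h_def \<sigma>_def distrib_right)
  define D where "D n i w = W (\<sigma> n (Suc i)) w - W (\<sigma> n i) w" for n i w
  define S where "S n w = (\<Sum>i<Suc (K n). (D n i w)\<^sup>2 - h n i)" for n w
  define S0 where "S0 n w = (\<Sum>i<K n. (W (real (Suc i) * \<delta> n) w - W (real i * \<delta> n) w)\<^sup>2 - \<delta> n)" for n w
  \<comment> \<open>The contribution of the last, possibly shorter step from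
    \<open>real (K n) * \<delta> n\<close> to \<open>t\<close>.\<close>
  define z where "z n w = (D n (K n) w)\<^sup>2 - h n (K n)" for n w
  define q where "q n = (\<Sum>i<Suc (K n). (h n i)\<^sup>2)" for n
  have W_meas[measurable]: "W (\<sigma> n i) \<in> borel_measurable M" for n i
    by (rule measurable_F_M[OF W_measurable[OF \<sigma>_nn]])
  have Wg_meas[measurable]: "W (real i * \<delta> n) \<in> borel_measurable M" for n i
    by (rule measurable_F_M[OF W_measurable]) (use \<delta>[of n] in simp)
  have R_meas[measurable]: "R n \<in> borel_measurable M" for n unfolding R_def by measurable
  have z_meas[measurable]: "z n \<in> borel_measurable M" for n unfolding z_def[abs_def] D_def by measurable
  have S_meas[measurable]: "S n \<in> borel_measurable M" for n unfolding S_def[abs_def] D_def by measurable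
  have S0_meas[measurable]: "S0 n \<in> borel_measurable M" for n
    unfolding S0_def[abs_def]
    by (intro borel_arith_measurable Wg_meas)
  have S_eq: "S n w = S0 n w + z n w" for n w
  proof -
    have "(\<Sum>i<K n. (D n i w)\<^sup>2 - h n i) = S0 n w"
      unfolding S0_def
    proof (intro sum.cong refl)
      fix i assume "i \<in> {..<K n}"
      then have "\<sigma> n i = real i * \<delta> n" "\<sigma> n (Suc i) = real (Suc i) * \<delta> n"
        using \<sigma>_grid[of i n] \<sigma>_grid[of "Suc i" n] by simp_all
      then show "(D n i w)\<^sup>2 - h n i = (W (real (Suc i) * \<delta> n) w - W (real i * \<delta> n) w)\<^sup>2 - \<delta> n"
        by (simp add: D_def h_def distrib_right)
    qed
    then show ?thesis by (simp add: S_def z_def)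
  qed
  have q_le: "q n \<le> \<delta> n * t" for n
  proof -
    have "q n \<le> (\<Sum>i<Suc (K n). \<delta> n * h n i)"
      unfolding q_def power2_eq_square by (intro sum_mono mult_right_mono h)
    also have "\<dots> = \<delta> n * (\<sigma> n (Suc (K n)) - \<sigma> n 0)"
      unfolding h_def sum_distrib_left[symmetric] sum_lessThan_telescope ..
    finally show ?thesis by (simp only: \<sigma>0) simp
  qed
  have q0: "0 \<le> q n" for n unfolding q_def by (intro sum_nonneg) simp
  have RS: "integrable M (\<lambda>w. (R n w)\<^sup>2)" "integrable M (\<lambda>w. (S n w)\<^sup>2)"
    "q n \<le> 1 / 3 \<Longrightarrow> expectation (\<lambda>w. (R n w - 1 - S n w)\<^sup>2) \<le> 10 * (q n)\<^sup>2" for n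
    unfolding R_def S_def D_def h_def q_def
    by (rule euler_norm_second_moment_bound(1,2,4)[OF \<sigma>_mono \<sigma>_nn]; assumption)+
  have grid_mono: "mono (\<lambda>i. real i * \<delta> n)" for n
    using \<delta>[of n] by (intro monoI mult_right_mono) auto
  have S0_int: "integrable M (\<lambda>w. (S0 n w)\<^sup>2)" and S0_E: "expectation (\<lambda>w. (S0 n w)\<^sup>2) = 2 * (real (K n) * (\<delta> n)\<^sup>2)" for n
  proof -
    have d: "real (Suc i) * \<delta> n - real i * \<delta> n = \<delta> n" for i by (simp add: distrib_right)
    show "integrable M (\<lambda>w. (S0 n w)\<^sup>2)" "expectation (\<lambda>w. (S0 n w)\<^sup>2) = 2 * (real (K n) * (\<delta> n)\<^sup>2)"
      using euler_norm_second_moment_bound(2,3)[OF grid_mono, of n "K n"] unfolding d S0_def by simp_all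
  qed
  define b where "b n w = sqrt (real (Suc n)) * (R n w - 1)" for n w
  define a where "a n w = sqrt (real (Suc n)) * S0 n w" for n w
  have R1_int: "integrable M (\<lambda>w. (R n w - 1)\<^sup>2)" for n
    by (intro integrable_power2_diff RS) auto
  have a_int: "integrable M (\<lambda>w. (a n w)\<^sup>2)" and b_int: "integrable M (\<lambda>w. (b n w)\<^sup>2)" for n
    unfolding a_def b_def power_mult_distrib using S0_int R1_int by auto
  have a_meas: "a n \<in> borel_measurable M" and b_meas: "b n \<in> borel_measurable M" for n
    unfolding a_def[abs_def] b_def[abs_def] by measurable
  have a_bd: "expectation (\<lambda>w. (a n w)\<^sup>2) \<le> 2 * T * t" for n
  proof -
    have "expectation (\<lambda>w. (a n w)\<^sup>2) = 2 * (real (Suc n) * \<delta> n) * (real (K n) * \<delta> n)"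
      unfolding a_def power_mult_distrib by (simp add: S0_E power2_eq_square[of "\<delta> n"])
    also have "\<dots> \<le> 2 * T * t" unfolding N\<delta> using K(1)[of n] T by simp
    finally show ?thesis .
  qed
  have close: "(\<lambda>n. expectation (\<lambda>w. (b n w - a n w)\<^sup>2)) \<longlonglongrightarrow> 0"
  proof (rule tendsto_sandwich[OF _ _ tendsto_const])
    \<comment> \<open>Linearization costs \<open>10 (\<delta> t)^2\<close> and the last step
      \<open>2 \<delta>^2\<close>. Both are doubled by the estimate for the square of a sum and
      multiplied by the number \<open>Suc n\<close>, where
      \<open>Suc n * \<delta> n = T\<close>.\<close>
    have "(\<lambda>n. (20 * T * t\<^sup>2 + 4 * T) * \<delta> n) \<longlonglongrightarrow> (20 * T * t\<^sup>2 + 4 * T) * 0"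
      by (intro tendsto_intros \<delta>_lim)
    then show "(\<lambda>n. (20 * T * t\<^sup>2 + 4 * T) * \<delta> n) \<longlonglongrightarrow> 0" by simp
    have "(\<lambda>n. \<delta> n * t) \<longlonglongrightarrow> 0 * t" by (intro tendsto_intros \<delta>_lim)
    then have "eventually (\<lambda>n. \<delta> n * t < 1 / 3) sequentially" by (rule order_tendstoD(2)) simp
    then show "eventually (\<lambda>n. expectation (\<lambda>w. (b n w - a n w)\<^sup>2) \<le> (20 * T * t\<^sup>2 + 4 * T) * \<delta> n) sequentially"
    proof eventually_elim
      case (elim n)
      have q3: "q n \<le> 1 / 3" using elim q_le[of n] by simp
      have z_mom: "integrable M (\<lambda>w. (z n w)\<^sup>2)" "expectation (\<lambda>w. (z n w)\<^sup>2) = 2 * (h n (K n))\<^sup>2"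
        unfolding z_def D_def h_def
        by (intro centered_square_integrable_power2 centered_square_expectation_power2 \<sigma>_nn \<sigma>_le)+
      have RS_int: "integrable M (\<lambda>w. (R n w - 1 - S n w)\<^sup>2)"
        by (intro integrable_power2_diff R1_int RS) auto
      have sq: "(x + y)\<^sup>2 \<le> 2 * x\<^sup>2 + 2 * y\<^sup>2" for x y :: real
        using zero_le_power2[of "x - y"] by (simp add: power2_eq_square algebra_simps)
      have "expectation (\<lambda>w. (b n w - a n w)\<^sup>2) = real (Suc n) * expectation (\<lambda>w. ((R n w - 1 - S n w) + z n w)\<^sup>2)"
      proof -
        have "R n w - 1 - S n w + z n w = R n w - 1 - S0 n w" for w by (simp add: S_eq)
        then have eq: "(\<lambda>w. (R n w - 1 - S n w + z n w)\<^sup>2) = (\<lambda>w. (R n w - 1 - S0 n w)\<^sup>2)"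
          by (simp only:)
        show ?thesis unfolding eq a_def b_def right_diff_distrib[symmetric] power_mult_distrib by simp
      qed
      also have "expectation (\<lambda>w. ((R n w - 1 - S n w) + z n w)\<^sup>2) \<le>
          expectation (\<lambda>w. 2 * (R n w - 1 - S n w)\<^sup>2 + 2 * (z n w)\<^sup>2)"
        by (rule integral_mono') (use RS_int z_mom sq in auto)
      also have "\<dots> = 2 * expectation (\<lambda>w. (R n w - 1 - S n w)\<^sup>2) + 4 * (h n (K n))\<^sup>2"
        using RS_int z_mom by simp
      also have "\<dots> \<le> 20 * (\<delta> n * t)\<^sup>2 + 4 * (\<delta> n)\<^sup>2"
      proof -
        have "(q n)\<^sup>2 \<le> (\<delta> n * t)\<^sup>2" by (rule power_mono[OF q_le q0])
        moreover have "(h n (K n))\<^sup>2 \<le> (\<delta> n)\<^sup>2" by (rule power_mono[OF h(2,1)])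
        ultimately show ?thesis using RS(3)[OF q3] by linarith
      qed
      also have "real (Suc n) * (20 * (\<delta> n * t)\<^sup>2 + 4 * (\<delta> n)\<^sup>2) = (20 * (real (Suc n) * \<delta> n) * t\<^sup>2 + 4 * (real (Suc n) * \<delta> n)) * \<delta> n"
        by (simp add: power2_eq_square algebra_simps)
      finally show ?case unfolding N\<delta> by simp
    qed
  qed auto
  define m where "m k = (\<integral>x. \<bar>x\<bar> powr p \<partial>distr std_normal_sequence borel (chi_square_mean k))" for k
  have Ea: "expectation (\<lambda>w. \<bar>a n w\<bar> powr p) = sqrt (2 * T * (real (K n) * \<delta> n)) powr p * m (K n)" for n
  proof -
    have "expectation (\<lambda>w. \<bar>a n w\<bar> powr p) = sqrt (real (Suc n)) powr p * expectation (\<lambda>w. \<bar>S0 n w\<bar> powr p)"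
      unfolding a_def abs_mult by (simp add: powr_mult)
    also have "\<dots> = sqrt (real (Suc n)) powr p * ((\<delta> n * sqrt (2 * real (K n))) powr p * m (K n))"
      unfolding S0_def m_def by (simp only: quadratic_sum_abs_moment[OF \<delta>])
    also have "\<dots> = (sqrt (real (Suc n)) * (\<delta> n * sqrt (2 * real (K n)))) powr p * m (K n)"
      using \<delta>[of n] by (simp add: powr_mult)
    also have "sqrt (real (Suc n)) * (\<delta> n * sqrt (2 * real (K n))) = sqrt (2 * (real (Suc n) * \<delta> n) * (real (K n) * \<delta> n))"
    proof -
      have "\<delta> n = sqrt (\<delta> n * \<delta> n)" using \<delta>[of n] by simp
      then have "sqrt (real (Suc n)) * (\<delta> n * sqrt (2 * real (K n))) = sqrt (real (Suc n)) * (sqrt (\<delta> n * \<delta> n) * sqrt (2 * real (K n)))"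
        by simp
      also have "\<dots> = sqrt (real (Suc n) * (\<delta> n * \<delta> n * (2 * real (K n))))" by (simp only: real_sqrt_mult)
      finally show ?thesis by (simp add: mult_ac)
    qed
    finally show ?thesis unfolding N\<delta> .
  qed
  have "(\<lambda>n. expectation (\<lambda>w. \<bar>a n w\<bar> powr p)) \<longlonglongrightarrow> sqrt (2 * T * t) powr p * (\<integral>x. \<bar>x\<bar> powr p \<partial>std_normal_distribution)"
  \<comment> \<open>For \<open>t = 0\<close> there are no full steps, so \<open>K n\<close> does not
    tend to infinity; both sides are then 0.\<close>
  proof (cases "t = 0")
    case True
    then have "K n = 0" for n by (simp add: K_def)
    then show ?thesis using True by (simp add: Ea)
  next
    case False
    have K\<delta>_lim: "(\<lambda>n. real (K n) * \<delta> n) \<longlonglongrightarrow> t"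
    proof (rule tendsto_sandwich[OF _ _ _ tendsto_const])
      show "(\<lambda>n. t - \<delta> n) \<longlonglongrightarrow> t" using tendsto_diff[OF tendsto_const \<delta>_lim, of t] by simp
      show "eventually (\<lambda>n. t - \<delta> n \<le> real (K n) * \<delta> n) sequentially"
        using K(2) by (intro always_eventually allI) (simp add: distrib_right less_imp_le diff_le_eq add.commute)
      show "eventually (\<lambda>n. real (K n) * \<delta> n \<le> t) sequentially" using K(1) by simp
    qed
    have "filterlim K at_top sequentially"
    proof -
      have "filterlim (\<lambda>n. t / \<delta> n) at_top sequentially"
      proof -
        have "(\<lambda>n. t / \<delta> n) = (\<lambda>n. t / T * real (Suc n))" by (simp add: \<delta>_def fun_eq_iff)
        moreover have "filterlim (\<lambda>n. t / T * real (Suc n)) at_top sequentially"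
          by (rule filterlim_tendsto_pos_mult_at_top[OF tendsto_const _
                filterlim_compose[OF filterlim_real_sequentially filterlim_Suc]]) (use False t T in simp)
        ultimately show ?thesis by simp
      qed
      then show ?thesis unfolding K_def
        by (intro filterlim_compose[OF filterlim_nat_sequentially] filterlim_compose[OF filterlim_floor_sequentially])
    qed
    then have "(\<lambda>n. m (K n)) \<longlonglongrightarrow> (\<integral>x. \<bar>x\<bar> powr p \<partial>std_normal_distribution)"
      using filterlim_compose[OF centered_chi_square_abs_moment[OF p]] by (simp add: m_def)
    then show ?thesis
      unfolding Ea using False t T
      by (intro tendsto_mult tendsto_powr tendsto_real_sqrt tendsto_const K\<delta>_lim) auto
  qed
  from tendsto_add[OF abs_moment_perturbation[OF a_meas b_meas a_int b_int a_bd close p] this]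
  have "(\<lambda>n. expectation (\<lambda>w. \<bar>b n w\<bar> powr p)) \<longlonglongrightarrow> sqrt (2 * T * t) powr p * (\<integral>x. \<bar>x\<bar> powr p \<partial>std_normal_distribution)"
    by simp
  moreover have sqrt_powr: "sqrt x powr p = x powr (p / 2)" if "0 \<le> x" for x
    using that by (simp add: powr_half_sqrt[symmetric] powr_powr)
  moreover have "expectation (\<lambda>w. \<bar>b n w\<bar> powr p) = real (Suc n) powr (p / 2) * expectation (\<lambda>w. \<bar>R n w - 1\<bar> powr p)" for n
    unfolding b_def abs_mult using sqrt_powr[of "real (Suc n)"] by (simp add: powr_mult)
  ultimately show ?thesis using T t by simp
qed

end

section \<open>From the squared norms to the expectations of the test function\<close>

theorem proposition2p3:
  fixes M :: "'a measure" and F :: "real \<Rightarrow> 'a measure" and W :: "real \<Rightarrow> 'a \<Rightarrow> real"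
    and Z :: "real \<Rightarrow> 'a \<Rightarrow> real^2" and Zn :: "nat \<Rightarrow> real \<Rightarrow> 'a \<Rightarrow> real^2"
    and N :: "'b measure" and G :: "'b \<Rightarrow> real"
    and T \<theta> \<alpha> t :: real
  assumes "filtered_prob_space M F"
    and "standard_brownian_motion M F W"
    and "T > 0"
    and "\<theta> \<in> {0..2 * pi}"
    and "circle_sde_solution M F W \<theta> Z"
    and "\<And>n. n \<ge> 1 \<Longrightarrow> circle_euler_scheme M F W Z (T / real n) (Zn n)"
    and "prob_space N"
    and "distributed N lborel G std_normal_density"
    and "\<alpha> \<in> {1/2..1}"
    and "t \<ge> 0"
  shows "(\<lambda>n. real n powr \<alpha> * (\<integral>\<omega>. f_circle \<alpha> (Zn n t \<omega>) - f_circle \<alpha> (Z t \<omega>) \<partial>M))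
           \<longlonglongrightarrow> (2 * T * t) powr \<alpha> * (\<integral>x. \<bar>G x\<bar> powr (2 * \<alpha>) \<partial>N)"
proof -
  interpret brownian_motion_space M F W
    using assms(1,2) by (intro brownian_motion_space.intro brownian_motion_space_axioms.intro)
  note T = \<open>T > 0\<close> and t = \<open>t \<ge> 0\<close>
  have f_eq: "f_circle \<alpha> z = \<bar>(z $ 1)\<^sup>2 + (z $ 2)\<^sup>2 - 1\<bar> powr (2 * \<alpha>)" for z
    by (simp add: f_circle_def norm_vec_def L2_set_def sum_2 real_sqrt_pow2)
  have meas: "(\<lambda>w. f_circle \<alpha> (z t w)) \<in> borel_measurable M"
    if "adapted_process F (\<lambda>s w. z s w $ 1)" "adapted_process F (\<lambda>s w. z s w $ 2)"
    for z :: "real \<Rightarrow> 'a \<Rightarrow> real^2"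
  proof -
    have "(\<lambda>w. z t w $ 1) \<in> borel_measurable M" "(\<lambda>w. z t w $ 2) \<in> borel_measurable M"
      using that t by (auto simp: adapted_process_def intro: measurable_F_M)
    then show ?thesis unfolding f_eq by measurable
  qed
  have Z: "has_ito_differential M F W (\<lambda>t w. Z t w $ 1) (\<lambda>t w. - (1/2) * Z t w $ 1) (\<lambda>t w. - Z t w $ 2)"
    "has_ito_differential M F W (\<lambda>t w. Z t w $ 2) (\<lambda>t w. - (1/2) * Z t w $ 2) (\<lambda>t w. Z t w $ 1)"
    and Z0: "AE w in M. Z 0 w = vector [cos \<theta>, sin \<theta>]"
    using assms(5) by (auto simp: circle_sde_solution_def)
  have Z0_norm: "AE w in M. (Z 0 w $ 1)\<^sup>2 + (Z 0 w $ 2)\<^sup>2 = 1"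
    using Z0 by eventually_elim (simp add: vector_2)
  \<comment> \<open>Since \<open>0 powr (2 * \<alpha>) = 0\<close>, the term with the exact solution
    vanishes almost surely. The time 0 is covered by the initial condition, as the invariance was
    shown for positive times.\<close>
  have Z_norm: "AE w in M. (Z t w $ 1)\<^sup>2 + (Z t w $ 2)\<^sup>2 = 1"
  proof (cases "t = 0")
    case False
    then have "0 < t" using t by simp
    from circle_sde_norm_invariant[OF Z this] Z0_norm show ?thesis by eventually_elim simp
  qed (use Z0_norm in simp)
  have Z_meas: "(\<lambda>w. f_circle \<alpha> (Z t w)) \<in> borel_measurable M"
    by (rule meas) (use Z in \<open>auto simp: has_ito_differential_def\<close>)
  define \<delta> where "\<delta> n = T / real (Suc n)" for n
  define \<sigma> where "\<sigma> n k = min t (real k * \<delta> n)" for n k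
  define K where "K n = nat \<lfloor>t / \<delta> n\<rfloor>" for n
  define R where "R n w = (\<Prod>i<Suc (K n). (1 - (\<sigma> n (Suc i) - \<sigma> n i) / 2)\<^sup>2 + (W (\<sigma> n (Suc i)) w - W (\<sigma> n i) w)\<^sup>2)"
    for n w
  \<comment> \<open>The right-hand side is a genuine expectation and no default value:
    \<open>R n\<close> is square integrable and the exponent is at most 2.\<close>
  have int_eq: "(\<integral>w. f_circle \<alpha> (Zn (Suc n) t w) - f_circle \<alpha> (Z t w) \<partial>M)
    = expectation (\<lambda>w. \<bar>R n w - 1\<bar> powr (2 * \<alpha>))" for n
  proof (rule integral_cong_AE)
    have \<delta>: "0 < \<delta> n" using T by (simp add: \<delta>_def)
    have E: "has_ito_differential M F W (\<lambda>t w. Zn (Suc n) t w $ 1)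
       (\<lambda>t w. - (1/2) * Zn (Suc n) (grid_floor (\<delta> n) t) w $ 1) (\<lambda>t w. - Zn (Suc n) (grid_floor (\<delta> n) t) w $ 2)"
      "has_ito_differential M F W (\<lambda>t w. Zn (Suc n) t w $ 2)
       (\<lambda>t w. - (1/2) * Zn (Suc n) (grid_floor (\<delta> n) t) w $ 2) (\<lambda>t w. Zn (Suc n) (grid_floor (\<delta> n) t) w $ 1)"
      and E0: "AE w in M. Zn (Suc n) 0 w = Z 0 w"
      using assms(6)[of "Suc n"] unfolding circle_euler_scheme_def \<delta>_def by auto
    have "0 \<le> t / \<delta> n" using t \<delta> by simp
    then have "t / \<delta> n < real (Suc (K n))" unfolding K_def by linarith
    then have \<sigma>K: "\<sigma> n (Suc (K n)) = t" using \<delta> by (simp add: \<sigma>_def field_simps)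
    have "AE w in M. (Zn (Suc n) t w $ 1)\<^sup>2 + (Zn (Suc n) t w $ 2)\<^sup>2 =
      ((Zn (Suc n) 0 w $ 1)\<^sup>2 + (Zn (Suc n) 0 w $ 2)\<^sup>2) * R n w"
      using euler_scheme_norm_AE[OF E \<delta> t, of "Suc (K n)"]
      unfolding \<sigma>_def[symmetric] \<sigma>K R_def .
    with Z_norm Z0_norm E0 show "AE w in M. f_circle \<alpha> (Zn (Suc n) t w) - f_circle \<alpha> (Z t w) = \<bar>R n w - 1\<bar> powr (2 * \<alpha>)"
      by eventually_elim (simp add: f_eq)
    have "(\<lambda>w. f_circle \<alpha> (Zn (Suc n) t w)) \<in> borel_measurable M"
      by (rule meas) (use E in \<open>auto simp: has_ito_differential_def\<close>)
    then show "(\<lambda>w. f_circle \<alpha> (Zn (Suc n) t w) - f_circle \<alpha> (Z t w)) \<in> borel_measurable M"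
      using Z_meas by measurable
    have W_meas: "W (\<sigma> n i) \<in> borel_measurable M" for i
      by (rule measurable_F_M[OF W_measurable]) (use t \<delta> in \<open>simp add: \<sigma>_def\<close>)
    have [measurable]: "R n \<in> borel_measurable M"
      unfolding R_def[abs_def]
      by (intro borel_arith_measurable W_meas)
    show "(\<lambda>w. \<bar>R n w - 1\<bar> powr (2 * \<alpha>)) \<in> borel_measurable M" by measurable
  qed
  have G: "(\<integral>x. \<bar>G x\<bar> powr (2 * \<alpha>) \<partial>N) = (\<integral>x. \<bar>x\<bar> powr (2 * \<alpha>) \<partial>std_normal_distribution)"
  proof -
    have "(\<integral>x. \<bar>G x\<bar> powr (2 * \<alpha>) \<partial>N) = (\<integral>x. std_normal_density x * \<bar>x\<bar> powr (2 * \<alpha>) \<partial>lborel)"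
      using distributed_integral[OF assms(8), of "\<lambda>x. \<bar>x\<bar> powr (2 * \<alpha>)"] by simp
    also have "\<dots> = (\<integral>x. \<bar>x\<bar> powr (2 * \<alpha>) \<partial>std_normal_distribution)"
      by (subst integral_density) auto
    finally show ?thesis .
  qed
  have \<alpha>: "1 \<le> 2 * \<alpha>" "2 * \<alpha> \<le> 2" using \<open>\<alpha> \<in> {1/2..1}\<close> by auto
  have "(\<lambda>n. real (Suc n) powr \<alpha> * expectation (\<lambda>w. \<bar>R n w - 1\<bar> powr (2 * \<alpha>)))
    \<longlonglongrightarrow> (2 * T * t) powr \<alpha> * (\<integral>x. \<bar>x\<bar> powr (2 * \<alpha>) \<partial>std_normal_distribution)"
    using euler_norm_error_limit[OF T t \<alpha>] unfolding R_def \<sigma>_def K_def \<delta>_def by simp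
  then have "(\<lambda>n. real (Suc n) powr \<alpha> * (\<integral>w. f_circle \<alpha> (Zn (Suc n) t w) - f_circle \<alpha> (Z t w) \<partial>M))
    \<longlonglongrightarrow> (2 * T * t) powr \<alpha> * (\<integral>x. \<bar>G x\<bar> powr (2 * \<alpha>) \<partial>N)"
    unfolding int_eq G .
  \<comment> \<open>The sequence was shifted by one because the scheme is given only for
    \<open>n \<ge> 1\<close>.\<close>
  then show ?thesis by (rule LIMSEQ_imp_Suc)
qed

end
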